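(* Let $p$ be a prime, $q=p^t$ with $t\geq 1$, and let $V(q^2)$ be a vector space of dimension $n\geq 4$ over $\mathbf{F}_{q^2}$ carrying a nondegenerate Hermitian form. Let $A_{11}$ be the incidence matrix between the singular one-dimensional subspaces of $V(q^2)$ and their polar hyperplanes. There are two cases for the rank, depending on the existence of a positive integer $u$ satisfying $$n-2\leq up\leq p+n-4.$$ If $u$ exists then $$\mathrm{rank}_pA_{11}=1+\left[\binom{n+p-2}{n-1}^2-\binom{n+p-3}{n-1}^2-\binom{up+1}{n-1}^2+\binom{up}{n-1}^2\right]^t.$$ Otherwise, $$\mathrm{rank}_pA_{11}=1+\left[\binom{n+p-2}{n-1}^2-\binom{n+p-3}{n-1}^2\right]^t.$$
   Context: Let $P$ be the set of singular (isotropic) one-dimensional subspaces of $V(q^2)$ with respect to the Hermitian form, and let $P^*$ be the set of polar hyperplanes $\langle v\rangle^\perp$, $\langle v\rangle\in P$. $A_{11}$ is the $0$-$1$ matrix with rows indexed by $P$ and columns indexed by $P^*$, whose entry is $1$ exactly when the one-dimensional subspace is contained in the hyperplane. $\mathrm{rank}_p$ is the rank of the matrix regarded as having entries in the field of $p$ elements. Binomial coefficients $\binom{a}{b}$ with $0\le a<b$ are $0$. *)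

theory Defs
  imports
    "HOL-Library.Cardinality"
    "HOL-Computational_Algebra.Primes"
    "Jordan_Normal_Form.DL_Rank"
begin

text \<open>
  On a field with \<open>q\<^sup>2\<close> elements the involutory automorphism is \<open>x \<mapsto> x ^ q\<close>.
  Forms are linear in the first argument; semilinearity in the second argument follows from
  the symmetry condition.
\<close>

definition hermitian_form ::
    "nat \<Rightarrow> ('a::field \<Rightarrow> 'v::ab_group_add \<Rightarrow> 'v) \<Rightarrow> ('v \<Rightarrow> 'v \<Rightarrow> 'a) \<Rightarrow> bool" where
  "hermitian_form q scale h \<longleftrightarrow>
     (\<forall>w. Vector_Spaces.linear scale (*) (\<lambda>v. h v w)) \<and>
     (\<forall>v w. h w v = h v w ^ q)"

definition nondegenerate :: "('v::ab_group_add \<Rightarrow> 'v \<Rightarrow> 'a::field) \<Rightarrow> bool" where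
  "nondegenerate h \<longleftrightarrow> (\<forall>v. (\<forall>w. h v w = 0) \<longrightarrow> v = 0)"

definition singular_points ::
    "('a::field \<Rightarrow> 'v::ab_group_add \<Rightarrow> 'v) \<Rightarrow> ('v \<Rightarrow> 'v \<Rightarrow> 'a) \<Rightarrow> 'v set set" where
  "singular_points scale h =
     {S. Modules.module.subspace scale S \<and> vector_space.dim scale S = 1 \<and> (\<forall>v\<in>S. h v v = 0)}"

definition perp :: "('v \<Rightarrow> 'v \<Rightarrow> 'a::field) \<Rightarrow> 'v set \<Rightarrow> 'v set" where
  "perp h S = {w. \<forall>v\<in>S. h v w = 0}"

definition polar_hyperplanes ::
    "('a::field \<Rightarrow> 'v::ab_group_add \<Rightarrow> 'v) \<Rightarrow> ('v \<Rightarrow> 'v \<Rightarrow> 'a) \<Rightarrow> 'v set set" where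
  "polar_hyperplanes scale h = perp h ` singular_points scale h"

text \<open>
  Matrices are indexed by natural numbers, so the row and column index sets are presented by
  enumerations \<open>Ps\<close> and \<open>Hs\<close>. The type \<open>'k\<close> is the field in which the \<open>0\<close>-\<open>1\<close> entries are read.
\<close>

definition incidence_matrix :: "'v set list \<Rightarrow> 'v set list \<Rightarrow> 'k::field mat" where
  "incidence_matrix Ps Hs =
     mat (length Ps) (length Hs) (\<lambda>(i, j). if Ps ! i \<subseteq> Hs ! j then 1 else 0)"

end

theory Submission
  imports
    Defs
    "HOL-Library.Function_Algebras"
    "HOL-Library.Poly_Mapping"
    "HOL-Number_Theory.Cong"
begin

text \<open>
  For singular \<open>v\<close>, \<open>w\<close> put \<open>u = h v w * h w v\<close>. The entry of the incidence matrix is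
  \<open>1 - u\<^sup>q\<^sup>-\<^sup>1\<close>, and \<open>q - 1 = (p - 1) (1 + p + \<dots> + p\<^sup>t\<^sup>-\<^sup>1)\<close> turns a factorisation of the kernel \<open>u\<^sup>p\<^sup>-\<^sup>1\<close>
  through \<open>s\<close> functions into one of \<open>u\<^sup>q\<^sup>-\<^sup>1\<close> through the \<open>s\<^sup>t\<close> products of their Frobenius twists.
  A form of bidegree \<open>q - 1\<close> in the coordinates \<open>x\<close> and dual coordinates \<open>z\<close> that vanishes at the
  singular vectors vanishes on the whole quadric \<open>\<sigma> = \<Sum>\<^sub>i x\<^sub>i z\<^sub>i = 0\<close>, and in an affine cell of
  the quadric the forms of bidegree \<open>p - 1\<close> stay independent modulo the \<open>p\<close>-th powers of the
  variables, so the twisted products are independent. A totally isotropic line shows that the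
  constant function adds one to the rank \<open>s\<^sup>t\<close>.

  The column space of \<open>u\<^sup>p\<^sup>-\<^sup>1\<close> is the space of harmonic forms of bidegree \<open>p - 1\<close> modulo the harmonic
  multiples of \<open>\<sigma>\<close>. By the commutator relation between the Laplacian and powers of \<open>\<sigma>\<close>, these multiples are
  \<open>\<sigma>\<^sup>p\<^sup>-\<^sup>1\<^sup>-\<^sup>m\<close> times the harmonic forms of bidegree \<open>m\<close> with \<open>m < p - 1\<close> and \<open>p\<close> dividing \<open>n + m - 2\<close>; the
  multiple \<open>n + m - 2\<close> is the number \<open>up\<close> of the theorem.
\<close>

section \<open>Finite fields\<close>

text \<open>The dual coordinates \<open>z\<close> are conjugate-linear in the vector, so along a
  line \<open>x\<close> moves with a parameter \<open>\<mu>\<close> and \<open>z\<close> with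
  \<open>\<mu> ^ q\<close>. The exponents \<open>i + q * j\<close> with \<open>i, j < q\<close> are
  distinct and smaller than the order of the field; hence in bidegree \<open>q - 1\<close> the two
  parameters act as independent variables. This is why the Hermitian variety can be replaced by the
  quadric. The obstacle on the quadric is that its coordinate ring is not a polynomial ring. On the
  cell \<open>x\<^sub>0 = z\<^sub>1 = 1\<close> one coordinate can be eliminated; there the ideal of
  \<open>p\<close>-th powers of the variables is monomial and can be studied through weights of
  monomials. The forms of bidegree \<open>m\<close> number
  \<open>binomial(n + m - 1, n - 1)\<^sup>2\<close> in dimension, their multiples of
  \<open>\<sigma>\<close> \<open>binomial(n + m - 2, n - 1)\<^sup>2\<close>, and for
  \<open>m < p\<close> the harmonic forms account for the difference. Bidegree \<open>p - 1\<close>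
  yields the two main terms of the formula, bidegree \<open>u * p - n + 2\<close> the two
  corrections. Dimensions are read off from cardinalities, as a space over a finite field has a
  power of the field order as its size.\<close>

lemma finite_field_power_card:
  fixes x :: "'a::{field,finite}"
  shows "x ^ CARD('a) = x"
proof (cases "x = 0")
  case False
  have "x * (\<Prod>y\<in>UNIV-{0}. x * y) = x * x ^ (CARD('a) - 1) * \<Prod>(UNIV-{0})"
    by (simp add: prod.distrib mult_ac)
  also have "x * x ^ (CARD('a) - 1) = x ^ CARD('a)"
    by (metis power_Suc Suc_diff_1 zero_less_card_finite)
  also have "(\<Prod>y\<in>UNIV-{0}. x * y) = (\<Prod>y\<in>UNIV-{0}. y)"
    by (rule prod.reindex_bij_witness[of _ "\<lambda>y. y / x" "\<lambda>y. x * y"]) (use False in auto)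
  finally show ?thesis by simp
qed simp

lemma finite_field_card_ge_2: "CARD('a::{field,finite}) \<ge> 2"
proof -
  have "card {0, 1::'a} \<le> CARD('a)" by (rule card_mono) auto
  then show ?thesis by simp
qed

lemma finite_field_power_card_minus_1:
  fixes x :: "'a::{field,finite}"
  assumes "x \<noteq> 0"
  shows "x ^ (CARD('a) - 1) = 1"
proof -
  have "x * x ^ (CARD('a) - 1) = x * 1"
    using finite_field_power_card[of x] by (metis Suc_diff_1 mult.right_neutral power_Suc zero_less_card_finite)
  then show ?thesis using assms by simp
qed

lemma finite_field_of_nat_card: "of_nat (CARD('a)) = (0::'a::{field,finite})"
proof -
  have "(\<Sum>x\<in>(UNIV::'a set). x + 1) = (\<Sum>x\<in>UNIV. x)"
    by (rule sum.reindex_bij_witness[of _ "\<lambda>x. x - 1" "\<lambda>x. x + 1"]) auto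
  then show ?thesis by (simp add: sum.distrib)
qed

lemma finite_field_CHAR:
  assumes "prime p" "CARD('a::{field,finite}) = p ^ k"
  shows "CHAR('a) = p"
proof -
  have "CHAR('a) dvd p ^ k"
    using finite_field_of_nat_card[where 'a='a] assms(2) of_nat_eq_0_iff_char_dvd by metis
  moreover have "CHAR('a) > 0" by (rule finite_imp_CHAR_pos) simp
  then have "prime (CHAR('a))" by (rule prime_CHAR_semidom)
  ultimately show ?thesis
    using assms(1) prime_dvd_power primes_dvd_imp_eq by blast
qed

lemma poly_eq_0_finite_field:
  fixes P :: "'a::{field,finite} poly"
  assumes "degree P < CARD('a)" "\<And>x. poly P x = 0"
  shows "P = 0"
proof (rule ccontr)
  assume "P \<noteq> 0"
  then have "card {x. poly P x = 0} \<le> degree P" by (rule card_poly_roots_bound)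
  then show False using assms by simp
qed

text \<open>Replacing the summation variable by \<open>a\<close> times itself multiplies the sum by
  \<open>a ^ k\<close>. Some nonzero \<open>a\<close> has \<open>a ^ k \<noteq> 1\<close>: the
  remainder \<open>r\<close> of \<open>k\<close> is positive and smaller than the number of nonzero
  elements, whereas \<open>x ^ r - 1\<close> has at most \<open>r\<close> roots.\<close>

lemma finite_field_sum_powers:
  assumes "\<not> (CARD('a::{field,finite}) - 1) dvd k"
  shows "(\<Sum>x\<in>(UNIV::'a set). x ^ k) = 0"
proof -
  let ?N = "CARD('a) - 1"
  define r where "r = k mod ?N"
  have r0: "0 < r" using assms unfolding r_def by (simp add: dvd_eq_mod_eq_0)
  have N: "?N > 0" using finite_field_card_ge_2[where 'a='a] by simp
  have rN: "r < ?N" using N unfolding r_def by simp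
  define P :: "'a poly" where "P = monom 1 r - 1"
  have "degree (monom (1::'a) r + (- 1)) = degree (monom (1::'a) r)"
    by (rule degree_add_eq_left) (use r0 in \<open>simp add: degree_monom_eq\<close>)
  then have deg: "degree P = r" unfolding P_def by (simp add: degree_monom_eq)
  have "P \<noteq> 0" using deg r0 by auto
  then have le: "card {x. poly P x = 0} \<le> r" using card_poly_roots_bound[of P] deg by simp
  have "\<exists>a::'a. a \<noteq> 0 \<and> a ^ r \<noteq> 1"
  proof (rule ccontr)
    assume "\<nexists>a::'a. a \<noteq> 0 \<and> a ^ r \<noteq> 1"
    then have one: "a ^ r = 1" if "a \<noteq> 0" for a :: 'a using that by blast
    have "UNIV - {0} \<subseteq> {x. poly P x = 0}" unfolding P_def by (auto simp: poly_monom one)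
    then have "card (UNIV - {0::'a}) \<le> card {x. poly P x = 0}" by (intro card_mono) auto
    then show False using le rN by (simp add: card_Diff_subset)
  qed
  then obtain a :: 'a where a: "a \<noteq> 0" "a ^ r \<noteq> 1" by blast
  have ak: "a ^ k = a ^ r"
  proof -
    have "a ^ k = a ^ (?N * (k div ?N) + r)" unfolding r_def by (simp only: mult_div_mod_eq)
    then show ?thesis using finite_field_power_card_minus_1[OF a(1)]
      by (simp add: power_add power_mult)
  qed
  have "(\<Sum>x\<in>(UNIV::'a set). x ^ k) = (\<Sum>x\<in>(UNIV::'a set). (a * x) ^ k)"
    by (rule sum.reindex_bij_witness[of _ "\<lambda>x. a * x" "\<lambda>x. x / a"]) (use a in auto)
  also have "\<dots> = a ^ r * (\<Sum>x\<in>(UNIV::'a set). x ^ k)"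
    by (simp add: power_mult_distrib sum_distrib_left ak)
  finally have "(1 - a ^ r) * (\<Sum>x\<in>(UNIV::'a set). x ^ k) = 0" by (simp add: algebra_simps)
  then show ?thesis using a(2) by simp
qed

lemma finite_field_sum_power_card_minus_1:
  "(\<Sum>x\<in>(UNIV::'a::{field,finite} set). x ^ (CARD('a) - 1)) = -1"
proof -
  have N: "CARD('a) - 1 > 0" using finite_field_card_ge_2[where 'a='a] by simp
  have "(\<Sum>x\<in>(UNIV::'a set). x ^ (CARD('a) - 1)) = (\<Sum>x\<in>UNIV - {0::'a}. x ^ (CARD('a) - 1))"
    by (rule sum.mono_neutral_right) (use N in \<open>auto simp: zero_power\<close>)
  also have "\<dots> = (\<Sum>x\<in>UNIV - {0::'a}. 1)"
    by (rule sum.cong, simp, rule finite_field_power_card_minus_1, simp)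
  also have "\<dots> = of_nat (CARD('a) - 1)" by (simp add: card_Diff_subset)
  also have "\<dots> = of_nat (CARD('a)) - 1" using N by (subst of_nat_diff) auto
  finally show ?thesis by (simp add: finite_field_of_nat_card)
qed

text \<open>Multiplying by the monomial complementary to \<open>m\<close> and summing over all
  points isolates the coefficient of \<open>m\<close>, because a power sum factor vanishes for every
  other monomial.\<close>

lemma monomials_independent_finite_field:
  fixes a :: "'e \<Rightarrow> 'a::{field,finite}" and ex :: "'e \<Rightarrow> 'i \<Rightarrow> nat"
  assumes I: "finite I" and S: "finite S"
    and lt: "\<And>m i. m \<in> S \<Longrightarrow> i \<in> I \<Longrightarrow> ex m i < CARD('a) - 1"
    and inj: "\<And>m m'. m \<in> S \<Longrightarrow> m' \<in> S \<Longrightarrow> (\<And>i. i \<in> I \<Longrightarrow> ex m i = ex m' i) \<Longrightarrow> m = m'"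
    and zero: "\<And>x. (\<Sum>m\<in>S. a m * (\<Prod>i\<in>I. x i ^ ex m i)) = 0"
    and m: "m \<in> S"
  shows "a m = 0"
proof -
  let ?N = "CARD('a) - 1"
  have prd: "(\<Prod>i\<in>I. \<Sum>x\<in>(UNIV::'a set). x ^ (ex m' i + (?N - ex m i))) = (if m' = m then (-1) ^ card I else 0)"
    if m': "m' \<in> S" for m'
  proof (cases "m' = m")
    case True
    have "(\<Sum>x\<in>(UNIV::'a set). x ^ (ex m' i + (?N - ex m i))) = -1" if "i \<in> I" for i
      using lt[OF m that] True finite_field_sum_power_card_minus_1[where 'a='a] by simp
    then show ?thesis using True by simp
  next
    case False
    then obtain i where i: "i \<in> I" "ex m i \<noteq> ex m' i" using inj[OF m' m] by metis
    have "\<not> ?N dvd ex m' i + (?N - ex m i)"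
    proof
      assume "?N dvd ex m' i + (?N - ex m i)"
      then obtain c where c: "ex m' i + (?N - ex m i) = ?N * c" by (elim dvdE)
      \<comment> \<open>The exponent lies strictly between \<open>0\<close> and
        \<open>2 * ?N\<close>, so as a multiple of \<open>?N\<close> it would be \<open>?N\<close>
        itself, which means equal exponents.\<close>
      have "ex m' i + (?N - ex m i) < ?N * 2" "ex m' i + (?N - ex m i) > 0"
        using lt[OF m i(1)] lt[OF m' i(1)] by auto
      then have "c < 2" "0 < c" unfolding c by (simp_all add: mult_less_cancel1 mult.commute)
      then have "c = 1" by simp
      then show False using c i lt[OF m i(1)] by simp
    qed
    then have "(\<Sum>x\<in>(UNIV::'a set). x ^ (ex m' i + (?N - ex m i))) = 0" by (rule finite_field_sum_powers)
    then show ?thesis using False i(1) I by (simp add: prod_zero_iff) blast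
  qed
  have "0 = (\<Sum>x\<in>PiE I (\<lambda>_. UNIV). (\<Sum>m'\<in>S. a m' * (\<Prod>i\<in>I. x i ^ ex m' i)) * (\<Prod>i\<in>I. x i ^ (?N - ex m i)))"
    using zero by simp
  also have "\<dots> = (\<Sum>x\<in>PiE I (\<lambda>_. UNIV). \<Sum>m'\<in>S. a m' * (\<Prod>i\<in>I. x i ^ (ex m' i + (?N - ex m i))))"
    by (simp add: sum_distrib_right sum_distrib_left power_add prod.distrib mult_ac)
  also have "\<dots> = (\<Sum>m'\<in>S. a m' * (\<Sum>x\<in>PiE I (\<lambda>_. UNIV). (\<Prod>i\<in>I. x i ^ (ex m' i + (?N - ex m i)))))"
    by (subst sum.swap) (simp add: sum_distrib_left)
  also have "\<dots> = (\<Sum>m'\<in>S. a m' * (\<Prod>i\<in>I. \<Sum>x\<in>(UNIV::'a set). x ^ (ex m' i + (?N - ex m i))))"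
    by (subst prod_sum_PiE) (use I in auto)
  also have "\<dots> = (\<Sum>m'\<in>S. a m' * (if m' = m then (-1) ^ card I else 0))"
    using prd by (intro sum.cong) auto
  also have "\<dots> = a m * (-1) ^ card I" using m S by (simp add: if_distrib cong: if_cong)
  finally show ?thesis by simp
qed

section \<open>Linear algebra over a finite field by counting\<close>

text \<open>Arrays are total functions with default value zero off the index set; equality of arrays
  is then equality of functions, and addition is the pointwise one.\<close>

definition fspace :: "'i set \<Rightarrow> ('i \<Rightarrow> 'a::zero) set" where
  "fspace I = {c. \<forall>i. i \<notin> I \<longrightarrow> c i = 0}"

definition lin_subspace :: "('i \<Rightarrow> 'a::field) set \<Rightarrow> bool" where
  "lin_subspace S \<longleftrightarrow> 0 \<in> S \<and> (\<forall>x\<in>S. \<forall>y\<in>S. x + y \<in> S) \<and> (\<forall>a. \<forall>x\<in>S. (\<lambda>i. a * x i) \<in> S)"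

lemma lin_subspaceD:
  assumes "lin_subspace S"
  shows "0 \<in> S" "\<And>x y. x \<in> S \<Longrightarrow> y \<in> S \<Longrightarrow> x + y \<in> S" "\<And>a x. x \<in> S \<Longrightarrow> (\<lambda>i. a * x i) \<in> S"
    "\<And>x y. x \<in> S \<Longrightarrow> y \<in> S \<Longrightarrow> x - y \<in> S"
    "\<And>(f :: 'k \<Rightarrow> _) K. (\<And>k. k \<in> K \<Longrightarrow> f k \<in> S) \<Longrightarrow> sum f K \<in> S"
proof -
  show 1: "0 \<in> S" "\<And>x y. x \<in> S \<Longrightarrow> y \<in> S \<Longrightarrow> x + y \<in> S" "\<And>a x. x \<in> S \<Longrightarrow> (\<lambda>i. a * x i) \<in> S"
    using assms unfolding lin_subspace_def by auto
  show "x - y \<in> S" if "x \<in> S" "y \<in> S" for x y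
  proof -
    have "x - y = x + (\<lambda>i. (-1) * y i)" by (auto simp: fun_eq_iff)
    then show ?thesis using 1 that by metis
  qed
  show "sum f K \<in> S" if "\<And>k. k \<in> K \<Longrightarrow> f k \<in> S" for f :: "'k \<Rightarrow> _" and K
    using that by (induction K rule: infinite_finite_induct) (auto intro: 1)
qed

lemma fspaceD: "c \<in> fspace I \<Longrightarrow> i \<notin> I \<Longrightarrow> c i = 0"
  unfolding fspace_def by auto

lemma lin_subspace_fspace: "lin_subspace (fspace I)"
  unfolding lin_subspace_def fspace_def by auto

lemma bij_fspace: "bij_betw (\<lambda>f i. if i \<in> I then f i else 0) (PiE I (\<lambda>_. UNIV)) (fspace I)"
  by (rule bij_betwI[where g = "\<lambda>c. restrict c I"])
     (auto simp: fspace_def fun_eq_iff PiE_def extensional_def)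

lemma card_fspace:
  assumes "finite I"
  shows "card (fspace I :: ('i \<Rightarrow> 'a::{field,finite}) set) = CARD('a) ^ card I"
  using bij_betw_same_card[OF bij_fspace[of I, where 'b='a]] card_PiE[OF assms, of "\<lambda>_. UNIV::'a set"] by simp

lemma finite_fspace:
  assumes "finite I"
  shows "finite (fspace I :: ('i \<Rightarrow> 'a::{field,finite}) set)"
  using bij_betw_finite[OF bij_fspace[of I, where 'b='a]] finite_PiE[OF assms, of "\<lambda>_. UNIV::'a set"] by simp

text \<open>Counting form of rank and nullity: every nonempty fibre is a translate of the
  kernel.\<close>

lemma card_additive_image:
  fixes \<phi> :: "'x::ab_group_add \<Rightarrow> 'y::ab_group_add"
  assumes fin: "finite S" and S: "0 \<in> S" "\<And>x y. x \<in> S \<Longrightarrow> y \<in> S \<Longrightarrow> x + y \<in> S" "\<And>x y. x \<in> S \<Longrightarrow> y \<in> S \<Longrightarrow> x - y \<in> S"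
    and \<phi>: "\<And>x y. x \<in> S \<Longrightarrow> y \<in> S \<Longrightarrow> \<phi> (x + y) = \<phi> x + \<phi> y"
  shows "card S = card (\<phi> ` S) * card {x\<in>S. \<phi> x = 0}"
proof -
  have \<phi>m: "\<phi> (x - y) = \<phi> x - \<phi> y" if "x \<in> S" "y \<in> S" for x y
    using \<phi>[of "x - y" y] S(3)[OF that] that by (simp add: algebra_simps)
  have "card S = card (\<Union>y\<in>\<phi> ` S. {x\<in>S. \<phi> x = y})" by (rule arg_cong[where f=card]) auto
  also have "\<dots> = (\<Sum>y\<in>\<phi> ` S. card {x\<in>S. \<phi> x = y})"
    by (rule card_UN_disjoint) (use fin in auto)
  also have "\<dots> = (\<Sum>y\<in>\<phi> ` S. card {x\<in>S. \<phi> x = 0})"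
  proof (rule sum.cong, simp)
    fix y assume "y \<in> \<phi> ` S"
    then obtain x0 where x0: "x0 \<in> S" "y = \<phi> x0" by auto
    have "bij_betw (\<lambda>x. x - x0) {x\<in>S. \<phi> x = y} {x\<in>S. \<phi> x = 0}"
      by (rule bij_betwI[where g="\<lambda>x. x + x0"]) (use S \<phi> \<phi>m x0 in auto)
    then show "card {x\<in>S. \<phi> x = y} = card {x\<in>S. \<phi> x = 0}" by (rule bij_betw_same_card)
  qed
  finally show ?thesis by simp
qed

lemma card_functional_kernel:
  fixes \<phi> :: "('i \<Rightarrow> 'a::{field,finite}) \<Rightarrow> 'a"
  assumes fin: "finite S" and S: "lin_subspace S"
    and add: "\<And>x y. x \<in> S \<Longrightarrow> y \<in> S \<Longrightarrow> \<phi> (x + y) = \<phi> x + \<phi> y"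
    and sc: "\<And>a x. x \<in> S \<Longrightarrow> \<phi> (\<lambda>i. a * x i) = a * \<phi> x"
    and x0: "x0 \<in> S" "\<phi> x0 \<noteq> 0"
  shows "card S = CARD('a) * card {x\<in>S. \<phi> x = 0}"
proof -
  have "\<phi> ` S = UNIV"
  proof -
    have "y \<in> \<phi> ` S" for y
      using sc[OF x0(1), of "y / \<phi> x0"] x0 lin_subspaceD(3)[OF S x0(1), of "y / \<phi> x0"]
      by (metis imageI nonzero_mult_div_cancel_right times_divide_eq_left)
    then show ?thesis by auto
  qed
  then show ?thesis
    using card_additive_image[of S \<phi>] fin add lin_subspaceD[OF S] by auto
qed

definition perp_in :: "'i set \<Rightarrow> ('i \<Rightarrow> 'a::comm_ring) set \<Rightarrow> ('i \<Rightarrow> 'a) set" where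
  "perp_in I S = {c \<in> fspace I. \<forall>d\<in>S. (\<Sum>i\<in>I. c i * d i) = 0}"

text \<open>Count the pairs \<open>(c, d)\<close> with \<open>d \<in> S\<close> and \<open>c\<close> orthogonal to \<open>d\<close> in two ways.\<close>

lemma card_perp_in:
  fixes S :: "('i \<Rightarrow> 'a::{field,finite}) set"
  assumes I: "finite I" and S: "lin_subspace S" "S \<subseteq> fspace I"
  shows "card S * card (perp_in I S) = CARD('a) ^ card I"
proof -
  let ?Q = "CARD('a)" and ?b = "\<lambda>c d. (\<Sum>i\<in>I. c i * d i) :: 'a"
  let ?V = "fspace I :: ('i \<Rightarrow> 'a) set"
  have finV: "finite ?V" by (rule finite_fspace[OF I])
  have finS: "finite S" using finV S(2) finite_subset by blast
  have Sperp: "perp_in I S \<subseteq> ?V" unfolding perp_in_def by auto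
  have Q: "?Q > 0" by simp
  have cardV: "card ?V = ?Q ^ card I" by (rule card_fspace[OF I])
  have byd: "?Q * card {c\<in>?V. ?b c d = 0} = (if d = 0 then ?Q * card ?V else card ?V)" if d: "d \<in> S" for d
  proof (cases "d = 0")
    case False
    then obtain i where i: "d i \<noteq> 0" by (auto simp: fun_eq_iff)
    then have iI: "i \<in> I" using d S(2) unfolding fspace_def by auto
    have "(\<lambda>j. if j = i then 1 else 0) \<in> ?V" using iI unfolding fspace_def by auto
    moreover have "?b (\<lambda>j. if j = i then 1 else 0) d \<noteq> 0" using i iI I by (simp add: if_distrib[of "\<lambda>x. x * _"] cong: if_cong)
    ultimately have "card ?V = ?Q * card {c\<in>?V. ?b c d = 0}"
      by (intro card_functional_kernel[OF finV lin_subspace_fspace, where \<phi>="\<lambda>c. ?b c d"])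
         (auto simp: sum.distrib algebra_simps sum_distrib_left)
    then show ?thesis using False by simp
  qed simp
  have byc: "?Q * card {d\<in>S. ?b c d = 0} = (if c \<in> perp_in I S then ?Q * card S else card S)" if c: "c \<in> ?V" for c
  proof (cases "c \<in> perp_in I S")
    case True
    then have "{d\<in>S. ?b c d = 0} = S" unfolding perp_in_def by auto
    then show ?thesis using True by simp
  next
    case False
    then obtain d where d: "d \<in> S" "?b c d \<noteq> 0" using c unfolding perp_in_def by auto
    have "card S = ?Q * card {d\<in>S. ?b c d = 0}"
      by (rule card_functional_kernel[OF finS S(1), where \<phi>="\<lambda>d. ?b c d"])
         (use d in \<open>auto simp: sum.distrib algebra_simps sum_distrib_left\<close>)
    then show ?thesis using False by simp
  qed
  have "(\<Sum>d\<in>S. card {c\<in>?V. ?b c d = 0}) = (\<Sum>c\<in>?V. card {d\<in>S. ?b c d = 0})"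
    using sum.swap[of "\<lambda>d c. if ?b c d = 0 then 1 else (0::nat)" ?V S] finV finS
    by (simp add: sum.If_cases Int_def)
  then have "(\<Sum>d\<in>S. ?Q * card {c\<in>?V. ?b c d = 0}) = (\<Sum>c\<in>?V. ?Q * card {d\<in>S. ?b c d = 0})"
    by (simp add: sum_distrib_left[symmetric])
  then have eq: "(\<Sum>d\<in>S. if d = 0 then ?Q * card ?V else card ?V) = (\<Sum>c\<in>?V. if c \<in> perp_in I S then ?Q * card S else card S)"
    using byd byc by simp
  have l: "(\<Sum>d\<in>S. if d = 0 then ?Q * card ?V else card ?V) + card ?V = ?Q * card ?V + card S * card ?V"
  proof -
    have "(\<Sum>d\<in>S. if d = 0 then ?Q * card ?V else card ?V) = ?Q * card ?V + (\<Sum>d\<in>S - {0}. card ?V)"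
      using lin_subspaceD(1)[OF S(1)] finS by (subst sum.remove[of _ 0]) auto
    moreover have "(\<Sum>d\<in>S - {0}. card ?V) + card ?V = card S * card ?V"
      using sum.remove[OF finS lin_subspaceD(1)[OF S(1)], of "\<lambda>_. card ?V"] by simp
    ultimately show ?thesis by simp
  qed
  have r: "(\<Sum>c\<in>?V. if c \<in> perp_in I S then ?Q * card S else card S) + card (perp_in I S) * card S
      = card (perp_in I S) * (?Q * card S) + card ?V * card S"
  proof -
    have "(\<Sum>c\<in>?V. if c \<in> perp_in I S then ?Q * card S else card S)
        = (\<Sum>c\<in>perp_in I S. ?Q * card S) + (\<Sum>c\<in>?V - perp_in I S. card S)"
      using finV Sperp by (simp add: sum.If_cases Int_absorb1 Diff_eq Int_commute)
    moreover have "(\<Sum>c\<in>?V - perp_in I S. card S) + card (perp_in I S) * card S = card ?V * card S"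
      using sum.subset_diff[OF Sperp finV, of "\<lambda>_. card S"] by simp
    ultimately show ?thesis by simp
  qed
  have "?Q * card ?V + card S * card ?V + card (perp_in I S) * card S
      = card (perp_in I S) * (?Q * card S) + card ?V * card S + card ?V"
    using l r eq by linarith
  then have "?Q * card ?V + card S * card (perp_in I S) = ?Q * (card S * card (perp_in I S)) + card ?V"
    by (simp add: mult_ac)
  then have "int ?Q * int (card ?V) + int (card S * card (perp_in I S)) = int ?Q * int (card S * card (perp_in I S)) + int (card ?V)"
    by (metis of_nat_add of_nat_mult)
  then have "(int ?Q - 1) * (int (card ?V) - int (card S * card (perp_in I S))) = 0"
    by (simp add: algebra_simps)
  moreover have "int ?Q - 1 \<noteq> 0" using finite_field_card_ge_2[where 'a='a] by simp
  ultimately have "int (card ?V) = int (card S * card (perp_in I S))"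
    by simp
  then show ?thesis using cardV by linarith
qed

section \<open>Independent families of functions, their spans and dual families\<close>

definition lin_indep :: "'x set \<Rightarrow> 'i set \<Rightarrow> ('i \<Rightarrow> 'x \<Rightarrow> 'a::field) \<Rightarrow> bool" where
  "lin_indep X I f \<longleftrightarrow> (\<forall>a. (\<forall>x\<in>X. (\<Sum>i\<in>I. a i * f i x) = 0) \<longrightarrow> (\<forall>i\<in>I. a i = 0))"

text \<open>The value zero outside \<open>X\<close> makes functions with the same restriction to
  \<open>X\<close> equal, so that the size of the range measures the span on
  \<open>X\<close>.\<close>

definition lin_comb :: "'x set \<Rightarrow> 'i set \<Rightarrow> ('i \<Rightarrow> 'x \<Rightarrow> 'a::field) \<Rightarrow> ('i \<Rightarrow> 'a) \<Rightarrow> 'x \<Rightarrow> 'a" where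
  "lin_comb X I f a = (\<lambda>x. if x \<in> X then \<Sum>i\<in>I. a i * f i x else 0)"

lemma lin_indepD: "lin_indep X I f \<Longrightarrow> (\<And>x. x \<in> X \<Longrightarrow> (\<Sum>i\<in>I. a i * f i x) = 0) \<Longrightarrow> i \<in> I \<Longrightarrow> a i = 0"
  unfolding lin_indep_def by blast

lemma card_range_lin_comb:
  fixes f :: "'i \<Rightarrow> 'x \<Rightarrow> 'a::{field,finite}"
  assumes "finite I" "lin_indep X I f"
  shows "card (range (lin_comb X I f)) = CARD('a) ^ card I"
proof -
  have "range (lin_comb X I f) = lin_comb X I f ` fspace I"
  proof -
    have "lin_comb X I f a = lin_comb X I f (\<lambda>i. if i \<in> I then a i else 0)" for a
      unfolding lin_comb_def by (auto intro!: ext sum.cong)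
    moreover have "(\<lambda>i. if i \<in> I then a i else 0) \<in> fspace I" for a :: "'i \<Rightarrow> 'a"
      unfolding fspace_def by auto
    ultimately show ?thesis by blast
  qed
  moreover have "inj_on (lin_comb X I f) (fspace I)"
  proof (rule inj_onI)
    fix a b assume ab: "a \<in> fspace I" "b \<in> fspace I" "lin_comb X I f a = lin_comb X I f b"
    have "(\<Sum>i\<in>I. (a i - b i) * f i x) = 0" if "x \<in> X" for x
      using fun_cong[OF ab(3), of x] that by (simp add: lin_comb_def algebra_simps sum_subtractf)
    then have "a i - b i = 0" if "i \<in> I" for i
      by (rule lin_indepD[OF assms(2), where a="\<lambda>i. a i - b i"]) (use that in auto)
    then have "a i = b i" if "i \<in> I" for i using that by simp
    then show "a = b" using ab(1,2) unfolding fspace_def by (intro ext) force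
  qed
  ultimately show ?thesis using card_image card_fspace[OF assms(1), where 'a='a] by metis
qed

text \<open>Weights on the points give vectors of weighted values. A vector orthogonal to all of
  these is a linear relation among the \<open>f i\<close>, hence zero; by
  \<open>card_perp_in\<close> every vector is attained, in particular the unit vectors.\<close>

lemma lin_indep_dual:
  fixes f :: "'i \<Rightarrow> 'x \<Rightarrow> 'a::{field,finite}"
  assumes I: "finite I" and X: "finite X" and li: "lin_indep X I f"
  shows "\<exists>w. \<forall>i\<in>I. \<forall>j\<in>I. (\<Sum>x\<in>X. w i x * f j x) = (if i = j then 1 else 0)"
proof -
  define T where "T = (\<lambda>w::'x \<Rightarrow> 'a. \<lambda>i. if i \<in> I then \<Sum>x\<in>X. w x * f i x else 0)"
  have "lin_subspace (range T)"
    unfolding lin_subspace_def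
  proof (intro conjI ballI allI)
    have "T (\<lambda>_. 0) = 0" unfolding T_def by (auto simp: fun_eq_iff)
    then show "0 \<in> range T" by (metis rangeI)
    fix y z assume "y \<in> range T" "z \<in> range T"
    then obtain u v where "y = T u" "z = T v" by auto
    then have "y + z = T (\<lambda>x. u x + v x)" unfolding T_def by (auto simp: fun_eq_iff sum.distrib algebra_simps)
    then show "y + z \<in> range T" by simp
  next
    fix a y assume "y \<in> range T"
    then obtain u where "y = T u" by auto
    then have "(\<lambda>i. a * y i) = T (\<lambda>x. a * u x)" unfolding T_def by (auto simp: fun_eq_iff sum_distrib_left mult_ac)
    then show "(\<lambda>i. a * y i) \<in> range T" by simp
  qed
  moreover have sub: "range T \<subseteq> fspace I" unfolding T_def fspace_def by auto
  ultimately have "card (range T) * card (perp_in I (range T)) = CARD('a) ^ card I"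
    by (rule card_perp_in[OF I])
  moreover have "perp_in I (range T) = {0}"
  proof (intro subset_antisym subsetI)
    fix c assume c: "c \<in> perp_in I (range T)"
    have "(\<Sum>i\<in>I. c i * f i x) = 0" if x: "x \<in> X" for x
    proof -
      have "(\<Sum>i\<in>I. c i * T (\<lambda>y. if y = x then 1 else 0) i) = 0" using c unfolding perp_in_def by auto
      moreover have "T (\<lambda>y. if y = x then 1 else 0) i = f i x" if "i \<in> I" for i
        using that x X unfolding T_def by (simp add: if_distrib[of "\<lambda>x. x * _"] cong: if_cong)
      ultimately show ?thesis by simp
    qed
    then have "c i = 0" if "i \<in> I" for i using lin_indepD[OF li] that by blast
    then show "c \<in> {0}" using c unfolding perp_in_def fspace_def by (auto simp: fun_eq_iff)
  qed (auto simp: perp_in_def fspace_def)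
  ultimately have "card (range T) = card (fspace I :: ('i \<Rightarrow> 'a) set)" using card_fspace[OF I, where 'a='a] by simp
  then have rT: "range T = fspace I" using card_subset_eq[OF finite_fspace[OF I] sub] by simp
  have "\<exists>w. \<forall>j\<in>I. (\<Sum>x\<in>X. w x * f j x) = (if i = j then 1 else 0)" if "i \<in> I" for i
  proof -
    have "(\<lambda>j. if j = i then 1 else 0) \<in> range T" unfolding rT fspace_def using that by auto
    then obtain w where "T w = (\<lambda>j. if j = i then 1 else 0)" by auto
    then have "\<forall>j\<in>I. (\<Sum>x\<in>X. w x * f j x) = (if i = j then 1 else 0)"
      unfolding T_def by (metis (full_types))
    then show ?thesis by blast
  qed
  then show ?thesis by metis
qed

lemma lin_indep_maximal_subfamily:
  fixes f :: "'i \<Rightarrow> 'x \<Rightarrow> 'a::field"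
  assumes I: "finite I"
  shows "\<exists>J\<subseteq>I. lin_indep X J f \<and> (\<forall>i\<in>I. \<exists>a. \<forall>x\<in>X. f i x = (\<Sum>j\<in>J. a j * f j x))"
proof -
  define A where "A = {J. J \<subseteq> I \<and> lin_indep X J f}"
  have "finite A" "{} \<in> A" using I unfolding A_def lin_indep_def by auto
  then obtain J where J: "J \<in> A" "\<And>K. K \<in> A \<Longrightarrow> J \<subseteq> K \<Longrightarrow> K = J"
    using finite_has_maximal2[of A "{}"] by metis
  have "\<exists>a. \<forall>x\<in>X. f i x = (\<Sum>j\<in>J. a j * f j x)" if i: "i \<in> I" for i
  proof (cases "i \<in> J")
    case True
    have "finite J" using J(1) I finite_subset unfolding A_def by auto
    then have "f i x = (\<Sum>j\<in>J. (if j = i then 1 else 0) * f j x)" for x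
      using True by (simp add: if_distrib[of "\<lambda>x. x * _"] cong: if_cong)
    then show ?thesis by (intro exI[of _ "\<lambda>j. if j = i then 1 else 0"] ballI)
  next
    case False
    have fJ: "finite J" using J(1) I finite_subset unfolding A_def by auto
    have "insert i J \<notin> A" using J(2) False by blast
    then have "\<not> lin_indep X (insert i J) f" using i J(1) unfolding A_def by auto
    then obtain a where a: "\<And>x. x \<in> X \<Longrightarrow> (\<Sum>j\<in>insert i J. a j * f j x) = 0" and nz: "\<exists>j\<in>insert i J. a j \<noteq> 0"
      unfolding lin_indep_def by blast
    have a': "a i * f i x + (\<Sum>j\<in>J. a j * f j x) = 0" if "x \<in> X" for x
      using a[OF that] False fJ by simp
    have ai: "a i \<noteq> 0"
    proof
      assume 0: "a i = 0"
      then have "(\<Sum>j\<in>J. a j * f j x) = 0" if "x \<in> X" for x using a'[OF that] by simp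
      moreover have "lin_indep X J f" using J(1) unfolding A_def by simp
      ultimately have "\<forall>j\<in>J. a j = 0" by (metis lin_indepD)
      then show False using 0 nz by auto
    qed
    have "f i x = (\<Sum>j\<in>J. (- a j / a i) * f j x)" if "x \<in> X" for x
    proof -
      have "(\<Sum>j\<in>J. (- a j / a i) * f j x) = - (\<Sum>j\<in>J. a j * f j x) / a i"
        by (simp add: sum_divide_distrib sum_negf[symmetric])
      also have "\<dots> = f i x" using a'[OF that] ai by (simp add: field_simps add_eq_0_iff)
      finally show ?thesis by simp
    qed
    then show ?thesis by (intro exI[of _ "\<lambda>j. - a j / a i"] ballI)
  qed
  moreover have "J \<subseteq> I" "lin_indep X J f" using J(1) unfolding A_def by auto
  ultimately show ?thesis by metis
qed

lemma range_lin_comb_subfamily: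
  fixes f :: "'i \<Rightarrow> 'x \<Rightarrow> 'a::field"
  assumes I: "finite I" and JI: "J \<subseteq> I" and comb: "\<And>i. i \<in> I \<Longrightarrow> \<exists>a. \<forall>x\<in>X. f i x = (\<Sum>j\<in>J. a j * f j x)"
  shows "range (lin_comb X I f) = range (lin_comb X J f)"
proof (rule equalityI; rule subsetI)
  have ex: "\<forall>i\<in>I. \<exists>a. \<forall>x\<in>X. f i x = (\<Sum>j\<in>J. a j * f j x)" using comb by (intro ballI)
  obtain al where al: "\<forall>i\<in>I. \<forall>x\<in>X. f i x = (\<Sum>j\<in>J. al i j * f j x)" using bchoice[OF ex] by (elim exE)
  fix g assume "g \<in> range (lin_comb X I f)"
  then obtain a where g: "g = lin_comb X I f a" by (elim rangeE)
  have gg: "g = lin_comb X J f (\<lambda>j. \<Sum>i\<in>I. a i * al i j)"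
  proof
    fix x
    show "g x = lin_comb X J f (\<lambda>j. \<Sum>i\<in>I. a i * al i j) x"
    proof (cases "x \<in> X")
      case True
      have "(\<Sum>i\<in>I. a i * f i x) = (\<Sum>i\<in>I. \<Sum>j\<in>J. a i * al i j * f j x)"
      proof (intro sum.cong refl)
        fix i assume "i \<in> I"
        then have "f i x = (\<Sum>j\<in>J. al i j * f j x)" using al True by simp
        then show "a i * f i x = (\<Sum>j\<in>J. a i * al i j * f j x)" by (simp add: sum_distrib_left mult_ac)
      qed
      also have "\<dots> = (\<Sum>j\<in>J. (\<Sum>i\<in>I. a i * al i j) * f j x)"
        by (subst sum.swap) (simp add: sum_distrib_right)
      finally show ?thesis unfolding g lin_comb_def using True by simp
    qed (simp add: g lin_comb_def)
  qed
  show "g \<in> range (lin_comb X J f)" unfolding gg by (rule rangeI)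
next
  fix g assume "g \<in> range (lin_comb X J f)"
  then obtain a where g: "g = lin_comb X J f a" by (elim rangeE)
  have gg: "g = lin_comb X I f (\<lambda>i. if i \<in> J then a i else 0)"
  proof
    fix x
    have "(\<Sum>i\<in>I. (if i \<in> J then a i else 0) * f i x) = (\<Sum>i\<in>J. a i * f i x)"
      by (rule sum.mono_neutral_cong_right[OF I JI]) auto
    then show "g x = lin_comb X I f (\<lambda>i. if i \<in> J then a i else 0) x" unfolding g lin_comb_def by simp
  qed
  show "g \<in> range (lin_comb X I f)" unfolding gg by (rule rangeI)
qed

section \<open>Bihomogeneous forms\<close>

text \<open>A function-level stand-in for a homogeneous polynomial of degree \<open>d\<close>:
  scaling and the degree along lines are the properties needed for moving points of the
  variety.\<close>

definition homog_fun :: "nat \<Rightarrow> ((nat \<Rightarrow> 'a::field) \<Rightarrow> 'a) \<Rightarrow> bool" where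
  "homog_fun d A \<longleftrightarrow> (\<forall>c x. A (\<lambda>i. c * x i) = c ^ d * A x) \<and>
     (\<forall>v w. \<exists>P. degree P \<le> d \<and> (\<forall>\<mu>. A (\<lambda>i. v i + \<mu> * w i) = poly P \<mu>))"

inductive biform :: "nat \<Rightarrow> ((nat \<Rightarrow> 'a::field) \<Rightarrow> (nat \<Rightarrow> 'a) \<Rightarrow> 'a) \<Rightarrow> bool" for d where
  zero: "biform d (\<lambda>x z. 0)"
| add: "homog_fun d A \<Longrightarrow> homog_fun d B \<Longrightarrow> biform d G \<Longrightarrow> biform d (\<lambda>x z. A x * B z + G x z)"

lemma homog_funD: "homog_fun d A \<Longrightarrow> A (\<lambda>i. c * x i) = c ^ d * A x"
  unfolding homog_fun_def by blast

lemma homog_fun_line: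
  assumes "homog_fun d A"
  obtains P where "degree P \<le> d" "\<And>\<mu>. A (\<lambda>i. v i + \<mu> * w i) = poly P \<mu>"
  using assms unfolding homog_fun_def by blast

lemma homog_fun_const: "homog_fun 0 (\<lambda>x. c)"
  unfolding homog_fun_def by (auto intro!: exI[of _ "[:c:]"])

lemma homog_fun_coord: "homog_fun 1 (\<lambda>x. x i)"
proof -
  have "\<exists>P. degree P \<le> 1 \<and> (\<forall>\<mu>. v i + \<mu> * w i = poly P \<mu>)" for v w :: "nat \<Rightarrow> 'a"
    by (rule exI[of _ "[:v i, w i:]"]) simp
  then show ?thesis unfolding homog_fun_def by simp
qed

lemma homog_fun_mult:
  assumes "homog_fun d A" "homog_fun e B"
  shows "homog_fun (d + e) (\<lambda>x. A x * B x)"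
  unfolding homog_fun_def
proof (intro conjI allI)
  show "A (\<lambda>i. c * x i) * B (\<lambda>i. c * x i) = c ^ (d + e) * (A x * B x)" for c x
    using assms by (simp add: homog_funD power_add)
  fix v w
  obtain P where P: "degree P \<le> d" "\<And>\<mu>. A (\<lambda>i. v i + \<mu> * w i) = poly P \<mu>"
    using homog_fun_line[OF assms(1)] by blast
  obtain R where R: "degree R \<le> e" "\<And>\<mu>. B (\<lambda>i. v i + \<mu> * w i) = poly R \<mu>"
    using homog_fun_line[OF assms(2)] by blast
  show "\<exists>P. degree P \<le> d + e \<and> (\<forall>\<mu>. A (\<lambda>i. v i + \<mu> * w i) * B (\<lambda>i. v i + \<mu> * w i) = poly P \<mu>)"
    by (rule exI[of _ "P * R"]) (use P R degree_mult_le[of P R] in auto)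
qed

lemma homog_fun_power:
  assumes "homog_fun d A"
  shows "homog_fun (d * k) (\<lambda>x. A x ^ k)"
proof (induction k)
  case 0
  show ?case using homog_fun_const[of 1] by simp
next
  case (Suc k)
  show ?case using homog_fun_mult[OF assms Suc] by simp
qed

lemma homog_fun_prod:
  assumes "finite I" "\<And>i. i \<in> I \<Longrightarrow> homog_fun (d i) (A i)"
  shows "homog_fun (\<Sum>i\<in>I. d i) (\<lambda>x. \<Prod>i\<in>I. A i x)"
  using assms
proof (induction I)
  case empty
  show ?case using homog_fun_const[of 1] by simp
next
  case (insert i I)
  then show ?case using homog_fun_mult[of "d i" "A i" "sum d I" "\<lambda>x. \<Prod>i\<in>I. A i x"] by simp
qed

lemma homog_fun_scale:
  assumes "homog_fun d A"
  shows "homog_fun d (\<lambda>x. c * A x)"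
  using homog_fun_mult[OF homog_fun_const[of c] assms] by simp

lemma biform_prod:
  assumes "homog_fun d A" "homog_fun d B"
  shows "biform d (\<lambda>x z. A x * B z)"
  using biform.add[OF assms biform.zero] by simp

lemma biform_plus:
  assumes "biform d G" "biform d G'"
  shows "biform d (\<lambda>x z. G x z + G' x z)"
  using assms(1)
proof induction
  case zero
  then show ?case using assms(2) by simp
next
  case (add A B G)
  then show ?case using biform.add[OF add(1,2,4)] by (simp add: add.assoc)
qed

lemma biform_sum:
  assumes "\<And>i. i \<in> I \<Longrightarrow> biform d (G i)"
  shows "biform d (\<lambda>x z. \<Sum>i\<in>I. G i x z)"
  using assms by (induction I rule: infinite_finite_induct) (simp_all add: biform.zero biform_plus)

lemma biform_scale:
  assumes "biform d G"
  shows "biform d (\<lambda>x z. c * G x z)"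
  using assms
proof induction
  case zero
  then show ?case using biform.zero by simp
next
  case (add A B G)
  then show ?case using biform.add[OF homog_fun_scale[OF add(1)] add(2,4), of c] by (simp add: algebra_simps)
qed

lemma biform_mult:
  assumes "biform d G" "biform e G'"
  shows "biform (d + e) (\<lambda>x z. G x z * G' x z)"
  using assms(1)
proof induction
  case zero
  then show ?case using biform.zero by simp
next
  case (add A B G)
  have "biform (d + e) (\<lambda>x z. A x * B z * G' x z)"
    using assms(2)
  proof induction
    case zero
    then show ?case using biform.zero by simp
  next
    case (add A' B' G')
    show ?case
      using biform.add[OF homog_fun_mult[OF \<open>homog_fun d A\<close> add(1)] homog_fun_mult[OF \<open>homog_fun d B\<close> add(2)] add(4)]
      by (simp add: algebra_simps)
  qed
  from biform_plus[OF this add(4)] show ?case by (simp add: algebra_simps)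
qed

lemma biform_power:
  assumes "biform d G"
  shows "biform (d * k) (\<lambda>x z. G x z ^ k)"
proof (induction k)
  case 0
  show ?case using biform_prod[OF homog_fun_const[of 1] homog_fun_const[of 1]] by simp
next
  case (Suc k)
  show ?case using biform_mult[OF assms Suc] by simp
qed

lemma biform_homog_right: "biform d G \<Longrightarrow> G x (\<lambda>i. c * z i) = c ^ d * G x z"
  by (induction rule: biform.induct) (auto simp: homog_funD algebra_simps)

lemma poly_eq_sum_atMost:
  fixes P :: "'a::field poly"
  assumes "degree P \<le> d"
  shows "poly P x = (\<Sum>i\<le>d. coeff P i * x ^ i)"
  unfolding poly_altdef
  by (rule sum.mono_neutral_left) (use assms in \<open>auto simp: coeff_eq_0\<close>)

lemma biform_line:
  assumes "biform d G"
  shows "\<exists>c. \<forall>\<mu> \<nu>. G (\<lambda>i. v i + \<mu> * w i) (\<lambda>i. v' i + \<nu> * w' i) = (\<Sum>i\<le>d. \<Sum>j\<le>d. c i j * \<mu> ^ i * \<nu> ^ j)"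
  using assms
proof induction
  case zero
  then show ?case by (intro exI[of _ "\<lambda>_ _. 0"]) simp
next
  case (add A B G)
  obtain c where c: "\<And>\<mu> \<nu>. G (\<lambda>i. v i + \<mu> * w i) (\<lambda>i. v' i + \<nu> * w' i) = (\<Sum>i\<le>d. \<Sum>j\<le>d. c i j * \<mu> ^ i * \<nu> ^ j)"
    using add.IH by blast
  obtain P where P: "degree P \<le> d" "\<And>\<mu>. A (\<lambda>i. v i + \<mu> * w i) = poly P \<mu>"
    using homog_fun_line[OF add(1)] by blast
  obtain R where R: "degree R \<le> d" "\<And>\<mu>. B (\<lambda>i. v' i + \<mu> * w' i) = poly R \<mu>"
    using homog_fun_line[OF add(2)] by blast
  show ?case
    by (rule exI[of _ "\<lambda>i j. coeff P i * coeff R j + c i j"])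
       (simp add: c P R poly_eq_sum_atMost[OF P(1)] poly_eq_sum_atMost[OF R(1)] sum_product
         algebra_simps sum.distrib)
qed

lemma biform_line_left:
  assumes "biform d G"
  obtains P where "degree P \<le> d" "\<And>\<mu>. G (\<lambda>i. v i + \<mu> * w i) z = poly P \<mu>"
proof -
  obtain c where c: "\<And>\<mu> \<nu>. G (\<lambda>i. v i + \<mu> * w i) (\<lambda>i. z i + \<nu> * 0) = (\<Sum>i\<le>d. \<Sum>j\<le>d. c i j * \<mu> ^ i * \<nu> ^ j)"
    using biform_line[OF assms, of v w z "\<lambda>_. 0"] by blast
  let ?P = "\<Sum>i\<le>d. monom (c i 0) i"
  have "degree ?P \<le> d" by (rule degree_sum_le) (auto intro: order_trans[OF degree_monom_le])
  moreover have "G (\<lambda>i. v i + \<mu> * w i) z = poly ?P \<mu>" for \<mu>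
  proof -
    have "(\<Sum>j\<le>d. c i j * \<mu> ^ i * 0 ^ j) = c i 0 * \<mu> ^ i" for i
      by (subst sum.remove[of _ 0]) (auto intro!: sum.neutral)
    then show ?thesis using c[of \<mu> 0] by (simp add: poly_sum poly_monom)
  qed
  ultimately show ?thesis using that by blast
qed

lemma biform_line_right:
  assumes "biform d G"
  obtains P where "degree P \<le> d" "\<And>\<nu>. G x (\<lambda>i. v i + \<nu> * w i) = poly P \<nu>"
proof -
  obtain c where c: "\<And>\<mu> \<nu>. G (\<lambda>i. x i + \<mu> * 0) (\<lambda>i. v i + \<nu> * w i) = (\<Sum>i\<le>d. \<Sum>j\<le>d. c i j * \<mu> ^ i * \<nu> ^ j)"
    using biform_line[OF assms, of x "\<lambda>_. 0" v w] by blast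
  let ?P = "\<Sum>j\<le>d. monom (c 0 j) j"
  have "degree ?P \<le> d" by (rule degree_sum_le) (auto intro: order_trans[OF degree_monom_le])
  moreover have "G x (\<lambda>i. v i + \<nu> * w i) = poly ?P \<nu>" for \<nu>
  proof -
    have "(\<Sum>i\<le>d. \<Sum>j\<le>d. c i j * 0 ^ i * \<nu> ^ j) = (\<Sum>j\<le>d. c 0 j * \<nu> ^ j)"
      by (subst sum.remove[of _ 0]) (auto intro!: sum.neutral)
    then show ?thesis using c[of 0 \<nu>] by (simp add: poly_sum poly_monom)
  qed
  ultimately show ?thesis using that by blast
qed

text \<open>The exponents \<open>i + q * j\<close> are two-digit expansions in base
  \<open>q\<close>, so they are distinct and below \<open>q\<^sup>2\<close>; a polynomial of such
  degree that vanishes on the whole field is zero. Thus \<open>\<mu>\<close> and its conjugate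
  behave as independent variables.\<close>

lemma sum_powers_eq_0_imp:
  fixes c :: "nat \<Rightarrow> nat \<Rightarrow> 'a::{field,finite}"
  assumes q: "CARD('a) = q\<^sup>2" "d < q" and 0: "\<And>\<mu>. (\<Sum>i\<le>d. \<Sum>j\<le>d. c i j * \<mu> ^ i * (\<mu> ^ q) ^ j) = 0"
    and ij: "i \<le> d" "j \<le> d"
  shows "c i j = 0"
proof -
  define P where "P = (\<Sum>i\<le>d. \<Sum>j\<le>d. monom (c i j) (i + q * j))"
  have "poly P \<mu> = 0" for \<mu>
    using 0[of \<mu>] by (simp add: P_def poly_sum poly_monom power_add power_mult mult.assoc)
  moreover have "degree P < CARD('a)"
  proof -
    have "degree P \<le> d + q * d" unfolding P_def
      by (intro degree_sum_le) (auto intro!: order_trans[OF degree_monom_le] add_mono mult_left_mono)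
    also have "\<dots> < q + q * d" using q(2) by simp
    also have "\<dots> = q * (d + 1)" by simp
    also have "\<dots> \<le> q * q" using q(2) by (intro mult_left_mono) auto
    finally show ?thesis using q(1) by (simp add: power2_eq_square)
  qed
  ultimately have "P = 0" by (intro poly_eq_0_finite_field)
  have "coeff P (i + q * j) = (\<Sum>i'\<le>d. \<Sum>j'\<le>d. if i' = i \<and> j' = j then c i j else 0)"
    unfolding P_def coeff_sum
  proof (intro sum.cong refl)
    fix i' j' assume i': "i' \<in> {..d}"
    have "i' + q * j' = i + q * j \<longleftrightarrow> i' = i \<and> j' = j"
    proof
      assume e: "i' + q * j' = i + q * j"
      have "(i' + q * j') mod q = i'" "(i + q * j) mod q = i"
        "(i' + q * j') div q = j'" "(i + q * j) div q = j"
        using i' ij q(2) by auto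
      then show "i' = i \<and> j' = j" using e by metis
    qed auto
    then show "coeff (monom (c i' j') (i' + q * j')) (i + q * j) = (if i' = i \<and> j' = j then c i j else 0)"
      by auto
  qed
  also have "\<dots> = (\<Sum>i'\<le>d. if i' = i then c i j else 0)"
    by (intro sum.cong refl) (use ij in \<open>auto simp: if_distrib cong: if_cong\<close>)
  also have "\<dots> = c i j" using ij by simp
  finally show ?thesis using \<open>P = 0\<close> by simp
qed

section \<open>Hermitian geometry\<close>

locale hermitian_space = vector_space scale
  for scale :: "'a::{field,finite} \<Rightarrow> 'v::ab_group_add \<Rightarrow> 'v" (infixr \<open>*s\<close> 75) +
  fixes h :: "'v \<Rightarrow> 'v \<Rightarrow> 'a" and p t q n :: nat
  assumes prime_p: "prime p" and t_pos: "t \<ge> 1" and q_def: "q = p ^ t"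
    and card_field: "CARD('a) = q\<^sup>2"
    and dim_n: "dim (UNIV :: 'v set) = n" and n_ge_4: "n \<ge> 4"
    and herm: "hermitian_form q scale h" and nondeg: "nondegenerate h"
begin

lemma q_ge_2: "q \<ge> 2"
proof -
  have "p ^ 1 \<le> p ^ t" using prime_p t_pos by (intro power_increasing) (auto dest: prime_gt_0_nat)
  then show ?thesis using prime_ge_2_nat[OF prime_p] unfolding q_def by simp
qed

lemma zero_power_q [simp]: "(0::'a) ^ q = 0"
  using q_ge_2 by simp

lemma CHAR_p: "CHAR('a) = p"
proof (rule finite_field_CHAR[OF prime_p])
  show "CARD('a) = p ^ (2 * t)" unfolding card_field q_def by (simp add: power_mult[symmetric] mult.commute)
qed

lemma conj_add: "(x + y :: 'a) ^ q = x ^ q + y ^ q"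
  by (rule freshmans_dream'[where n=t]) (use prime_p in \<open>simp_all add: CHAR_p q_def\<close>)

lemma conj_conj: "((x::'a) ^ q) ^ q = x"
  using finite_field_power_card[of x] by (simp add: card_field power_mult[symmetric] power2_eq_square)

lemma conj_minus: "(- x :: 'a) ^ q = - (x ^ q)"
proof -
  have "(x + (- x)) ^ q = x ^ q + (-x) ^ q" by (rule conj_add)
  moreover have "(0::'a) ^ q = 0" using q_ge_2 by simp
  ultimately show ?thesis by (simp add: eq_neg_iff_add_eq_0 add.commute)
qed

lemma h_add_left: "h (v + w) y = h v y + h w y"
  and h_scale_left: "h (a *s v) y = a * h v y"
  and h_conj: "h v w ^ q = h w v"
proof -
  have lin: "Vector_Spaces.linear scale (*) (\<lambda>v. h v w)" and conj: "h w v = h v w ^ q" for v w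
    using herm unfolding hermitian_form_def by blast+
  show "h (v + w) y = h v y + h w y"
    by (rule module_hom.add[OF Vector_Spaces.linear.axioms(3)[OF lin]])
  show "h (a *s v) y = a * h v y"
    by (rule module_hom.scale[OF Vector_Spaces.linear.axioms(3)[OF lin]])
  show "h v w ^ q = h w v" by (rule conj[symmetric])
qed

lemma h_add_right: "h y (v + w) = h y v + h y w"
  using h_conj[of "v + w" y] h_conj[of v y] h_conj[of w y] by (simp add: h_add_left conj_add)

lemma h_scale_right: "h y (a *s v) = a ^ q * h y v"
  using h_conj[of "a *s v" y] h_conj[of v y] h_scale_left by (simp add: power_mult_distrib)

lemma h_zero_left: "h 0 y = 0" using h_scale_left[of 0 0 y] by simp
lemma h_zero_right: "h y 0 = 0" using h_conj[of 0 y] by (simp add: h_zero_left)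

lemma h_minus_left: "h (- v) y = - h v y"
  using h_scale_left[of "-1" v y] by simp
lemma h_minus_right: "h y (- v) = - h y v"
  using h_conj[of "- v" y] h_conj[of v y] h_minus_left conj_minus by simp

lemma h_diff_left: "h (v - w) y = h v y - h w y"
  using h_add_left[of v "- w" y] h_minus_left by simp
lemma h_diff_right: "h y (v - w) = h y v - h y w"
  using h_add_right[of y v "- w"] h_minus_right by simp

lemma h_sum_left: "h (\<Sum>i\<in>I. f i) y = (\<Sum>i\<in>I. h (f i) y)"
  by (induction I rule: infinite_finite_induct) (auto simp: h_zero_left h_add_left)

lemmas h_simps = h_add_left h_add_right h_scale_left h_scale_right h_diff_left h_diff_right

lemma h_eq_0_commute: "h v w = 0 \<longleftrightarrow> h w v = 0"
proof -
  have sym: "h w v = 0" if "h v w = 0" for v w using h_conj[of v w] unfolding that by simp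
  show ?thesis by (rule iffI[OF sym sym])
qed

lemma h_self_conj: "h v v ^ q = h v v"
  by (rule h_conj)

lemma h_nondeg:
  assumes "\<And>w. h w v = 0"
  shows "v = 0"
proof -
  have "h v w = 0" for w using assms[of w] h_eq_0_commute[of v w] by simp
  then show ?thesis using nondeg unfolding nondegenerate_def by simp
qed

text \<open>The norm map from the nonzero elements of the field to the at most \<open>q - 1\<close> nonzero fixed
  points of conjugation has fibres of size at most \<open>q + 1\<close>, so all fibres have exactly this size.\<close>

lemma card_norm_fibre:
  assumes c: "c ^ q = c" "c \<noteq> (0::'a)"
  shows "card {\<mu>. \<mu> ^ (q + 1) = c} > q"
proof (rule ccontr)
  assume "\<not> ?thesis"
  then have le: "card {\<mu>. \<mu> ^ (q + 1) = c} \<le> q" by simp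
  define R where "R = {c::'a. c ^ q = c \<and> c \<noteq> 0}"
  have cR: "c \<in> R" using c unfolding R_def by simp
  have fib: "card {\<mu>. \<mu> ^ (q + 1) = d} \<le> q + 1" for d :: 'a
  proof -
    let ?P = "monom 1 (q + 1) + [:-d:]"
    have deg: "degree ?P = q + 1" by (subst degree_add_eq_left) (auto simp: degree_monom_eq)
    then have "?P \<noteq> 0" by auto
    then have "card {x. poly ?P x = 0} \<le> q + 1" using card_poly_roots_bound[of ?P] deg by simp
    moreover have "{x. poly ?P x = 0} = {\<mu>. \<mu> ^ (q + 1) = d}" by (auto simp: poly_monom)
    ultimately show ?thesis by simp
  qed
  have cardR: "card R \<le> q - 1"
  proof -
    let ?P = "monom 1 (q - 1) + [:-1::'a:]"
    have deg: "degree ?P = q - 1" using q_ge_2 by (subst degree_add_eq_left) (auto simp: degree_monom_eq)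
    then have "?P \<noteq> 0" using q_ge_2 by auto
    then have "card {x. poly ?P x = 0} \<le> q - 1" using card_poly_roots_bound[of ?P] deg by simp
    moreover have "R \<subseteq> {x. poly ?P x = 0}"
    proof
      fix x assume x: "x \<in> R"
      have "x * x ^ (q - 1) = x * 1" using x q_ge_2 unfolding R_def
        by (metis (mono_tags, lifting) One_nat_def Suc_pred less_le_trans mem_Collect_eq mult.right_neutral
            one_add_one plus_1_eq_Suc power_Suc zero_less_Suc)
      then show "x \<in> {x. poly ?P x = 0}" using x unfolding R_def by (auto simp: poly_monom)
    qed
    then have "card R \<le> card {x. poly ?P x = 0}" by (intro card_mono) auto
    ultimately show ?thesis by simp
  qed
  have "UNIV - {0::'a} \<subseteq> (\<Union>d\<in>R. {\<mu>. \<mu> ^ (q + 1) = d})"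
  proof
    fix \<mu> :: 'a assume "\<mu> \<in> UNIV - {0}"
    moreover have "(\<mu> ^ (q + 1)) ^ q = \<mu> ^ (q + 1)"
      using conj_conj[of \<mu>] by (simp add: power_mult_distrib mult.commute)
    ultimately show "\<mu> \<in> (\<Union>d\<in>R. {\<mu>. \<mu> ^ (q + 1) = d})" unfolding R_def by auto
  qed
  then have "card (UNIV - {0::'a}) \<le> card (\<Union>d\<in>R. {\<mu>. \<mu> ^ (q + 1) = d})" by (intro card_mono) auto
  also have "\<dots> \<le> (\<Sum>d\<in>R. card {\<mu>. \<mu> ^ (q + 1) = d})" by (rule card_UN_le) simp
  also have "\<dots> = card {\<mu>. \<mu> ^ (q + 1) = c} + (\<Sum>d\<in>R - {c}. card {\<mu>. \<mu> ^ (q + 1) = d})"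
    using cR by (subst sum.remove[of _ c]) auto
  also have "\<dots> \<le> q + (\<Sum>d\<in>R - {c}. q + 1)"
    by (intro add_mono le sum_mono fib)
  also have "\<dots> = q + (card R - 1) * (q + 1)" using cR by simp
  also have "\<dots> \<le> q + (q - 2) * (q + 1)" using cardR by (intro add_mono mult_mono) auto
  \<comment> \<open>The right-hand side is \<open>q\<^sup>2 - 2\<close>.\<close>
  finally have le2: "q\<^sup>2 - 1 \<le> q + (q - 2) * (q + 1)" by (simp add: card_Diff_subset card_field)
  obtain k where k: "q = k + 2" using q_ge_2 by (metis add.commute le_Suc_ex)
  from le2 show False unfolding k by (simp add: power2_eq_square algebra_simps)
qed

text \<open>The trace polynomial \<open>x + x ^ q\<close> has degree \<open>q\<close>, below the
  order of the field, so it is not zero everywhere; the multiples of \<open>a\<close> are all field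
  elements.\<close>

lemma trace_nonzero:
  assumes "a \<noteq> (0::'a)"
  obtains c where "c * a + (c * a) ^ q \<noteq> 0"
proof -
  let ?P = "monom (1::'a) q + [:0, 1:]"
  have deg: "degree ?P = q" using q_ge_2 by (subst degree_add_eq_left) (auto simp: degree_monom_eq)
  have "degree ?P < CARD('a)" using deg q_ge_2 card_field by (simp add: power2_eq_square)
  moreover have "?P \<noteq> 0" using deg q_ge_2 by auto
  ultimately obtain x where "poly ?P x \<noteq> 0" using poly_eq_0_finite_field by blast
  then have "x + x ^ q \<noteq> 0" by (simp add: poly_monom add.commute)
  then show ?thesis using that[of "x / a"] assms by simp
qed

text \<open>A nonzero \<open>d\<close> for which \<open>d * h b a\<close> has trace zero isolates
  the term of \<open>h b b\<close>, which therefore vanishes. The hypothesis then says that every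
  \<open>c * h b a\<close> has trace zero. Using traces instead of a division by two covers
  characteristic two as well.\<close>

lemma isotropic_polarization:
  assumes "\<And>c. h (a + c *s b) (a + c *s b) = 0"
  shows "h a b = 0"
proof (rule ccontr)
  assume ab: "h a b \<noteq> 0"
  then obtain c where c: "c * h b a + (c * h b a) ^ q \<noteq> 0" using trace_nonzero[of "h b a"] h_eq_0_commute[of a b] by auto
  have 1: "h a a + c ^ q * h a b + c * (h b a + c ^ q * h b b) = 0"
    using assms[of c] by (simp add: h_simps algebra_simps)
  have 2: "h a a = 0" using assms[of 0] by simp
  have 3: "h b b = 0"
  proof -
    have t: "h a a + c ^ q * h a b + c * (h b a + c ^ q * h b b) = 0" for c
      using assms[of c] by (simp add: h_simps algebra_simps)
    obtain d where d: "d * h b a + (d * h b a) ^ q = 0" "d \<noteq> 0"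
    proof -
      have ba: "h b a \<noteq> 0" using ab h_eq_0_commute[of a b] by simp
      \<comment> \<open>A difference \<open>y - y ^ q\<close> has trace zero because conjugation is
        an involution; divided by \<open>h b a\<close> it serves as \<open>d\<close> unless it is
        zero.\<close>
      define y where "y = c * h b a"
      have "(y - y ^ q) + (y - y ^ q) ^ q = 0"
        using conj_add[of y "- (y ^ q)"] conj_minus[of "y ^ q"] conj_conj[of y] by simp
      show ?thesis
      proof (cases "y = y ^ q")
        case False
        then show ?thesis using that[of "(y - y ^ q) / h b a"] ba \<open>(y - y ^ q) + (y - y ^ q) ^ q = 0\<close> by simp
      next
        case True
        text \<open>If conjugation fixes \<open>y\<close>, some other element is not fixed, as conjugation is not trivial.\<close>
        obtain z :: 'a where z: "z ^ q \<noteq> z"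
        proof -
          let ?P = "monom (1::'a) q + [:0, -1:]"
          have deg: "degree ?P = q" using q_ge_2 by (subst degree_add_eq_left) (auto simp: degree_monom_eq)
          have "degree ?P < CARD('a)" using deg q_ge_2 card_field by (simp add: power2_eq_square)
          moreover have "?P \<noteq> 0" using deg q_ge_2 by auto
          ultimately obtain x where "poly ?P x \<noteq> 0" using poly_eq_0_finite_field by blast
          then show ?thesis using that[of x] by (simp add: poly_monom)
        qed
        have "(z - z ^ q) + (z - z ^ q) ^ q = 0"
          using conj_add[of z "- (z ^ q)"] conj_minus[of "z ^ q"] conj_conj[of z] by simp
        then show ?thesis using that[of "(z - z ^ q) / h b a"] ba z by simp
      qed
    qed
    have "d * (d ^ q * h b b) = h a a + d ^ q * h a b + d * (h b a + d ^ q * h b b) - (d * h b a + (d * h b a) ^ q)"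
      using 2 by (simp add: power_mult_distrib h_conj algebra_simps)
    then have "d * (d ^ q * h b b) = 0" unfolding t d(1) by simp
    then show ?thesis using d(2) by simp
  qed
  have "c * h b a + (c * h b a) ^ q = h a a + c ^ q * h a b + c * (h b a + c ^ q * h b b)"
    using 2 3 by (simp add: power_mult_distrib h_conj algebra_simps)
  then show False using 1 c by simp
qed

text \<open>The projection \<open>pr\<close> away from \<open>Y\<close> is nonzero, as fewer than
  \<open>n\<close> vectors cannot span. If all vectors orthogonal to \<open>Y\<close> were singular,
  polarization would make them mutually orthogonal, and a nonzero \<open>pr v0\<close> would be
  orthogonal to the whole space.\<close>

lemma orthogonal_extension:
  assumes Y: "finite Y" "card Y < n" and ns: "\<And>y. y \<in> Y \<Longrightarrow> h y y \<noteq> 0"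
    and orth: "\<And>y y'. y \<in> Y \<Longrightarrow> y' \<in> Y \<Longrightarrow> y \<noteq> y' \<Longrightarrow> h y y' = 0"
  obtains w where "h w w \<noteq> 0" "\<And>y. y \<in> Y \<Longrightarrow> h w y = 0"
proof -
  define pr where "pr = (\<lambda>v. v - (\<Sum>y\<in>Y. (h v y / h y y) *s y))"
  have pr: "h (pr v) y = 0" if y: "y \<in> Y" for v y
  proof -
    have "(\<Sum>y'\<in>Y. h ((h v y' / h y' y') *s y') y) = (\<Sum>y'\<in>Y. if y' = y then h v y else 0)"
      by (intro sum.cong refl) (use ns orth y in \<open>auto simp: h_scale_left\<close>)
    then show ?thesis unfolding pr_def using y Y(1) by (simp add: h_diff_left h_sum_left)
  qed
  have "\<exists>v0. pr v0 \<noteq> 0"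
  proof (rule ccontr)
    assume "\<nexists>v0. pr v0 \<noteq> 0"
    then have pr0: "pr v = 0" for v by simp
    have "v \<in> span Y" for v
    proof -
      have "v = (\<Sum>y\<in>Y. (h v y / h y y) *s y)" using pr0[of v] unfolding pr_def by simp
      moreover have "(\<Sum>y\<in>Y. (h v y / h y y) *s y) \<in> span Y" by (intro span_sum span_scale span_base)
      ultimately show ?thesis by simp
    qed
    then have "dim (UNIV :: 'v set) \<le> card Y" using Y(1) by (intro dim_le_card) auto
    then show False using Y(2) dim_n by simp
  qed
  then obtain v0 where v0: "pr v0 \<noteq> 0" by (elim exE)
  have "\<exists>w. h w w \<noteq> 0 \<and> (\<forall>y\<in>Y. h w y = 0)"
  proof (rule ccontr)
    assume a: "\<nexists>w. h w w \<noteq> 0 \<and> (\<forall>y\<in>Y. h w y = 0)"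
    have sing: "h w w = 0" if "\<And>y. y \<in> Y \<Longrightarrow> h w y = 0" for w
      using a that by auto
    have "h v (pr v0) = 0" for v
    proof -
      have "h (pr v) (pr v0) = 0"
        by (rule isotropic_polarization, rule sing) (simp add: pr h_add_left h_scale_left)
      moreover have "h (\<Sum>y\<in>Y. (h v y / h y y) *s y) (pr v0) = 0"
        using pr h_eq_0_commute[of _ "pr v0"] by (simp add: h_sum_left h_scale_left)
      moreover have "h v (pr v0) = h (pr v) (pr v0) + h (\<Sum>y\<in>Y. (h v y / h y y) *s y) (pr v0)"
        unfolding h_add_left[symmetric] unfolding pr_def by simp
      ultimately show ?thesis by simp
    qed
    then have "pr v0 = 0" by (rule h_nondeg)
    then show False using v0 by simp
  qed
  then show ?thesis using that by (elim exE conjE) simp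
qed

text \<open>A singular nonzero \<open>x\<close> cannot belong to an orthogonal family of nonsingular
  vectors, so it is written as a sum of two orthogonal nonsingular vectors \<open>b\<close> and
  \<open>k *s u\<close>, both orthogonal to \<open>y\<close>. The family \<open>y\<close>,
  \<open>u\<close>, \<open>b\<close> can be extended because \<open>n \<ge> 4\<close>.\<close>

lemma nonsingular_orthogonal_to_pair:
  assumes y: "h y y \<noteq> 0" and xy: "h x y = 0"
  obtains w where "h w w \<noteq> 0" "h w x = 0" "h w y = 0"
proof (cases "h x x = 0")
  case False
  have "x \<noteq> y" using y xy by auto
  have "card {x, y} < n" using n_ge_4 by (simp add: card_insert_if)
  then obtain w where w: "h w w \<noteq> 0" "\<And>z. z \<in> {x, y} \<Longrightarrow> h w z = 0"
    by (rule orthogonal_extension[rotated]) (use y False xy h_eq_0_commute in auto)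
  then show ?thesis using that by blast
next
  case xx: True
  show ?thesis
  proof (cases "x = 0")
    case True
    have "card {y} < n" using n_ge_4 by simp
    then obtain w where "h w w \<noteq> 0" "\<And>z. z \<in> {y} \<Longrightarrow> h w z = 0"
      by (rule orthogonal_extension[rotated]) (use y in auto)
    then show ?thesis using that True h_zero_right by blast
  next
    case False
    have yx: "h y x = 0" using xy h_eq_0_commute[of x y] by simp
    obtain v where v: "h v x \<noteq> 0" using False h_nondeg[of x] by auto
    define x' where "x' = v - (h v y / h y y) *s y"
    have x'y: "h x' y = 0" and x'x: "h x' x \<noteq> 0" unfolding x'_def using y v yx by (auto simp: h_simps)
    \<comment> \<open>If \<open>x'\<close> is singular, the vector \<open>x' + c *s x\<close> is
      used instead: its form value is the trace of \<open>c * h x x'\<close>, nonzero for a suitable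
      \<open>c\<close>.\<close>
    obtain u where u: "h u u \<noteq> 0" "h u y = 0" "h u x \<noteq> 0"
    proof (cases "h x' x' = 0")
      case True
      have "h x x' \<noteq> 0" using x'x h_eq_0_commute[of x x'] by simp
      then obtain c where c: "c * h x x' + (c * h x x') ^ q \<noteq> 0" using trace_nonzero by blast
      have "h (x' + c *s x) (x' + c *s x) = c * h x x' + (c * h x x') ^ q"
        using True xx by (simp add: h_simps power_mult_distrib h_conj)
      then have "h (x' + c *s x) (x' + c *s x) \<noteq> 0" using c by simp
      then show ?thesis by (rule that) (use x'y xy x'x xx in \<open>simp_all add: h_add_left h_scale_left\<close>)
    qed (rule that[OF _ x'y x'x])
    have xu: "h x u \<noteq> 0" using u(3) h_eq_0_commute[of u x] by simp
    define k where "k = h x u / h u u"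
    define b where "b = x - k *s u"
    have k: "k \<noteq> 0" "k * h u u = h x u" unfolding k_def using xu u(1) by auto
    have bu: "h b u = 0" unfolding b_def using k by (simp add: h_simps)
    have bb: "h b b \<noteq> 0"
    proof -
      have "h b b = h b x - k ^ q * h b u" using h_diff_right[of b x "k *s u"] unfolding b_def[symmetric] by (simp add: h_simps)
      also have "\<dots> = - (k * h u x)" using bu xx unfolding b_def by (simp add: h_simps)
      finally show ?thesis using k u by simp
    qed
    have by': "h b y = 0" unfolding b_def using xy u by (simp add: h_simps)
    have c3: "card {y, u, b} < n" using n_ge_4 by (simp add: card_insert_if)
    have ub: "h u b = 0" "h y u = 0" "h y b = 0"
      using bu u(2) by' h_eq_0_commute[of u b] h_eq_0_commute[of y u] h_eq_0_commute[of y b] by simp_all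
    from c3 obtain w where w: "h w w \<noteq> 0" "\<And>z. z \<in> {y, u, b} \<Longrightarrow> h w z = 0"
      by (rule orthogonal_extension[rotated]) (use y u bb bu by' ub in auto)
    have "x = b + k *s u" unfolding b_def by simp
    then have "h w x = 0" using w(2)[of b] w(2)[of u] by (simp add: h_simps)
    then show ?thesis using that w by blast
  qed
qed

text \<open>Orthogonality turns the condition into the norm equation
  \<open>\<mu> ^ (q + 1) = - h x x / h w w\<close> with a nonzero right-hand side fixed by
  conjugation. More than \<open>q\<close> solutions will exceed the degree \<open>q - 1\<close> of
  the forms.\<close>

lemma many_singular_on_line:
  assumes x: "h x x \<noteq> 0" and w: "h w w \<noteq> 0" and wx: "h w x = 0"
  shows "card {\<mu>. h (x + \<mu> *s w) (x + \<mu> *s w) = 0} > q"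
proof -
  let ?c = "- h x x / h w w"
  have "?c ^ q = ?c"
    by (simp add: power_divide conj_minus h_self_conj)
  moreover have "?c \<noteq> 0" using x w by simp
  ultimately have "card {\<mu>. \<mu> ^ (q + 1) = ?c} > q" by (rule card_norm_fibre)
  moreover have "{\<mu>. \<mu> ^ (q + 1) = ?c} = {\<mu>. h (x + \<mu> *s w) (x + \<mu> *s w) = 0}"
  proof -
    have xw: "h x w = 0" using wx h_eq_0_commute[of x w] by simp
    have "h (x + \<mu> *s w) (x + \<mu> *s w) = h x x + \<mu> ^ (q + 1) * h w w" for \<mu>
      using wx xw by (simp add: h_simps algebra_simps)
    then show ?thesis using w by (auto simp: field_simps add_eq_0_iff)
  qed
  ultimately show ?thesis by simp
qed

text \<open>Four mutually orthogonal nonsingular vectors form two orthogonal planes, and each plane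
  contains a singular vector. The four vectors exist because \<open>n \<ge> 4\<close>.\<close>

lemma totally_isotropic_line:
  obtains e e' where "h e e = 0" "h e' e' = 0" "h e e' = 0" "e' \<noteq> 0" "\<And>c. e \<noteq> c *s e'"
proof -
  obtain w1 where w1: "h w1 w1 \<noteq> 0"
    using orthogonal_extension[of "{}"] n_ge_4 by auto
  obtain w2 where w2: "h w2 w2 \<noteq> 0" "h w2 w1 = 0"
    using orthogonal_extension[of "{w1}"] n_ge_4 w1 by auto
  have o12: "h w1 w2 = 0" using w2 h_eq_0_commute[of w1 w2] by simp
  have "card {w1, w2} < n" using n_ge_4 by (simp add: card_insert_if)
  then obtain w3 where w3': "h w3 w3 \<noteq> 0" "\<And>y. y \<in> {w1, w2} \<Longrightarrow> h w3 y = 0"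
    by (rule orthogonal_extension[rotated]) (use w1 w2 o12 in auto)
  then have w3: "h w3 w3 \<noteq> 0" "h w3 w1 = 0" "h w3 w2 = 0" by simp_all
  have o3: "h w1 w3 = 0" "h w2 w3 = 0" using w3 h_eq_0_commute[of w1 w3] h_eq_0_commute[of w2 w3] by simp_all
  have "card {w1, w2, w3} < n" using n_ge_4 by (simp add: card_insert_if)
  then obtain w4 where w4': "h w4 w4 \<noteq> 0" "\<And>y. y \<in> {w1, w2, w3} \<Longrightarrow> h w4 y = 0"
    by (rule orthogonal_extension[rotated]) (use w1 w2 o12 w3 o3 in auto)
  then have w4: "h w4 w4 \<noteq> 0" "h w4 w1 = 0" "h w4 w2 = 0" "h w4 w3 = 0" by simp_all
  have o4: "h w1 w4 = 0" "h w2 w4 = 0" "h w3 w4 = 0"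
    using w4 h_eq_0_commute[of w1 w4] h_eq_0_commute[of w2 w4] h_eq_0_commute[of w3 w4] by simp_all
  have ex: "\<exists>\<mu>. h (x + \<mu> *s w) (x + \<mu> *s w) = 0" if "h x x \<noteq> 0" "h w w \<noteq> 0" "h w x = 0" for x w
  proof (rule ccontr)
    assume "\<not> ?thesis"
    then have "{\<mu>. h (x + \<mu> *s w) (x + \<mu> *s w) = 0} = {}" by simp
    then show False using many_singular_on_line[OF that] by simp
  qed
  obtain \<mu> where \<mu>: "h (w1 + \<mu> *s w2) (w1 + \<mu> *s w2) = 0" using ex[OF w1 w2] by (elim exE)
  obtain \<nu> where \<nu>: "h (w3 + \<nu> *s w4) (w3 + \<nu> *s w4) = 0" using ex[OF w3(1) w4(1,4)] by (elim exE)
  let ?e = "w1 + \<mu> *s w2" and ?f = "w3 + \<nu> *s w4"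
  have ef: "h ?e ?f = 0" using o3 o4 by (simp add: h_simps)
  have "h ?f w3 \<noteq> 0" using w3 w4 by (simp add: h_simps)
  then have f0: "?f \<noteq> 0" using h_zero_left[of w3] by auto
  have "?e \<noteq> c *s ?f" for c
  proof
    assume "?e = c *s ?f"
    then have "h ?e w1 = h (c *s ?f) w1" by simp
    then show False using w1 w2 w3 w4 by (simp add: h_simps)
  qed
  then show ?thesis by (rule that[OF \<mu> \<nu> ef f0])
qed

subsection \<open>Coordinates\<close>

definition "bas = (SOME b :: nat \<Rightarrow> 'v. independent (b ` {..<n}) \<and> inj_on b {..<n} \<and> span (b ` {..<n}) = UNIV)"

lemma bas: "independent (bas ` {..<n})" "inj_on bas {..<n}" "span (bas ` {..<n}) = UNIV"
proof -
  obtain B where B: "B \<subseteq> (UNIV :: 'v set)" "independent B" "UNIV \<subseteq> span B" "card B = n"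
    using basis_exists[of UNIV] dim_n by metis
  have "finite B" using B(4) n_ge_4 card.infinite by force
  then obtain b where b: "bij_betw b {..<n} B" using ex_bij_betw_nat_finite B(4) atLeast0LessThan by metis
  then have "b ` {..<n} = B" "inj_on b {..<n}" unfolding bij_betw_def by auto
  then have "\<exists>b :: nat \<Rightarrow> 'v. independent (b ` {..<n}) \<and> inj_on b {..<n} \<and> span (b ` {..<n}) = UNIV"
    using B by (intro exI[of _ b]) auto
  from someI_ex[OF this] show "independent (bas ` {..<n})" "inj_on bas {..<n}" "span (bas ` {..<n}) = UNIV"
    unfolding bas_def[symmetric] by auto
qed

text \<open>In these coordinates the form is the bilinear pairing of \<open>crd x\<close> with
  \<open>dcrd y\<close>; conjugation is absorbed into the dual coordinates, on which a scalar
  \<open>c\<close> acts as \<open>c ^ q\<close>.\<close>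

definition "crd v = (\<lambda>i. if i < n then representation (bas ` {..<n}) v (bas i) else 0)"
definition "dcrd y = (\<lambda>i. if i < n then h (bas i) y else 0)"

lemma crd_add: "crd (v + w) = (\<lambda>i. crd v i + crd w i)"
  unfolding crd_def using bas by (auto simp: representation_add)

lemma crd_scale: "crd (c *s v) = (\<lambda>i. c * crd v i)"
  unfolding crd_def using bas by (auto simp: representation_scale)

lemma dcrd_add: "dcrd (v + w) = (\<lambda>i. dcrd v i + dcrd w i)"
  unfolding dcrd_def by (auto simp: h_add_right)

lemma dcrd_scale: "dcrd (c *s v) = (\<lambda>i. c ^ q * dcrd v i)"
  unfolding dcrd_def by (auto simp: h_scale_right)

lemma sum_crd: "(\<Sum>i<n. crd v i *s bas i) = v"
proof -
  have "(\<Sum>b\<in>bas ` {..<n}. representation (bas ` {..<n}) v b *s b) = v"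
    by (rule sum_representation_eq) (use bas in auto)
  then show ?thesis unfolding crd_def by (simp add: sum.reindex[OF bas(2)])
qed

lemma h_coordinates: "h x y = (\<Sum>i<n. crd x i * dcrd y i)"
proof -
  have "h x y = h (\<Sum>i<n. crd x i *s bas i) y" by (simp add: sum_crd)
  also have "\<dots> = (\<Sum>i<n. crd x i * h (bas i) y)" by (simp add: h_sum_left h_scale_left)
  finally show ?thesis unfolding dcrd_def by simp
qed

lemma crd_in: "crd v \<in> fspace {..<n}" and dcrd_in: "dcrd v \<in> fspace {..<n}"
  unfolding crd_def dcrd_def fspace_def by auto

lemma crd_inj: "inj crd"
  by (metis injI sum_crd)

lemma crd_range: "range crd = fspace {..<n}"
proof (intro subset_antisym subsetI)
  fix x :: "nat \<Rightarrow> 'a" assume x: "x \<in> fspace {..<n}"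
  let ?v = "\<Sum>i<n. x i *s bas i"
  have "crd ?v = x"
  proof
    fix i
    show "crd ?v i = x i"
    proof (cases "i < n")
      case True
      have "crd ?v i = representation (bas ` {..<n}) (\<Sum>b\<in>bas ` {..<n}. x (inv_into {..<n} bas b) *s b) (bas i)"
        using True by (simp add: crd_def sum.reindex[OF bas(2)] bas(2))
      also have "\<dots> = (\<Sum>b\<in>bas ` {..<n}. representation (bas ` {..<n}) (x (inv_into {..<n} bas b) *s b) (bas i))"
        using bas by (subst representation_sum) auto
      also have "\<dots> = (\<Sum>j<n. x j * representation (bas ` {..<n}) (bas j) (bas i))"
        using bas by (simp add: sum.reindex[OF bas(2)] representation_scale)
      also have "\<dots> = (\<Sum>j<n. if j = i then x i else 0)"
        by (intro sum.cong refl) (use bas True in \<open>auto simp: representation_basis inj_on_eq_iff[OF bas(2)]\<close>)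
      finally show ?thesis using True by simp
    qed (use x in \<open>auto simp: crd_def fspace_def\<close>)
  qed
  then show "x \<in> range crd" by (metis rangeI)
qed (use crd_in in auto)

lemma finite_V: "finite (UNIV :: 'v set)"
  using finite_fspace[of "{..<n}"] crd_range crd_inj by (metis finite_imageD finite_lessThan)

lemma dcrd_range: "range dcrd = fspace {..<n}"
proof -
  have "inj dcrd"
  proof (rule injI)
    fix y y' assume e: "dcrd y = dcrd y'"
    have "h v y = h v y'" for v using h_coordinates[of v y] h_coordinates[of v y'] e by simp
    then have "h v (y - y') = 0" for v by (simp add: h_diff_right)
    then have "y - y' = 0" by (rule h_nondeg)
    then show "y = y'" by simp
  qed
  then have "card (range dcrd) = card (UNIV :: 'v set)" by (rule card_image)
  also have "\<dots> = card (fspace {..<n} :: (nat \<Rightarrow> 'a) set)" using card_image[OF crd_inj] crd_range by simp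
  finally show ?thesis using dcrd_in by (intro card_subset_eq finite_fspace) auto
qed

text \<open>The restrictions on the two arguments are removed in turn. Orthogonal singular
  \<open>x\<close> and \<open>y\<close> span singular vectors only, and the expansion in
  \<open>\<mu>\<close> and \<open>\<mu> ^ q\<close> decouples the arguments. A nonsingular argument
  is moved along a nonsingular \<open>w\<close> orthogonal to both; more than \<open>q\<close> of
  the vectors met are singular, too many for a polynomial of degree \<open>q - 1\<close>.\<close>

lemma singular_vectors_determine_biform:
  assumes G: "biform (q - 1) G" and van: "\<And>x. h x x = 0 \<Longrightarrow> G (crd x) (dcrd x) = 0"
    and xz: "x \<in> fspace {..<n}" "z \<in> fspace {..<n}" "(\<Sum>i<n. x i * z i) = 0"
  shows "G x z = 0"
proof -
  have q1: "q - 1 < q" using q_ge_2 by simp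
  have roots: "poly P 0 = 0" if P: "degree P \<le> q - 1" "card {\<mu>. poly P \<mu> = 0} \<ge> q" for P :: "'a poly"
  proof (rule ccontr)
    assume "poly P 0 \<noteq> 0"
    then have "P \<noteq> 0" by auto
    then have "card {\<mu>. poly P \<mu> = 0} \<le> degree P" by (rule card_poly_roots_bound)
    then show False using P q1 by simp
  qed
  have s1: "G (crd x) (dcrd y) = 0" if xx: "h x x = 0" and yy: "h y y = 0" and xy: "h x y = 0" for x y
  proof -
    have yx: "h y x = 0" using xy h_eq_0_commute[of x y] by simp
    obtain c where c: "\<And>\<mu> \<nu>. G (\<lambda>i. crd x i + \<mu> * crd y i) (\<lambda>i. dcrd x i + \<nu> * dcrd y i)
        = (\<Sum>i\<le>q-1. \<Sum>j\<le>q-1. c i j * \<mu> ^ i * \<nu> ^ j)"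
      using biform_line[OF G] by blast
    have "(\<Sum>i\<le>q-1. \<Sum>j\<le>q-1. c i j * \<mu> ^ i * (\<mu> ^ q) ^ j) = 0" for \<mu>
    proof -
      have "h (x + \<mu> *s y) (x + \<mu> *s y) = 0" using xx yy xy yx by (simp add: h_simps)
      from van[OF this] show ?thesis unfolding c[symmetric] by (simp add: crd_add crd_scale dcrd_add dcrd_scale)
    qed
    then have "c i j = 0" if "i \<le> q - 1" "j \<le> q - 1" for i j
      using sum_powers_eq_0_imp[OF card_field q1] that by blast
    then have all0: "G (\<lambda>i. crd x i + \<mu> * crd y i) (\<lambda>i. dcrd x i + \<nu> * dcrd y i) = 0" for \<mu> \<nu>
      using c[of \<mu> \<nu>] by simp
    \<comment> \<open>The point \<open>dcrd y\<close> is the point at infinity of the line from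
      \<open>dcrd x\<close> in its direction. Homogeneity gives a zero at every
      \<open>\<nu> \<noteq> 0\<close>, and these \<open>q\<^sup>2 - 1 \<ge> q\<close> zeros force
      one at \<open>\<nu> = 0\<close>.\<close>
    obtain P where P: "degree P \<le> q - 1" "\<And>\<nu>. G (crd x) (\<lambda>i. dcrd y i + \<nu> * dcrd x i) = poly P \<nu>"
      using biform_line_right[OF G] by blast
    have "poly P \<nu> = 0" if "\<nu> \<noteq> 0" for \<nu>
    proof -
      have "(\<lambda>i. dcrd y i + \<nu> * dcrd x i) = (\<lambda>i. \<nu> * (dcrd x i + inverse \<nu> * dcrd y i))"
        using that by (simp add: fun_eq_iff field_simps)
      then have "poly P \<nu> = G (crd x) (\<lambda>i. \<nu> * (dcrd x i + inverse \<nu> * dcrd y i))"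
        unfolding P(2)[symmetric] by simp
      also have "\<dots> = \<nu> ^ (q - 1) * G (\<lambda>i. crd x i + 0 * crd y i) (\<lambda>i. dcrd x i + inverse \<nu> * dcrd y i)"
        using biform_homog_right[OF G] by simp
      finally show ?thesis unfolding all0 by simp
    qed
    then have "UNIV - {0} \<subseteq> {\<nu>. poly P \<nu> = 0}" by auto
    then have "card (UNIV - {0::'a}) \<le> card {\<nu>. poly P \<nu> = 0}" by (intro card_mono) auto
    moreover have "q \<le> q\<^sup>2 - 1"
    proof -
      have "q + 1 \<le> q + q" using q_ge_2 by simp
      also have "\<dots> \<le> q * q" using q_ge_2 by (metis mult_2 mult_le_mono1)
      finally show ?thesis by (simp add: power2_eq_square)
    qed
    ultimately have "poly P 0 = 0" using roots[OF P(1)] by (simp add: card_Diff_subset card_field)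
    then show ?thesis using P(2)[of 0] by simp
  qed
  have s2: "G (crd x) (dcrd y) = 0" if yy: "h y y = 0" and xy: "h x y = 0" for x y
  proof (cases "h x x = 0")
    case False
    obtain w where w: "h w w \<noteq> 0" "h w y = 0" "h w x = 0"
        using nonsingular_orthogonal_to_pair[OF False, of y] xy h_eq_0_commute[of x y] by auto
    obtain P where P: "degree P \<le> q - 1" "\<And>\<mu>. G (\<lambda>i. crd x i + \<mu> * crd w i) (dcrd y) = poly P \<mu>"
      using biform_line_left[OF G] by blast
    have "{\<mu>. h (x + \<mu> *s w) (x + \<mu> *s w) = 0} \<subseteq> {\<mu>. poly P \<mu> = 0}"
    proof clarify
      fix \<mu> assume a: "h (x + \<mu> *s w) (x + \<mu> *s w) = 0"
      have "G (crd (x + \<mu> *s w)) (dcrd y) = 0" by (rule s1[OF a yy]) (use xy w in \<open>simp add: h_simps\<close>)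
      then show "poly P \<mu> = 0" by (simp add: P(2)[symmetric] crd_add crd_scale)
    qed
    then have "card {\<mu>. h (x + \<mu> *s w) (x + \<mu> *s w) = 0} \<le> card {\<mu>. poly P \<mu> = 0}" by (intro card_mono) auto
    then have "poly P 0 = 0" using many_singular_on_line[OF False w(1,3)] by (intro roots[OF P(1)]) simp
    then show ?thesis using P(2)[of 0] by simp
  qed (rule s1[OF _ yy xy])
  have s3: "G (crd x) (dcrd y) = 0" if xy: "h x y = 0" for x y
  proof (cases "h y y = 0")
    case False
    obtain w where w: "h w w \<noteq> 0" "h w x = 0" "h w y = 0"
      using nonsingular_orthogonal_to_pair[OF False xy] by blast
    have xw: "h x w = 0" using w(2) h_eq_0_commute[of x w] by simp
    obtain P where P: "degree P \<le> q - 1" "\<And>\<mu>. G (crd x) (\<lambda>i. dcrd y i + \<mu> * dcrd w i) = poly P \<mu>"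
      using biform_line_right[OF G] by blast
    let ?S = "{\<mu>. h (y + \<mu> *s w) (y + \<mu> *s w) = 0}"
    \<comment> \<open>The dual coordinates move with the conjugate parameter; conjugation is
      injective, so the number of roots is preserved.\<close>
    have "(\<lambda>\<mu>. \<mu> ^ q) ` ?S \<subseteq> {\<mu>. poly P \<mu> = 0}"
    proof clarify
      fix \<mu> assume a: "h (y + \<mu> *s w) (y + \<mu> *s w) = 0"
      have "G (crd x) (dcrd (y + \<mu> *s w)) = 0" by (rule s2[OF a]) (use xy xw in \<open>simp add: h_simps\<close>)
      then show "poly P (\<mu> ^ q) = 0" by (simp add: P(2)[symmetric] dcrd_add dcrd_scale)
    qed
    then have "card ((\<lambda>\<mu>. \<mu> ^ q) ` ?S) \<le> card {\<mu>. poly P \<mu> = 0}" by (intro card_mono) auto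
    moreover have "inj_on (\<lambda>\<mu>::'a. \<mu> ^ q) ?S" by (rule inj_on_inverseI[where g="\<lambda>\<mu>. \<mu> ^ q"]) (simp add: conj_conj)
    ultimately have "card ?S \<le> card {\<mu>. poly P \<mu> = 0}" by (simp add: card_image)
    then have "poly P 0 = 0" using many_singular_on_line[OF False w(1,3)] by (intro roots[OF P(1)]) simp
    then show ?thesis using P(2)[of 0] by simp
  qed (rule s2[OF _ xy])
  have "x \<in> range crd" "z \<in> range dcrd" using xz(1,2) crd_range dcrd_range by simp_all
  then obtain v y where "crd v = x" "dcrd y = z" by (elim imageE) simp
  then show ?thesis using s3[of v y] xz(3) h_coordinates[of v y] by simp
qed

end

section \<open>Coefficient arrays of bihomogeneous polynomials\<close>

definition expo :: "nat \<Rightarrow> nat \<Rightarrow> (nat \<Rightarrow> nat) set" where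
  "expo n k = {\<alpha>. (\<forall>i\<ge>n. \<alpha> i = 0) \<and> (\<Sum>i<n. \<alpha> i) = k}"

text \<open>Exponents of degree \<open>k - 1\<close>; for \<open>k = 0\<close> the truncated
  subtraction would give degree zero instead of no exponents.\<close>

definition expo_pred :: "nat \<Rightarrow> nat \<Rightarrow> (nat \<Rightarrow> nat) set" where
  "expo_pred n k = (if k = 0 then {} else expo n (k - 1))"

lemma expo_pred_Suc [simp]: "expo_pred n (Suc k) = expo n k"
  unfolding expo_pred_def by simp

definition inc :: "(nat \<Rightarrow> nat) \<Rightarrow> nat \<Rightarrow> nat \<Rightarrow> nat" where "inc \<alpha> i = \<alpha>(i := \<alpha> i + 1)"
definition dec :: "(nat \<Rightarrow> nat) \<Rightarrow> nat \<Rightarrow> nat \<Rightarrow> nat" where "dec \<alpha> i = \<alpha>(i := \<alpha> i - 1)"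

lemma inc_apply: "inc \<alpha> i j = (if j = i then Suc (\<alpha> i) else \<alpha> j)"
  and dec_apply: "dec \<alpha> i j = (if j = i then \<alpha> i - 1 else \<alpha> j)"
  unfolding inc_def dec_def by auto

lemma bij_expo_lists: "bij_betw (\<lambda>\<alpha>. map \<alpha> [0..<n]) (expo n k) {l. length l = n \<and> sum_list l = k}"
proof (rule bij_betwI[where g="\<lambda>l i. if i < n then l ! i else 0"])
  show "(\<lambda>\<alpha>. map \<alpha> [0..<n]) \<in> expo n k \<rightarrow> {l. length l = n \<and> sum_list l = k}"
    unfolding expo_def by (auto simp: interv_sum_list_conv_sum_set_nat atLeast0LessThan)
  show "(\<lambda>l i. if i < n then l ! i else 0) \<in> {l. length l = n \<and> sum_list l = k} \<rightarrow> expo n k"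
    unfolding expo_def by (auto simp: sum_list_sum_nth atLeast0LessThan)
qed (auto simp: expo_def fun_eq_iff intro!: nth_equalityI)

lemma card_expo:
  assumes "n \<ge> 1"
  shows "card (expo n k) = (n + k - 1) choose (n - 1)"
proof -
  have "card (expo n k) = (k + n - 1) choose k"
    using bij_betw_same_card[OF bij_expo_lists[of n k]] card_length_sum_list[of n k] by simp
  also have "\<dots> = (k + n - 1) choose (n - 1)"
    using assms by (subst binomial_symmetric) auto
  finally show ?thesis by (simp add: add.commute)
qed

lemma card_expo_pred:
  assumes "n \<ge> 2"
  shows "card (expo_pred n k) = (n + k - 2) choose (n - 1)"
  using assms card_expo[of n "k - 1"] by (cases k) (auto simp: expo_pred_def numeral_2_eq_2)

lemma finite_expo [simp]: "finite (expo n k)"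
proof -
  have "finite {l. set l \<subseteq> {..k} \<and> length l = n}" by (rule finite_lists_length_eq) simp
  moreover have "{l. length l = n \<and> sum_list l = k} \<subseteq> {l. set l \<subseteq> {..k} \<and> length l = n}"
    using member_le_sum_list by fastforce
  ultimately have "finite {l. length l = n \<and> sum_list l = k}" by (rule finite_subset[rotated])
  then show ?thesis using bij_betw_finite[OF bij_expo_lists[of n k]] by simp
qed

lemma finite_expo_pred [simp]: "finite (expo_pred n k)"
  unfolding expo_pred_def by simp

lemma expo_le:
  assumes "\<alpha> \<in> expo n k"
  shows "\<alpha> i \<le> k"
proof (cases "i < n")
  case True
  then have "\<alpha> i \<le> (\<Sum>i<n. \<alpha> i)" by (intro member_le_sum) auto
  then show ?thesis using assms unfolding expo_def by simp
qed (use assms in \<open>auto simp: expo_def\<close>)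

lemma sum_inc: "i < n \<Longrightarrow> (\<Sum>j<n. inc \<alpha> i j) = Suc (\<Sum>j<n. \<alpha> j)"
  by (simp add: sum.remove[of "{..<n}" i] inc_apply)

lemma inc_in_expo_iff:
  assumes "i < n"
  shows "inc \<alpha> i \<in> expo n k \<longleftrightarrow> \<alpha> \<in> expo_pred n k"
  unfolding expo_pred_def expo_def mem_Collect_eq sum_inc[OF assms] using assms
  by (cases k) (auto simp: inc_apply)

lemma inc_dec: "\<alpha> i > 0 \<Longrightarrow> inc (dec \<alpha> i) i = \<alpha>"
  by (auto simp: fun_eq_iff inc_apply dec_apply)

lemma dec_inc: "dec (inc \<alpha> i) i = \<alpha>"
  by (auto simp: fun_eq_iff inc_apply dec_apply)

lemma dec_in_expo_pred_iff:
  assumes "i < n" "\<alpha> i > 0"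
  shows "dec \<alpha> i \<in> expo_pred n k \<longleftrightarrow> \<alpha> \<in> expo n k"
  using inc_in_expo_iff[OF assms(1), of "dec \<alpha> i" k] inc_dec[of \<alpha> i] assms(2) by simp

definition "inc2 e i = (inc (fst e) i, inc (snd e) i)"
definition "dec2 e i = (dec (fst e) i, dec (snd e) i)"
definition "biexpo n k = expo n k \<times> expo n k"
definition "biexpo_pred n k = expo_pred n k \<times> expo_pred n k"

lemma finite_biexpo [simp]: "finite (biexpo n k)" "finite (biexpo_pred n k)"
  unfolding biexpo_def biexpo_pred_def by auto

lemma biexpo_pred_Suc [simp]: "biexpo_pred n (Suc k) = biexpo n k"
  unfolding biexpo_pred_def biexpo_def by simp

lemma inc2_in_biexpo_iff: "i < n \<Longrightarrow> inc2 e i \<in> biexpo n k \<longleftrightarrow> e \<in> biexpo_pred n k"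
  unfolding inc2_def biexpo_def biexpo_pred_def by (cases e) (simp add: inc_in_expo_iff)

lemma dec2_in_biexpo_pred_iff:
  "i < n \<Longrightarrow> fst e i > 0 \<Longrightarrow> snd e i > 0 \<Longrightarrow> dec2 e i \<in> biexpo_pred n k \<longleftrightarrow> e \<in> biexpo n k"
  unfolding dec2_def biexpo_def biexpo_pred_def by (cases e) (simp add: dec_in_expo_pred_iff)

lemma inc2_dec2: "fst e i > 0 \<Longrightarrow> snd e i > 0 \<Longrightarrow> inc2 (dec2 e i) i = e"
  unfolding inc2_def dec2_def by (cases e) (simp add: inc_dec)

lemma dec2_inc2: "dec2 (inc2 e i) i = e"
  unfolding inc2_def dec2_def by (cases e) (simp add: dec_inc)

text \<open>Pairs of an exponent and a variable occurring in it correspond to pairs of an exponent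
  of degree one less and a variable to be added. This underlies the multinomial expansion; the
  version for biexponents underlies multiplication by \<open>\<sigma>\<close> and its
  adjoint.\<close>

lemma sum_expo_reindex:
  fixes F :: "nat \<Rightarrow> (nat \<Rightarrow> nat) \<Rightarrow> (nat \<Rightarrow> nat) \<Rightarrow> 'b::comm_monoid_add"
  shows "(\<Sum>\<alpha>\<in>expo n k. \<Sum>i<n. if \<alpha> i > 0 then F i (dec \<alpha> i) \<alpha> else 0) = (\<Sum>\<alpha>\<in>expo_pred n k. \<Sum>i<n. F i \<alpha> (inc \<alpha> i))"
proof -
  have "(\<Sum>\<alpha>\<in>expo n k. if \<alpha> i > 0 then F i (dec \<alpha> i) \<alpha> else 0) = (\<Sum>\<alpha>\<in>expo_pred n k. F i \<alpha> (inc \<alpha> i))"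
    if i: "i < n" for i
  proof -
    have "(\<Sum>\<alpha>\<in>expo n k. if \<alpha> i > 0 then F i (dec \<alpha> i) \<alpha> else 0) = (\<Sum>\<alpha>\<in>{\<alpha>\<in>expo n k. \<alpha> i > 0}. F i (dec \<alpha> i) \<alpha>)"
      by (simp add: sum.inter_filter)
    also have "\<dots> = (\<Sum>\<alpha>\<in>expo_pred n k. F i \<alpha> (inc \<alpha> i))"
      by (rule sum.reindex_bij_witness[of _ "\<lambda>\<alpha>. inc \<alpha> i" "\<lambda>\<alpha>. dec \<alpha> i"])
         (use i in \<open>auto simp: inc_in_expo_iff dec_in_expo_pred_iff inc_dec dec_inc inc_apply\<close>)
    finally show ?thesis .
  qed
  then show ?thesis
    by (subst sum.swap, subst (2) sum.swap) (auto intro!: sum.cong)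
qed

lemma sum_biexpo_reindex:
  fixes F :: "nat \<Rightarrow> (nat \<Rightarrow> nat) \<times> (nat \<Rightarrow> nat) \<Rightarrow> (nat \<Rightarrow> nat) \<times> (nat \<Rightarrow> nat) \<Rightarrow> 'b::comm_monoid_add"
  shows "(\<Sum>e\<in>biexpo n k. \<Sum>i<n. if fst e i > 0 \<and> snd e i > 0 then F i (dec2 e i) e else 0)
    = (\<Sum>e\<in>biexpo_pred n k. \<Sum>i<n. F i e (inc2 e i))"
proof -
  have "(\<Sum>e\<in>biexpo n k. if fst e i > 0 \<and> snd e i > 0 then F i (dec2 e i) e else 0) = (\<Sum>e\<in>biexpo_pred n k. F i e (inc2 e i))"
    if i: "i < n" for i
  proof -
    have "(\<Sum>e\<in>biexpo n k. if fst e i > 0 \<and> snd e i > 0 then F i (dec2 e i) e else 0)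
        = (\<Sum>e\<in>{e\<in>biexpo n k. fst e i > 0 \<and> snd e i > 0}. F i (dec2 e i) e)"
      by (simp add: sum.inter_filter)
    also have "\<dots> = (\<Sum>e\<in>biexpo_pred n k. F i e (inc2 e i))"
    proof (rule sum.reindex_bij_witness[of _ "\<lambda>e. inc2 e i" "\<lambda>e. dec2 e i"])
      fix e assume "e \<in> {e\<in>biexpo n k. fst e i > 0 \<and> snd e i > 0}"
      then show "inc2 (dec2 e i) i = e" "dec2 e i \<in> biexpo_pred n k" "F i (dec2 e i) (inc2 (dec2 e i) i) = F i (dec2 e i) e"
        using i by (auto simp: inc2_dec2 dec2_in_biexpo_pred_iff)
    next
      fix e assume e: "e \<in> biexpo_pred n k"
      show "dec2 (inc2 e i) i = e" by (rule dec2_inc2)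
      show "inc2 e i \<in> {e\<in>biexpo n k. fst e i > 0 \<and> snd e i > 0}"
        using e inc2_in_biexpo_iff[OF i, of e k] by (simp add: inc2_def inc_apply)
    qed
    finally show ?thesis .
  qed
  then show ?thesis
    by (subst sum.swap, subst (2) sum.swap) (auto intro!: sum.cong)
qed

section \<open>Evaluation of arrays, multiplication by \<open>\<sigma>\<close> and the
  Laplacian\<close>

definition power_prod :: "nat \<Rightarrow> (nat \<Rightarrow> 'r::comm_ring_1) \<Rightarrow> (nat \<Rightarrow> nat) \<Rightarrow> 'r" where
  "power_prod n x \<alpha> = (\<Prod>i<n. x i ^ \<alpha> i)"

lemma power_prod_inc: "i < n \<Longrightarrow> power_prod n x (inc \<alpha> i) = x i * power_prod n x \<alpha>"
  unfolding power_prod_def by (simp add: prod.remove[of "{..<n}" i] inc_apply algebra_simps)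

text \<open>The coefficient map \<open>\<iota>\<close> allows the same array to be evaluated at
  field elements, at multivariate polynomials and at univariate polynomials over these.\<close>

definition bieval :: "('a \<Rightarrow> 'r::comm_ring_1) \<Rightarrow> nat \<Rightarrow> ((nat \<Rightarrow> nat) \<times> (nat \<Rightarrow> nat)) set
    \<Rightarrow> ((nat \<Rightarrow> nat) \<times> (nat \<Rightarrow> nat) \<Rightarrow> 'a) \<Rightarrow> (nat \<Rightarrow> 'r) \<Rightarrow> (nat \<Rightarrow> 'r) \<Rightarrow> 'r" where
  "bieval \<iota> n E c x z = (\<Sum>e\<in>E. \<iota> (c e) * (power_prod n x (fst e) * power_prod n z (snd e)))"

abbreviation "beval \<equiv> bieval (\<lambda>x. x)"

text \<open>On coefficient arrays, multiplication by \<open>\<sigma> = \<Sum>\<^sub>i x\<^sub>i z\<^sub>i\<close> and the operator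
  \<open>\<Sum>\<^sub>i \<partial>\<^sup>2 / \<partial>x\<^sub>i \<partial>z\<^sub>i\<close>.\<close>

definition mult_sigma :: "nat \<Rightarrow> ((nat \<Rightarrow> nat) \<times> (nat \<Rightarrow> nat) \<Rightarrow> 'a) \<Rightarrow> (nat \<Rightarrow> nat) \<times> (nat \<Rightarrow> nat) \<Rightarrow> 'a::comm_ring_1" where
  "mult_sigma n c = (\<lambda>e. \<Sum>i<n. if fst e i > 0 \<and> snd e i > 0 then c (dec2 e i) else 0)"

definition laplace :: "nat \<Rightarrow> ((nat \<Rightarrow> nat) \<times> (nat \<Rightarrow> nat) \<Rightarrow> 'a) \<Rightarrow> (nat \<Rightarrow> nat) \<times> (nat \<Rightarrow> nat) \<Rightarrow> 'a::comm_ring_1" where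
  "laplace n c = (\<lambda>e. \<Sum>i<n. of_nat ((fst e i + 1) * (snd e i + 1)) * c (inc2 e i))"

lemma beval_mult_sigma:
  "beval n (biexpo n k) (mult_sigma n c) x z = (\<Sum>i<n. x i * z i) * beval n (biexpo_pred n k) c x z"
proof -
  have "beval n (biexpo n k) (mult_sigma n c) x z
      = (\<Sum>e\<in>biexpo n k. \<Sum>i<n. if fst e i > 0 \<and> snd e i > 0 then c (dec2 e i) * (power_prod n x (fst e) * power_prod n z (snd e)) else 0)"
    unfolding bieval_def mult_sigma_def by (intro sum.cong refl) (simp add: sum_distrib_right, intro sum.cong, auto)
  also have "\<dots> = (\<Sum>e\<in>biexpo_pred n k. \<Sum>i<n. c e * (power_prod n x (fst (inc2 e i)) * power_prod n z (snd (inc2 e i))))"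
    by (rule sum_biexpo_reindex[where F="\<lambda>i e' e. c e' * (power_prod n x (fst e) * power_prod n z (snd e))"])
  also have "\<dots> = (\<Sum>e\<in>biexpo_pred n k. (\<Sum>i<n. x i * z i) * (c e * (power_prod n x (fst e) * power_prod n z (snd e))))"
    by (intro sum.cong refl) (simp add: inc2_def power_prod_inc sum_distrib_right sum_distrib_left algebra_simps)
  finally show ?thesis unfolding bieval_def by (simp add: sum_distrib_left)
qed

lemma mult_sigma_add: "mult_sigma n (c + d) = mult_sigma n c + mult_sigma n d"
  unfolding mult_sigma_def plus_fun_def sum.distrib[symmetric] by (intro ext sum.cong refl) simp

lemma mult_sigma_scale: "mult_sigma n (\<lambda>e. a * c e) = (\<lambda>e. a * mult_sigma n c e)"
  unfolding mult_sigma_def sum_distrib_left by (intro ext sum.cong refl) simp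

lemma mult_sigma_zero: "mult_sigma n 0 = 0"
  unfolding mult_sigma_def zero_fun_def by simp

lemma laplace_add: "laplace n (c + d) = laplace n c + laplace n d"
  unfolding laplace_def plus_fun_def sum.distrib[symmetric] by (intro ext sum.cong refl) (simp add: distrib_left)

lemma laplace_zero: "laplace n 0 = 0"
  unfolding laplace_def zero_fun_def by simp

lemma mult_sigma_in: "c \<in> fspace (biexpo_pred n k) \<Longrightarrow> mult_sigma n c \<in> fspace (biexpo n k)"
  unfolding fspace_def mult_sigma_def mem_Collect_eq
  by (intro allI impI sum.neutral ballI) (simp add: dec2_in_biexpo_pred_iff del: split_paired_All)

lemma laplace_in: "c \<in> fspace (biexpo n k) \<Longrightarrow> laplace n c \<in> fspace (biexpo_pred n k)"
  unfolding fspace_def laplace_def mem_Collect_eq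
  by (intro allI impI sum.neutral ballI) (simp add: inc2_in_biexpo_iff del: split_paired_All)

text \<open>Comparing the coefficient of \<open>x\<^sub>0 z\<^sub>0 m\<close> on both sides expresses the coefficient of \<open>m\<close>
  through coefficients of monomials with a higher power of \<open>x\<^sub>0\<close>.\<close>

lemma mult_sigma_eq_0_imp:
  assumes "n \<ge> 1" "mult_sigma n c = 0"
  shows "c = 0"
proof -
  have "c (\<alpha>, \<beta>) = 0" for \<alpha> \<beta>
  proof (induction "\<Sum>j\<in>{1..<n}. \<alpha> j" arbitrary: \<alpha> \<beta> rule: less_induct)
    case less
    let ?e = "inc2 (\<alpha>, \<beta>) 0"
    have "0 = mult_sigma n c ?e" using assms(2) by simp
    also have "\<dots> = (if fst ?e 0 > 0 \<and> snd ?e 0 > 0 then c (dec2 ?e 0) else 0)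
        + (\<Sum>i\<in>{1..<n}. if fst ?e i > 0 \<and> snd ?e i > 0 then c (dec2 ?e i) else 0)"
    proof -
      have "{..<n} = insert 0 {1..<n}" using assms(1) by auto
      then show ?thesis unfolding mult_sigma_def by simp
    qed
    also have "(\<Sum>i\<in>{1..<n}. if fst ?e i > 0 \<and> snd ?e i > 0 then c (dec2 ?e i) else 0) = 0"
    proof (rule sum.neutral, rule ballI)
      fix i assume i: "i \<in> {1..<n}"
      show "(if fst ?e i > 0 \<and> snd ?e i > 0 then c (dec2 ?e i) else 0) = 0"
      proof (cases "fst ?e i > 0 \<and> snd ?e i > 0")
        case True
        have pos: "\<alpha> i > 0" using True i by (auto simp: inc2_def inc_apply)
        have "(\<Sum>j\<in>{1..<n}. dec (fst ?e) i j) < (\<Sum>j\<in>{1..<n}. \<alpha> j)"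
        proof (rule sum_strict_mono_ex1)
          show "\<forall>j\<in>{1..<n}. dec (fst ?e) i j \<le> \<alpha> j" by (auto simp: inc2_def inc_apply dec_apply)
          show "\<exists>j\<in>{1..<n}. dec (fst ?e) i j < \<alpha> j" using pos i by (intro bexI[of _ i]) (auto simp: inc2_def inc_apply dec_apply)
        qed simp
        from less.hyps[OF this] show ?thesis by (simp add: dec2_def)
      next
        case False
        then show ?thesis by (rule if_not_P)
      qed
    qed
    finally have "0 = (if fst ?e 0 > 0 \<and> snd ?e 0 > 0 then c (dec2 ?e 0) else 0)" by simp
    moreover have "fst ?e 0 > 0 \<and> snd ?e 0 > 0" by (simp add: inc2_def inc_apply)
    ultimately show ?case by (simp add: dec2_inc2)
  qed
  then show ?thesis by (auto simp: fun_eq_iff)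
qed

text \<open>Terms that raise one index and lower a different one agree on both sides. On the
  diagonal \<open>(a + 1) * (b + 1) - a * b = a + b + 1\<close>, which adds up to the total degree
  plus \<open>n\<close>.\<close>

lemma laplace_mult_sigma:
  "laplace n (mult_sigma n c) e = mult_sigma n (laplace n c) e + of_nat ((\<Sum>i<n. fst e i) + (\<Sum>i<n. snd e i) + n) * c e"
proof -
  define L where "L = (\<lambda>i j. of_nat ((fst e i + 1) * (snd e i + 1)) *
      (if fst (inc2 e i) j > 0 \<and> snd (inc2 e i) j > 0 then c (dec2 (inc2 e i) j) else 0))"
  define R where "R = (\<lambda>i j. if fst e j > 0 \<and> snd e j > 0
      then of_nat ((fst (dec2 e j) i + 1) * (snd (dec2 e j) i + 1)) * c (inc2 (dec2 e j) i) else 0)"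
  have LR: "L i j = R i j + (if j = i then of_nat (fst e i + snd e i + 1) * c e else 0)" for i j
  proof (cases "i = j")
    case True
    have "L i j = of_nat ((fst e i + 1) * (snd e i + 1)) * c e"
      unfolding L_def True dec2_inc2 by (simp add: inc2_def inc_apply)
    moreover have "R i j = of_nat (fst e i * snd e i) * c e"
    proof (cases "fst e j > 0 \<and> snd e j > 0")
      case pos: True
      then have "fst (dec2 e j) j + 1 = fst e j" "snd (dec2 e j) j + 1 = snd e j"
        by (simp_all add: dec2_def dec_apply)
      then show ?thesis using pos unfolding R_def True by (simp only: inc2_dec2) simp
    qed (auto simp: R_def True)
    ultimately show ?thesis using True by (simp add: algebra_simps)
  next
    case False
    then have "dec2 (inc2 e i) j = inc2 (dec2 e j) i"
      unfolding dec2_def inc2_def by (auto simp: fun_eq_iff inc_apply dec_apply)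
    then show ?thesis using False unfolding L_def R_def by (simp add: inc2_def dec2_def inc_apply dec_apply)
  qed
  have "laplace n (mult_sigma n c) e = (\<Sum>i<n. \<Sum>j<n. L i j)"
    unfolding laplace_def mult_sigma_def L_def by (simp add: sum_distrib_left)
  also have "\<dots> = (\<Sum>i<n. \<Sum>j<n. R i j) + (\<Sum>i<n. of_nat (fst e i + snd e i + 1) * c e)"
    unfolding LR by (simp add: sum.distrib)
  also have "(\<Sum>i<n. \<Sum>j<n. R i j) = mult_sigma n (laplace n c) e"
    unfolding laplace_def mult_sigma_def R_def by (subst sum.swap, intro sum.cong refl) auto
  also have "(\<Sum>i<n. of_nat (fst e i + snd e i + 1) * c e) = of_nat ((\<Sum>i<n. fst e i) + (\<Sum>i<n. snd e i) + n) * c e"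
    by (simp add: sum_distrib_left sum.distrib algebra_simps)
  finally show ?thesis .
qed

lemma mult_sigma_pow_in: "c \<in> fspace (biexpo n m) \<Longrightarrow> (mult_sigma n ^^ j) c \<in> fspace (biexpo n (m + j))"
proof (induction j)
  case (Suc j)
  then have "mult_sigma n ((mult_sigma n ^^ j) c) \<in> fspace (biexpo n (Suc (m + j)))"
    by (intro mult_sigma_in) simp
  then show ?case by simp
qed simp

lemma mult_sigma_pow_eq_0_imp: "n \<ge> 1 \<Longrightarrow> (mult_sigma n ^^ j) c = 0 \<Longrightarrow> c = 0"
proof (induction j)
  case (Suc j)
  have "mult_sigma n ((mult_sigma n ^^ j) c) = 0" using Suc.prems(2) by (simp only: funpow.simps comp_apply)
  from Suc.IH[OF Suc.prems(1) mult_sigma_eq_0_imp[OF Suc.prems(1) this]] show ?case .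
qed (simp only: funpow.simps id_apply)

lemma mult_sigma_pow_zero: "(mult_sigma n ^^ j) 0 = 0"
  by (induction j) (simp_all only: funpow.simps comp_apply id_apply mult_sigma_zero)

lemma mult_sigma_pow_add: "(mult_sigma n ^^ j) (c + d) = (mult_sigma n ^^ j) c + (mult_sigma n ^^ j) d"
  by (induction j) (simp_all only: funpow.simps comp_apply id_apply mult_sigma_add)
lemma mult_sigma_pow_scale: "(mult_sigma n ^^ j) (\<lambda>e. a * c e) = (\<lambda>e. a * (mult_sigma n ^^ j) c e)"
  by (induction j) (simp_all only: funpow.simps comp_apply id_apply mult_sigma_scale)

text \<open>Summing the commutator scalars \<open>n + 2 * (m + i)\<close> over \<open>i < j\<close>
  gives \<open>j * (n + 2 * m + j - 1)\<close>.\<close>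

lemma laplace_mult_sigma_pow:
  assumes c: "c \<in> fspace (biexpo n m)" and n: "n \<ge> 1"
  shows "laplace n ((mult_sigma n ^^ j) c)
    = (mult_sigma n ^^ j) (laplace n c) + (\<lambda>e. of_nat (j * (n + 2 * m + j - 1)) * (mult_sigma n ^^ (j - 1)) c e)"
proof (induction j)
  case 0
  show ?case by (auto simp: fun_eq_iff)
next
  case (Suc j)
  let ?s = "mult_sigma n"
  have "laplace n (?s ((?s ^^ j) c)) e = ((?s ^^ Suc j) (laplace n c) + (\<lambda>e. of_nat (Suc j * (n + 2 * m + Suc j - 1)) * (?s ^^ j) c e)) e" for e
  proof -
    have deg: "of_nat ((\<Sum>i<n. fst e i) + (\<Sum>i<n. snd e i) + n) * (?s ^^ j) c e = of_nat (2 * (m + j) + n) * (?s ^^ j) c e"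
    proof (cases "e \<in> biexpo n (m + j)")
      case True
      then have "(\<Sum>i<n. fst e i) = m + j" "(\<Sum>i<n. snd e i) = m + j" unfolding biexpo_def expo_def by auto
      then show ?thesis by (simp only: mult_2)
    next
      case False
      then show ?thesis using fspaceD[OF mult_sigma_pow_in[OF c, of j]] by simp
    qed
    have rec: "?s (\<lambda>e. of_nat (j * (n + 2 * m + j - 1)) * (?s ^^ (j - 1)) c e) e = of_nat (j * (n + 2 * m + j - 1)) * (?s ^^ j) c e"
      unfolding mult_sigma_scale by (cases j) simp_all
    have num: "j * (n + 2 * m + j - 1) + (2 * (m + j) + n) = Suc j * (n + 2 * m + Suc j - 1)"
      using n by (cases n) (auto simp: algebra_simps)
    have "laplace n (?s ((?s ^^ j) c)) e = ?s (laplace n ((?s ^^ j) c)) e + of_nat (2 * (m + j) + n) * (?s ^^ j) c e"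
      by (simp only: laplace_mult_sigma deg)
    also have "\<dots> = (?s ^^ Suc j) (laplace n c) e + (of_nat (j * (n + 2 * m + j - 1)) * (?s ^^ j) c e + of_nat (2 * (m + j) + n) * (?s ^^ j) c e)"
      unfolding Suc.IH mult_sigma_add using rec by simp
    also have "of_nat (j * (n + 2 * m + j - 1)) * (?s ^^ j) c e + of_nat (2 * (m + j) + n) * (?s ^^ j) c e
        = of_nat (Suc j * (n + 2 * m + Suc j - 1)) * (?s ^^ j) c e"
      unfolding num[symmetric] by (simp only: of_nat_add distrib_right)
    finally show ?thesis by simp
  qed
  then show ?case by (auto simp: fun_eq_iff)
qed

section \<open>Harmonic arrays in positive characteristic\<close>

definition harmonic :: "nat \<Rightarrow> nat \<Rightarrow> ((nat \<Rightarrow> nat) \<times> (nat \<Rightarrow> nat) \<Rightarrow> 'a::comm_ring_1) set" where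
  "harmonic n k = {c \<in> fspace (biexpo n k). laplace n c = 0}"

text \<open>A harmonic multiple of \<open>\<sigma>\<close> is written as \<open>\<sigma>\<^sup>j h\<close> with \<open>j\<close> maximal; the commutator formula then
  forces the degree of \<open>h\<close> modulo \<open>p\<close>.\<close>

lemma harmonic_multiple_of_sigma:
  fixes f :: "(nat \<Rightarrow> nat) \<times> (nat \<Rightarrow> nat) \<Rightarrow> 'a::field"
  assumes p: "prime p" "CHAR('a) = p" and n: "n \<ge> 2"
    and f: "laplace n f = 0" "f \<noteq> 0" "f = mult_sigma n g" "g \<in> fspace (biexpo_pred n (p - 1))"
  obtains m h where "m < p - 1" "p dvd n + m - 2" "h \<in> harmonic n m" "f = (mult_sigma n ^^ (p - 1 - m)) h"
proof -
  let ?s = "mult_sigma n"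
  define J where "J = {j. j \<le> p - 1 \<and> (\<exists>h\<in>fspace (biexpo n (p - 1 - j)). f = (?s ^^ j) h)}"
  have p2: "p \<ge> 2" using prime_ge_2_nat[OF p(1)] .
  have p1: "p - 1 = Suc (p - 1 - 1)" using p2 by simp
  have "g \<in> fspace (biexpo n (p - 1 - 1))" using f(4) by (subst (asm) p1) simp
  moreover have "f = (?s ^^ 1) g" using f(3) by simp
  moreover have "1 \<le> p - 1" using p2 by simp
  ultimately have J1: "1 \<in> J" unfolding J_def by (intro CollectI conjI bexI[of _ g])
  have finJ: "finite J" unfolding J_def by simp
  have J: "Max J \<in> J" "Max J \<ge> 1" using Max_in[OF finJ] Max_ge[OF finJ J1] J1 by auto
  define j where "j = Max J"
  define m where "m = p - 1 - j"
  have j: "1 \<le> j" "j \<le> p - 1" using J unfolding j_def[symmetric] by (simp_all add: J_def)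
  obtain h where h: "h \<in> fspace (biexpo n m)" "f = (?s ^^ j) h"
    using J(1) unfolding j_def[symmetric] unfolding J_def m_def mem_Collect_eq by (elim conjE bexE)
  have mx: "h \<noteq> ?s h'" if "h' \<in> fspace (biexpo_pred n m)" for h'
  proof
    assume hs: "h = ?s h'"
    have "h \<noteq> 0"
    proof
      assume "h = 0"
      then have "f = 0" unfolding h(2) by (simp only: mult_sigma_pow_zero)
      then show False using f(2) by contradiction
    qed
    have "m \<noteq> 0"
    proof
      assume "m = 0"
      then have "h' = 0" using that unfolding fspace_def biexpo_pred_def expo_pred_def by (auto simp: fun_eq_iff)
      then have "h = 0" unfolding hs by (simp only: mult_sigma_zero)
      then show False using \<open>h \<noteq> 0\<close> by contradiction
    qed
    then have m1: "m = Suc (p - 1 - Suc j)" unfolding m_def by simp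
    have "h' \<in> fspace (biexpo n (p - 1 - Suc j))" using that unfolding m1 by simp
    moreover have "f = (?s ^^ Suc j) h'" unfolding h(2) hs by (simp only: funpow_Suc_right comp_apply)
    moreover have "Suc j \<le> p - 1" using m1 unfolding m_def by simp
    ultimately have "Suc j \<in> J" unfolding J_def by (intro CollectI conjI bexI[of _ h'])
    then have "Suc j \<le> j" unfolding j_def by (rule Max_ge[OF finJ])
    then show False by simp
  qed
  define lam where "lam = (of_nat (j * (n + 2 * m + j - 1)) :: 'a)"
  have "(?s ^^ j) (laplace n h) + (\<lambda>e. lam * (?s ^^ (j - 1)) h e) = 0"
    using laplace_mult_sigma_pow[OF h(1), of j] n f(1) h(2) unfolding lam_def by simp
  moreover have "(?s ^^ j) (laplace n h) = (?s ^^ (j - 1)) (?s (laplace n h))"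
  proof -
    obtain j' where "j = Suc j'" using j(1) by (cases j) auto
    then show ?thesis by (simp only: funpow_Suc_right comp_apply diff_Suc_1)
  qed
  ultimately have "(?s ^^ (j - 1)) (?s (laplace n h) + (\<lambda>e. lam * h e)) = 0"
    by (simp only: mult_sigma_pow_add mult_sigma_pow_scale)
  then have z: "?s (laplace n h) + (\<lambda>e. lam * h e) = 0"
    by (rule mult_sigma_pow_eq_0_imp[rotated]) (use n in simp)
  have lh: "laplace n h \<in> fspace (biexpo_pred n m)" by (rule laplace_in[OF h(1)])
  \<comment> \<open>Otherwise the relation \<open>z\<close> exhibits \<open>h\<close> itself as a
    multiple of \<open>\<sigma>\<close>, against the maximality of \<open>j\<close>.\<close>
  have lam: "lam = 0"
  proof (rule ccontr)
    assume lam: "lam \<noteq> 0"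
    have hs: "h = ?s (\<lambda>e. (- 1 / lam) * laplace n h e)"
    proof
      fix e
      have "?s (laplace n h) e + lam * h e = 0" using fun_cong[OF z, of e] by simp
      then have "?s (laplace n h) e = - (lam * h e)" by (simp add: eq_neg_iff_add_eq_0)
      then show "h e = ?s (\<lambda>e. (- 1 / lam) * laplace n h e) e"
        unfolding mult_sigma_scale using lam by simp
    qed
    have "(\<lambda>e. (- 1 / lam) * laplace n h e) \<in> fspace (biexpo_pred n m)"
      by (rule lin_subspaceD(3)[OF lin_subspace_fspace lh])
    from mx[OF this] hs show False by (rule notE)
  qed
  then have "?s (laplace n h) = 0" using z by (simp add: plus_fun_def zero_fun_def)
  then have "laplace n h = 0" by (rule mult_sigma_eq_0_imp[rotated]) (use n in simp)
  then have harm: "h \<in> harmonic n m" using h(1) unfolding harmonic_def by simp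
  have "p dvd j * (n + 2 * m + j - 1)" using lam p(2) unfolding lam_def by (simp only: of_nat_eq_0_iff_char_dvd)
  moreover have "\<not> p dvd j" using j p2 by (auto dest: dvd_imp_le)
  ultimately have "p dvd n + 2 * m + j - 1" using prime_dvd_multD[OF p(1)] by auto
  \<comment> \<open>Here \<open>j = p - 1 - m\<close> turns the condition on the commutator scalar
    into one on \<open>m\<close> alone.\<close>
  moreover have "n + 2 * m + j - 1 = (n + m - 2) + p" using j p2 n unfolding m_def by simp
  ultimately have "p dvd n + m - 2" by simp
  moreover have "m < p - 1" "j = p - 1 - m" using j p2 unfolding m_def by auto
  ultimately show ?thesis using that[of m h] harm h(2) by simp
qed

text \<open>When \<open>p\<close> divides \<open>n + m - 2\<close>, the commutator scalar for the
  exponent \<open>p - 1 - m\<close> vanishes, so this power of \<open>\<sigma>\<close> preserves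
  harmonicity.\<close>

lemma mult_sigma_pow_harmonic:
  fixes h :: "(nat \<Rightarrow> nat) \<times> (nat \<Rightarrow> nat) \<Rightarrow> 'a::field"
  assumes p: "prime p" "CHAR('a) = p" and n: "n \<ge> 2"
    and m: "m < p - 1" "p dvd n + m - 2" and h: "h \<in> harmonic n m"
  shows "(mult_sigma n ^^ (p - 1 - m)) h \<in> harmonic n (p - 1) \<inter> mult_sigma n ` fspace (biexpo_pred n (p - 1))"
proof -
  let ?s = "mult_sigma n"
  define j where "j = p - 2 - m"
  have pm: "p - 1 - m = Suc j" "p - 1 = m + Suc j" using m(1) unfolding j_def by auto
  have hf: "h \<in> fspace (biexpo n m)" "laplace n h = 0" using h unfolding harmonic_def by auto
  have "n + 2 * m + Suc j - 1 = (n + m - 2) + p" using m(1) n unfolding j_def by simp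
  then have "p dvd n + 2 * m + Suc j - 1" using m(2) by simp
  then have "p dvd Suc j * (n + 2 * m + Suc j - 1)" by (rule dvd_mult)
  then have "(of_nat (Suc j * (n + 2 * m + Suc j - 1)) :: 'a) = 0" by (simp only: of_nat_eq_0_iff_char_dvd p(2))
  moreover have "laplace n ((?s ^^ Suc j) h) = (?s ^^ Suc j) (laplace n h)
      + (\<lambda>e. of_nat (Suc j * (n + 2 * m + Suc j - 1)) * (?s ^^ (Suc j - 1)) h e)"
    by (rule laplace_mult_sigma_pow[OF hf(1)]) (use n in simp)
  ultimately have "laplace n ((?s ^^ Suc j) h) = 0"
    unfolding hf(2) mult_sigma_pow_zero by (simp only: mult_zero_left) (simp add: fun_eq_iff)
  moreover have "(?s ^^ Suc j) h \<in> fspace (biexpo n (p - 1))"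
    unfolding pm(2) by (rule mult_sigma_pow_in[OF hf(1)])
  moreover have "(?s ^^ j) h \<in> fspace (biexpo_pred n (p - 1))"
    unfolding pm(2) using mult_sigma_pow_in[OF hf(1), of j] by simp
  then have "(?s ^^ Suc j) h \<in> ?s ` fspace (biexpo_pred n (p - 1))" by simp
  ultimately show ?thesis unfolding harmonic_def pm(1) by simp
qed

lemma card_mult_sigma_image:
  assumes "n \<ge> 1"
  shows "card (mult_sigma n ` (fspace (biexpo_pred n k) :: (_ \<Rightarrow> 'a::{field,finite}) set)) = CARD('a) ^ card (biexpo_pred n k)"
proof -
  have "inj (mult_sigma n :: (_ \<Rightarrow> 'a) \<Rightarrow> _)"
  proof (rule injI)
    fix c d :: "_ \<Rightarrow> 'a" assume e: "mult_sigma n c = mult_sigma n d"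
    have "mult_sigma n (c + (\<lambda>e. (-1) * d e)) = 0"
      unfolding mult_sigma_add mult_sigma_scale e by (auto simp: fun_eq_iff)
    then have "c + (\<lambda>e. (-1) * d e) = 0" by (rule mult_sigma_eq_0_imp[OF assms])
    then show "c = d" by (auto simp: fun_eq_iff add_eq_0_iff2)
  qed
  then show ?thesis by (subst card_image) (auto intro: inj_on_subset simp: card_fspace)
qed

text \<open>The admissible \<open>m\<close> are congruent modulo \<open>p\<close> and lie in an
  interval shorter than \<open>p\<close>, so there is at most one. For this \<open>m\<close> the
  power of \<open>\<sigma>\<close> maps the harmonic arrays of bidegree \<open>m\<close> bijectively
  onto \<open>K\<close>.\<close>

lemma card_harmonic_multiples_of_sigma:
  assumes p: "prime p" "CHAR('a::{field,finite}) = p" and n: "n \<ge> 2"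
  defines "K \<equiv> harmonic n (p - 1) \<inter> mult_sigma n ` (fspace (biexpo_pred n (p - 1)) :: (_ \<Rightarrow> 'a) set)"
  shows "m < p - 1 \<Longrightarrow> p dvd n + m - 2 \<Longrightarrow> card K = card (harmonic n m :: (_ \<Rightarrow> 'a) set)"
    and "(\<And>m. m < p - 1 \<Longrightarrow> \<not> p dvd n + m - 2) \<Longrightarrow> card K = 1"
proof -
  let ?s = "mult_sigma n :: (_ \<Rightarrow> 'a) \<Rightarrow> _"
  have zK: "0 \<in> K" unfolding K_def harmonic_def
    by (intro IntI CollectI conjI lin_subspaceD(1)[OF lin_subspace_fspace] laplace_zero
        image_eqI[where x=0] mult_sigma_zero[symmetric])
  {
    assume m: "m < p - 1" "p dvd n + m - 2"
    have "K = (?s ^^ (p - 1 - m)) ` harmonic n m"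
    proof (intro subset_antisym subsetI)
      fix f assume f: "f \<in> K"
      show "f \<in> (?s ^^ (p - 1 - m)) ` harmonic n m"
      proof (cases "f = 0")
        case True
        have "0 \<in> (harmonic n m :: (_ \<Rightarrow> 'a) set)" unfolding harmonic_def
          by (intro CollectI conjI lin_subspaceD(1)[OF lin_subspace_fspace] laplace_zero)
        then show ?thesis unfolding True by (rule image_eqI[rotated]) (simp only: mult_sigma_pow_zero)
      next
        case False
        obtain g where g: "f = ?s g" "g \<in> fspace (biexpo_pred n (p - 1))" "laplace n f = 0"
          using f unfolding K_def harmonic_def by auto
        obtain m' h where m': "m' < p - 1" "p dvd n + m' - 2" "h \<in> harmonic n m'" "f = (?s ^^ (p - 1 - m')) h"
          by (rule harmonic_multiple_of_sigma[OF p n g(3) False g(1,2)])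
        have "m' = m"
        proof (rule ccontr)
          assume ne: "m' \<noteq> m"
          have d: "p dvd a - b" if "a > b" "p dvd n + a - 2" "p dvd n + b - 2" for a b
          proof -
            have "a - b = (n + a - 2) - (n + b - 2)" using that(1) n by simp
            then show ?thesis using dvd_diff_nat[OF that(2,3)] by simp
          qed
          consider "m' > m" | "m > m'" using ne by linarith
          then show False
          proof cases
            case 1
            then show False using d[OF 1 m'(2) m(2)] m'(1) by (auto dest!: dvd_imp_le)
          next
            case 2
            then show False using d[OF 2 m(2) m'(2)] m(1) by (auto dest!: dvd_imp_le)
          qed
        qed
        then show ?thesis using m'(3,4) by simp
      qed
    next
      fix f assume "f \<in> (?s ^^ (p - 1 - m)) ` harmonic n m"
      then show "f \<in> K" unfolding K_def by (elim imageE) (simp only: mult_sigma_pow_harmonic[OF p n m])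
    qed
    moreover have "inj (?s ^^ (p - 1 - m))"
    proof (rule injI)
      fix c d :: "_ \<Rightarrow> 'a" assume e: "(?s ^^ (p - 1 - m)) c = (?s ^^ (p - 1 - m)) d"
      have "(?s ^^ (p - 1 - m)) (c + (\<lambda>e. (-1) * d e)) = 0"
        unfolding mult_sigma_pow_add mult_sigma_pow_scale e by (auto simp: fun_eq_iff)
      then have "c + (\<lambda>e. (-1) * d e) = 0" by (rule mult_sigma_pow_eq_0_imp[rotated]) (use n in simp)
      then show "c = d" by (auto simp: fun_eq_iff add_eq_0_iff2)
    qed
    ultimately show "card K = card (harmonic n m :: (_ \<Rightarrow> 'a) set)"
      by (simp add: card_image inj_on_subset[OF _ subset_UNIV])
  next
    assume no: "\<And>m. m < p - 1 \<Longrightarrow> \<not> p dvd n + m - 2"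
    have "f = 0" if f: "f \<in> K" for f
    proof (rule ccontr)
      assume f0: "f \<noteq> 0"
      obtain g where g: "f = ?s g" "g \<in> fspace (biexpo_pred n (p - 1))" "laplace n f = 0"
        using f unfolding K_def harmonic_def by auto
      show False by (rule harmonic_multiple_of_sigma[OF p n g(3) f0 g(1,2)]) (use no in simp)
    qed
    then have "K = {0}" using zK by auto
    then show "card K = 1" by simp
  }
qed

section \<open>The factorial-weighted pairing of arrays and the number of harmonic arrays\<close>

definition facts :: "nat \<Rightarrow> (nat \<Rightarrow> nat) \<times> (nat \<Rightarrow> nat) \<Rightarrow> 'a::comm_semiring_1" where
  "facts n e = (\<Prod>i<n. of_nat (fact (fst e i) * fact (snd e i)))"

lemma facts_inc2:
  assumes i: "i < n"
  shows "facts n (inc2 e i) = (of_nat ((fst e i + 1) * (snd e i + 1)) * facts n e :: 'a::comm_semiring_1)"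
proof -
  define g where "g = (\<lambda>j. of_nat (fact (fst e j) * fact (snd e j)) :: 'a)"
  define g' where "g' = (\<lambda>j. of_nat (fact (fst (inc2 e i) j) * fact (snd (inc2 e i) j)) :: 'a)"
  have g'i: "g' i = of_nat ((fst e i + 1) * (snd e i + 1)) * g i"
  proof -
    have "fact (Suc a) * fact (Suc b) = ((a + 1) * (b + 1)) * (fact a * fact b :: nat)" for a b
      unfolding fact_Suc of_nat_id by (simp only: Suc_eq_plus1 mult.assoc mult.left_commute mult.commute)
    then show ?thesis
      unfolding g_def g'_def inc2_def fst_conv snd_conv inc_apply if_P[OF refl] of_nat_mult[symmetric] by (rule arg_cong)
  qed
  have g'j: "g' j = g j" if "j \<in> {..<n} - {i}" for j
    using that unfolding g_def g'_def inc2_def by (simp add: inc_apply del: of_nat_fact of_nat_mult)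
  have "prod g' {..<n} = g' i * prod g' ({..<n} - {i})" by (rule prod.remove) (use i in auto)
  also have "prod g' ({..<n} - {i}) = prod g ({..<n} - {i})" by (rule prod.cong) (auto intro: g'j)
  also have "g' i * prod g ({..<n} - {i}) = of_nat ((fst e i + 1) * (snd e i + 1)) * (g i * prod g ({..<n} - {i}))"
    unfolding g'i by (simp only: mult.assoc)
  also have "g i * prod g ({..<n} - {i}) = prod g {..<n}" by (rule prod.remove[symmetric]) (use i in auto)
  finally show ?thesis unfolding facts_def g_def g'_def .
qed

lemma of_nat_fact_nonzero:
  assumes "prime p" "CHAR('a::field) = p" "k < p"
  shows "(of_nat (fact k) :: 'a) \<noteq> 0"
  using assms prime_dvd_fact_iff[of p k] of_nat_eq_0_iff_char_dvd[where 'a='a] by auto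

lemma facts_nonzero:
  assumes "prime p" "CHAR('a::field) = p" "k < p" "e \<in> biexpo n k"
  shows "(facts n e :: 'a) \<noteq> 0"
proof -
  have "fst e i < p" "snd e i < p" for i
    using assms(3,4) expo_le[of "fst e" n k i] expo_le[of "snd e" n k i] unfolding biexpo_def by auto
  then show ?thesis unfolding facts_def using of_nat_fact_nonzero[OF assms(1,2)] by (simp add: prod_zero_iff)
qed

lemma facts_nonzero_pred:
  assumes "prime p" "CHAR('a::field) = p" "k < p" "e \<in> biexpo_pred n k"
  shows "(facts n e :: 'a) \<noteq> 0"
proof (cases k)
  case (Suc j)
  then show ?thesis using facts_nonzero[OF assms(1,2), of j e n] assms(3,4) by simp
qed (use assms(4) in \<open>simp add: biexpo_pred_def expo_pred_def\<close>)

text \<open>Differentiation is adjoint to multiplication in the apolar pairing: raising both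
  exponents at \<open>i\<close> changes the weight by exactly the coefficient in
  \<open>laplace\<close>.\<close>

lemma laplace_adjoint:
  fixes c d :: "_ \<Rightarrow> 'a::comm_ring_1"
  shows "(\<Sum>e\<in>biexpo n k. facts n e * d e * mult_sigma n c e) = (\<Sum>e\<in>biexpo_pred n k. facts n e * c e * laplace n d e)"
proof -
  have "(\<Sum>e\<in>biexpo n k. facts n e * d e * mult_sigma n c e)
      = (\<Sum>e\<in>biexpo n k. \<Sum>i<n. if fst e i > 0 \<and> snd e i > 0 then facts n e * d e * c (dec2 e i) else 0)"
    unfolding mult_sigma_def sum_distrib_left by (intro sum.cong refl) auto
  also have "\<dots> = (\<Sum>e\<in>biexpo_pred n k. \<Sum>i<n. facts n (inc2 e i) * d (inc2 e i) * c e)"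
    by (rule sum_biexpo_reindex[where F="\<lambda>i e' e. facts n e * d e * c e'"])
  also have "\<dots> = (\<Sum>e\<in>biexpo_pred n k. facts n e * c e * laplace n d e)"
    unfolding laplace_def sum_distrib_left by (intro sum.cong refl) (simp add: facts_inc2 algebra_simps)
  finally show ?thesis .
qed

text \<open>The kernel of an operator is the annihilator of the image of its adjoint. The pairing is
  nondegenerate because \<open>k < p\<close> keeps all factorials invertible.\<close>

lemma laplace_eq_0_iff_orthogonal:
  fixes d :: "_ \<Rightarrow> 'a::field"
  assumes p: "prime p" "CHAR('a) = p" and k: "k < p" and d: "d \<in> fspace (biexpo n k)"
  shows "laplace n d = 0 \<longleftrightarrow>
    (\<forall>c\<in>fspace (biexpo_pred n k). (\<Sum>e\<in>biexpo n k. facts n e * d e * mult_sigma n c e) = 0)"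
proof
  assume "laplace n d = 0"
  then show "\<forall>c\<in>fspace (biexpo_pred n k). (\<Sum>e\<in>biexpo n k. facts n e * d e * mult_sigma n c e) = 0"
    unfolding laplace_adjoint by simp
next
  assume o: "\<forall>c\<in>fspace (biexpo_pred n k). (\<Sum>e\<in>biexpo n k. facts n e * d e * mult_sigma n c e) = 0"
  have "laplace n d e = 0" for e
  proof (cases "e \<in> biexpo_pred n k")
    case True
    let ?c = "\<lambda>e'. if e' = e then 1 else (0::'a)"
    have "?c \<in> fspace (biexpo_pred n k)" using True unfolding fspace_def by auto
    then have "(\<Sum>e'\<in>biexpo_pred n k. facts n e' * ?c e' * laplace n d e') = 0"
      using o unfolding laplace_adjoint by (rule bspec[rotated])
    moreover have "(\<Sum>e'\<in>biexpo_pred n k. facts n e' * ?c e' * laplace n d e') = (\<Sum>e'\<in>biexpo_pred n k. if e' = e then facts n e * laplace n d e else 0)"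
      by (intro sum.cong) auto
    ultimately have "facts n e * laplace n d e = 0" using True by simp
    then show ?thesis using facts_nonzero_pred[OF p k True] by simp
  next
    case False
    then show ?thesis using fspaceD[OF laplace_in[OF d]] by simp
  qed
  then show "laplace n d = 0" by (auto simp: fun_eq_iff)
qed

lemma lin_subspace_mult_sigma_image: "lin_subspace (mult_sigma n ` (fspace E :: (_ \<Rightarrow> 'a::field) set))"
  unfolding lin_subspace_def
proof (intro conjI ballI allI)
  show "0 \<in> mult_sigma n ` (fspace E :: (_ \<Rightarrow> 'a) set)"
    by (intro image_eqI[where x=0] mult_sigma_zero[symmetric] lin_subspaceD(1)[OF lin_subspace_fspace])
  fix x y assume "x \<in> mult_sigma n ` (fspace E :: (_ \<Rightarrow> 'a) set)" "y \<in> mult_sigma n ` (fspace E :: (_ \<Rightarrow> 'a) set)"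
  then obtain c d where cd: "x = mult_sigma n c" "y = mult_sigma n d" "c \<in> fspace E" "d \<in> fspace E" by auto
  then have "x + y = mult_sigma n (c + d)" by (simp add: mult_sigma_add)
  then show "x + y \<in> mult_sigma n ` (fspace E :: (_ \<Rightarrow> 'a) set)"
    using lin_subspaceD(2)[OF lin_subspace_fspace cd(3,4)] by simp
next
  fix a x assume "x \<in> mult_sigma n ` (fspace E :: (_ \<Rightarrow> 'a) set)"
  then obtain c where c: "x = mult_sigma n c" "c \<in> fspace E" by auto
  then have "(\<lambda>i. a * x i) = mult_sigma n (\<lambda>e. a * c e)" by (simp add: mult_sigma_scale)
  then show "(\<lambda>i. a * x i) \<in> mult_sigma n ` (fspace E :: (_ \<Rightarrow> 'a) set)"
    using lin_subspaceD(3)[OF lin_subspace_fspace c(2)] by simp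
qed

text \<open>Absorbing the weights into the arrays carries annihilators for the weighted pairing to
  the unweighted \<open>perp_in\<close>, to which the counting lemma applies.\<close>

lemma bij_betw_facts_scaling:
  fixes S T :: "(_ \<Rightarrow> 'a::field) set"
  assumes p: "prime p" "CHAR('a) = p" and k: "k < p"
    and S: "S \<subseteq> fspace (biexpo n k)" "T \<subseteq> fspace (biexpo n k)"
    and iff: "\<And>d. d \<in> fspace (biexpo n k) \<Longrightarrow> d \<in> S \<longleftrightarrow> (\<lambda>e. facts n e * d e) \<in> T"
  shows "bij_betw (\<lambda>d e. facts n e * d e) S T"
proof (rule bij_betwI[where g="\<lambda>d e. d e / facts n e"])
  have inv1: "(\<lambda>e. facts n e * d e / facts n e) = d" if "d \<in> fspace (biexpo n k)" for d :: "_ \<Rightarrow> 'a"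
  proof
    fix e show "facts n e * d e / facts n e = d e"
      using facts_nonzero[OF p k, of e n] fspaceD[OF that, of e] by (cases "e \<in> biexpo n k") auto
  qed
  have inv2: "(\<lambda>e. facts n e * (d e / facts n e)) = d" if "d \<in> fspace (biexpo n k)" for d :: "_ \<Rightarrow> 'a"
  proof
    fix e show "facts n e * (d e / facts n e) = d e"
      using facts_nonzero[OF p k, of e n] fspaceD[OF that, of e] by (cases "e \<in> biexpo n k") auto
  qed
  have in2: "(\<lambda>e. d e / facts n e) \<in> fspace (biexpo n k)" if "d \<in> fspace (biexpo n k)" for d :: "_ \<Rightarrow> 'a"
    using that unfolding fspace_def by auto
  show "(\<lambda>d e. facts n e * d e) \<in> S \<rightarrow> T" using iff S(1) by auto
  show "(\<lambda>d e. d e / facts n e) \<in> T \<rightarrow> S"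
  proof
    fix d assume d: "d \<in> T"
    then have d': "d \<in> fspace (biexpo n k)" using S(2) by auto
    show "(\<lambda>e. d e / facts n e) \<in> S" using iff[OF in2[OF d']] inv2[OF d'] d by simp
  qed
  show "(\<lambda>e. facts n e * d e / facts n e) = d" if "d \<in> S" for d using inv1 S(1) that by auto
  show "(\<lambda>e. facts n e * (d e / facts n e)) = d" if "d \<in> T" for d using inv2 S(2) that by auto
qed

text \<open>Harmonic arrays form the annihilator of the injective image of multiplication by
  \<open>\<sigma>\<close>. The count is valid even though in positive characteristic the two spaces
  may intersect.\<close>

lemma card_harmonic:
  assumes p: "prime p" "CHAR('a::{field,finite}) = p" and n: "n \<ge> 1" and k: "k < p"
  shows "CARD('a) ^ card (biexpo_pred n k) * card (harmonic n k :: (_ \<Rightarrow> 'a) set) = CARD('a) ^ card (biexpo n k)"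
proof -
  let ?N = "mult_sigma n ` (fspace (biexpo_pred n k) :: (_ \<Rightarrow> 'a) set)"
  have "bij_betw (\<lambda>d e. facts n e * d e) (harmonic n k :: (_ \<Rightarrow> 'a) set) (perp_in (biexpo n k) ?N)"
  proof (rule bij_betw_facts_scaling[OF p k])
    show "harmonic n k \<subseteq> (fspace (biexpo n k) :: (_ \<Rightarrow> 'a) set)" "perp_in (biexpo n k) ?N \<subseteq> fspace (biexpo n k)"
      unfolding harmonic_def perp_in_def by auto
    fix d :: "_ \<Rightarrow> 'a" assume d: "d \<in> fspace (biexpo n k)"
    then have "(\<lambda>e. facts n e * d e) \<in> fspace (biexpo n k)" unfolding fspace_def by auto
    then show "d \<in> harmonic n k \<longleftrightarrow> (\<lambda>e. facts n e * d e) \<in> perp_in (biexpo n k) ?N"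
      using laplace_eq_0_iff_orthogonal[OF p k d] d unfolding harmonic_def perp_in_def by auto
  qed
  then have "card (harmonic n k :: (_ \<Rightarrow> 'a) set) = card (perp_in (biexpo n k) ?N)" by (rule bij_betw_same_card)
  moreover have "?N \<subseteq> fspace (biexpo n k)" using mult_sigma_in by auto
  then have "card ?N * card (perp_in (biexpo n k) ?N) = CARD('a) ^ card (biexpo n k)"
    by (intro card_perp_in lin_subspace_mult_sigma_image) auto
  ultimately show ?thesis using card_mult_sigma_image[OF n, where 'a='a] by simp
qed

section \<open>Powers of linear forms and reproducing arrays\<close>

lemma multinomial_expansion:
  fixes u :: "nat \<Rightarrow> 'a::field"
  assumes "(of_nat (fact k) :: 'a) \<noteq> 0"
  shows "(\<Sum>i<n. u i) ^ k = of_nat (fact k) * (\<Sum>\<alpha>\<in>expo n k. \<Prod>i<n. u i ^ \<alpha> i / of_nat (fact (\<alpha> i)))"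
  using assms
proof (induction k)
  case 0
  have "expo n 0 = {\<lambda>_. 0}"
  proof (intro subset_antisym subsetI)
    fix \<alpha> assume "\<alpha> \<in> expo n 0"
    then have "\<alpha> i = 0" for i using expo_le[of \<alpha> n 0 i] by simp
    then show "\<alpha> \<in> {\<lambda>_. 0}" by auto
  qed (simp add: expo_def)
  then show ?case by simp
next
  case (Suc k)
  define w where "w = (\<lambda>\<alpha>. \<Prod>i<n. u i ^ \<alpha> i / of_nat (fact (\<alpha> i)))"
  have nz: "(of_nat (fact k) :: 'a) \<noteq> 0"
    using Suc.prems unfolding fact_Suc of_nat_id of_nat_mult by simp
  have nzj: "(of_nat (Suc j) :: 'a) \<noteq> 0" if "j \<le> k" for j
  proof
    assume z: "(of_nat (Suc j) :: 'a) = 0"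
    have "Suc j dvd (fact (Suc k) :: nat)" by (rule dvd_fact) (use that in simp_all)
    then obtain l where l: "(fact (Suc k) :: nat) = Suc j * l" by (elim dvdE)
    have "(of_nat (fact (Suc k)) :: 'a) = 0" unfolding l of_nat_mult z by simp
    then show False using Suc.prems by contradiction
  qed
  have winc: "of_nat (Suc (\<alpha> i)) * w (inc \<alpha> i) = u i * w \<alpha>" if i: "i < n" and \<alpha>: "\<alpha> \<in> expo n k" for \<alpha> i
  proof -
    define g where "g = (\<lambda>\<alpha> j. u j ^ \<alpha> j / of_nat (fact (\<alpha> j)))"
    have gj: "g (inc \<alpha> i) j = g \<alpha> j" if "j \<in> {..<n} - {i}" for j
      using that unfolding g_def by (simp add: inc_apply)
    have gi: "of_nat (Suc (\<alpha> i)) * g (inc \<alpha> i) i = u i * g \<alpha> i"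
      using nzj[OF expo_le[OF \<alpha>], of i] unfolding g_def inc_apply if_P[OF refl] fact_Suc of_nat_mult of_nat_id power_Suc
      by (simp add: divide_simps del: of_nat_Suc)
    have "w (inc \<alpha> i) = g (inc \<alpha> i) i * prod (g (inc \<alpha> i)) ({..<n} - {i})"
      unfolding w_def g_def by (rule prod.remove) (use i in auto)
    also have "prod (g (inc \<alpha> i)) ({..<n} - {i}) = prod (g \<alpha>) ({..<n} - {i})"
      by (rule prod.cong[OF refl gj])
    finally have "of_nat (Suc (\<alpha> i)) * w (inc \<alpha> i)
        = (of_nat (Suc (\<alpha> i)) * g (inc \<alpha> i) i) * prod (g \<alpha>) ({..<n} - {i})"
      by (simp only: mult.assoc)
    then have "of_nat (Suc (\<alpha> i)) * w (inc \<alpha> i) = u i * (g \<alpha> i * prod (g \<alpha>) ({..<n} - {i}))"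
      unfolding gi by (simp only: mult.assoc)
    also have "g \<alpha> i * prod (g \<alpha>) ({..<n} - {i}) = w \<alpha>"
      unfolding w_def g_def by (rule prod.remove[symmetric]) (use i in auto)
    finally show ?thesis .
  qed
  \<comment> \<open>The factor \<open>k + 1\<close> is the sum of the exponents, and each
    \<open>\<alpha> i\<close> cancels one factor of a factorial, leaving \<open>u i\<close> times a
    term of degree \<open>k\<close>. This is the Euler relation, and no multinomial coefficients are
    needed.\<close>
  have "of_nat (Suc k) * (\<Sum>\<alpha>\<in>expo n (Suc k). w \<alpha>) = (\<Sum>\<alpha>\<in>expo n (Suc k). \<Sum>i<n. of_nat (\<alpha> i) * w \<alpha>)"
    unfolding sum_distrib_left
  proof (intro sum.cong refl)
    fix \<alpha> assume "\<alpha> \<in> expo n (Suc k)"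
    then have "of_nat (Suc k) = (of_nat (\<Sum>i<n. \<alpha> i) :: 'a)" unfolding expo_def by simp
    then show "of_nat (Suc k) * w \<alpha> = (\<Sum>i<n. of_nat (\<alpha> i) * w \<alpha>)" by (simp add: sum_distrib_right)
  qed
  also have "\<dots> = (\<Sum>\<alpha>\<in>expo n (Suc k). \<Sum>i<n. if \<alpha> i > 0 then of_nat (Suc (dec \<alpha> i i)) * w \<alpha> else 0)"
    by (intro sum.cong refl) (simp add: dec_apply del: of_nat_Suc)
  also have "\<dots> = (\<Sum>\<alpha>\<in>expo_pred n (Suc k). \<Sum>i<n. of_nat (Suc (\<alpha> i)) * w (inc \<alpha> i))"
    by (rule sum_expo_reindex[where F="\<lambda>i \<alpha>' \<alpha>. of_nat (Suc (\<alpha>' i)) * w \<alpha>"])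
  also have "\<dots> = (\<Sum>\<alpha>\<in>expo n k. \<Sum>i<n. u i * w \<alpha>)"
    unfolding expo_pred_Suc by (intro sum.cong refl winc) auto
  also have "\<dots> = (\<Sum>i<n. u i) * (\<Sum>\<alpha>\<in>expo n k. w \<alpha>)"
    by (simp add: sum_distrib_left sum_distrib_right)
  finally have e: "of_nat (Suc k) * (\<Sum>\<alpha>\<in>expo n (Suc k). w \<alpha>) = (\<Sum>i<n. u i) * (\<Sum>\<alpha>\<in>expo n k. w \<alpha>)" .
  have "(\<Sum>i<n. u i) ^ Suc k = (\<Sum>i<n. u i) * (of_nat (fact k) * (\<Sum>\<alpha>\<in>expo n k. w \<alpha>))"
    using Suc.IH[OF nz] unfolding w_def by simp
  also have "\<dots> = of_nat (fact k) * (of_nat (Suc k) * (\<Sum>\<alpha>\<in>expo n (Suc k). w \<alpha>))"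
    unfolding e by simp
  finally show ?case unfolding w_def by (simp add: algebra_simps)
qed

text \<open>The array of \<open>(x \<cdot> b)\<^sup>k (z \<cdot> a)\<^sup>k\<close> as a polynomial in \<open>(x, z)\<close>.\<close>

definition kernel_array :: "nat \<Rightarrow> nat \<Rightarrow> (nat \<Rightarrow> 'a) \<Rightarrow> (nat \<Rightarrow> 'a) \<Rightarrow> (nat \<Rightarrow> nat) \<times> (nat \<Rightarrow> nat) \<Rightarrow> 'a::field" where
  "kernel_array n k a b = (\<lambda>e. if e \<in> biexpo n k
     then of_nat (fact k) ^ 2 * (power_prod n b (fst e) * power_prod n a (snd e)) / facts n e else 0)"

lemma beval_kernel_array:
  fixes x :: "nat \<Rightarrow> 'a::field"
  assumes "(of_nat (fact k) :: 'a) \<noteq> 0"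
  shows "beval n (biexpo n k) (kernel_array n k a b) x z = ((\<Sum>i<n. x i * b i) * (\<Sum>i<n. z i * a i)) ^ k"
proof -
  define u where "u = (\<lambda>x b \<alpha>. \<Prod>i<n. (x i * b i :: 'a) ^ \<alpha> i / of_nat (fact (\<alpha> i)))"
  have "beval n (biexpo n k) (kernel_array n k a b) x z = (\<Sum>e\<in>biexpo n k. of_nat (fact k) ^ 2 * (u x b (fst e) * u z a (snd e)))"
    unfolding bieval_def kernel_array_def u_def power_prod_def facts_def
    by (intro sum.cong refl) (simp add: prod.distrib prod_dividef power_mult_distrib algebra_simps)
  also have "\<dots> = of_nat (fact k) ^ 2 * ((\<Sum>\<alpha>\<in>expo n k. u x b \<alpha>) * (\<Sum>\<alpha>\<in>expo n k. u z a \<alpha>))"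
    unfolding biexpo_def sum_product unfolding sum.cartesian_product case_prod_beta sum_distrib_left ..
  also have "\<dots> = (of_nat (fact k) * (\<Sum>\<alpha>\<in>expo n k. u x b \<alpha>)) * (of_nat (fact k) * (\<Sum>\<alpha>\<in>expo n k. u z a \<alpha>))"
    by (simp add: power2_eq_square algebra_simps)
  also have "\<dots> = (\<Sum>i<n. x i * b i) ^ k * (\<Sum>i<n. z i * a i) ^ k"
    unfolding u_def multinomial_expansion[OF assms] by simp
  finally show ?thesis by (simp add: power_mult_distrib)
qed

text \<open>The weights cancel the denominators of the kernel array, so pairing with it is
  evaluation, up to a nonzero scalar when \<open>k < p\<close>. The arguments \<open>a\<close> and
  \<open>b\<close> appear in exchanged order.\<close>

lemma kernel_array_reproducing:
  fixes c :: "_ \<Rightarrow> 'a::field"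
  assumes p: "prime p" "CHAR('a) = p" and k: "k < p"
  shows "(\<Sum>e\<in>biexpo n k. facts n e * kernel_array n k a b e * c e) = of_nat (fact k) ^ 2 * beval n (biexpo n k) c b a"
  unfolding bieval_def sum_distrib_left
proof (intro sum.cong refl)
  fix e assume "e \<in> biexpo n k"
  then show "facts n e * kernel_array n k a b e * c e = of_nat (fact k) ^ 2 * (c e * (power_prod n b (fst e) * power_prod n a (snd e)))"
    using facts_nonzero[OF p k, of e n] unfolding kernel_array_def by (simp add: field_simps)
qed

lemma kernel_array_in: "kernel_array n k a b \<in> fspace (biexpo n k)"
  unfolding kernel_array_def fspace_def by auto

section \<open>Multivariate polynomials\<close>

type_synonym 'a mpol = "(nat \<Rightarrow>\<^sub>0 nat) \<Rightarrow>\<^sub>0 'a"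

abbreviation "lookup \<equiv> Poly_Mapping.lookup"
abbreviation "keys \<equiv> Poly_Mapping.keys"

definition mvar :: "nat \<Rightarrow> 'a::comm_ring_1 mpol" where
  "mvar i = Poly_Mapping.single (Poly_Mapping.single i 1) 1"

definition mconst :: "'a::comm_ring_1 \<Rightarrow> 'a mpol" where
  "mconst c = Poly_Mapping.single 0 c"

definition mon_eval :: "(nat \<Rightarrow> 'r::comm_ring_1) \<Rightarrow> (nat \<Rightarrow>\<^sub>0 nat) \<Rightarrow> 'r" where
  "mon_eval x m = (\<Prod>i\<in>keys m. x i ^ lookup m i)"

text \<open>Substitution may enlarge the coefficient ring through \<open>\<iota>\<close>: it serves
  for evaluation, for changes of variables and for passing to polynomials in an auxiliary
  variable.\<close>

definition subst_mpol :: "('a \<Rightarrow> 'r::comm_ring_1) \<Rightarrow> (nat \<Rightarrow> 'r) \<Rightarrow> 'a::comm_ring_1 mpol \<Rightarrow> 'r" where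
  "subst_mpol \<iota> x f = (\<Sum>m\<in>keys f. \<iota> (lookup f m) * mon_eval x m)"

lemma mpol_sum_single: "f = (\<Sum>m\<in>keys f. Poly_Mapping.single m (lookup f m))"
proof (rule poly_mapping_eqI)
  fix k
  have "lookup (\<Sum>m\<in>keys f. Poly_Mapping.single m (lookup f m)) k = (\<Sum>m\<in>keys f. if m = k then lookup f k else 0)"
    unfolding lookup_sum by (intro sum.cong refl) (auto simp: lookup_single when_def)
  also have "\<dots> = lookup f k" by (auto simp: in_keys_iff)
  finally show "lookup f k = lookup (\<Sum>m\<in>keys f. Poly_Mapping.single m (lookup f m)) k" ..
qed

lemma mon_eval_superset:
  assumes "finite A" "keys m \<subseteq> A"
  shows "mon_eval x m = (\<Prod>i\<in>A. x i ^ lookup m i)"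
  unfolding mon_eval_def by (rule prod.mono_neutral_left) (use assms in \<open>auto simp: in_keys_iff\<close>)

lemma mon_eval_add: "mon_eval x (m + m') = mon_eval x m * mon_eval x m'"
proof -
  let ?A = "keys m \<union> keys m'"
  have "mon_eval x (m + m') = (\<Prod>i\<in>?A. x i ^ lookup (m + m') i)"
    by (rule mon_eval_superset) (use keys_add[of m m'] in auto)
  also have "\<dots> = (\<Prod>i\<in>?A. x i ^ lookup m i) * (\<Prod>i\<in>?A. x i ^ lookup m' i)"
    by (simp add: lookup_add power_add prod.distrib)
  also have "\<dots> = mon_eval x m * mon_eval x m'"
    by (subst (1 2) mon_eval_superset[of ?A]) auto
  finally show ?thesis .
qed

lemma mon_eval_zero [simp]: "mon_eval x 0 = 1"
  unfolding mon_eval_def by simp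

locale coeff_hom =
  fixes \<iota> :: "'a::comm_ring_1 \<Rightarrow> 'r::comm_ring_1"
  assumes hom_zero: "\<iota> 0 = 0" and hom_one: "\<iota> 1 = 1"
    and hom_add: "\<iota> (a + b) = \<iota> a + \<iota> b" and hom_mult: "\<iota> (a * b) = \<iota> a * \<iota> b"
begin

lemma subst_add: "subst_mpol \<iota> x (f + g) = subst_mpol \<iota> x f + subst_mpol \<iota> x g"
  unfolding subst_mpol_def
  by (rule setsum_keys_plus_distrib[where f="\<lambda>m c. \<iota> c * mon_eval x m"])
     (simp_all add: hom_zero hom_add distrib_right)

lemma subst_zero: "subst_mpol \<iota> x 0 = 0"
  unfolding subst_mpol_def by simp

lemma subst_sum: "subst_mpol \<iota> x (sum f A) = (\<Sum>i\<in>A. subst_mpol \<iota> x (f i))"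
  by (induction A rule: infinite_finite_induct) (simp_all add: subst_add subst_zero)

lemma subst_single: "subst_mpol \<iota> x (Poly_Mapping.single m c) = \<iota> c * mon_eval x m"
  unfolding subst_mpol_def by (auto simp: hom_zero)

lemma subst_mult: "subst_mpol \<iota> x (f * g) = subst_mpol \<iota> x f * subst_mpol \<iota> x g"
proof -
  have "f * g = (\<Sum>m\<in>keys f. \<Sum>m'\<in>keys g. Poly_Mapping.single (m + m') (lookup f m * lookup g m'))"
    by (subst mpol_sum_single[of f], subst mpol_sum_single[of g]) (simp add: sum_product mult_single)
  then have "subst_mpol \<iota> x (f * g) = (\<Sum>m\<in>keys f. \<Sum>m'\<in>keys g. \<iota> (lookup f m * lookup g m') * mon_eval x (m + m'))"
    by (simp only: subst_sum subst_single)
  also have "\<dots> = subst_mpol \<iota> x f * subst_mpol \<iota> x g"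
    unfolding subst_mpol_def sum_product by (intro sum.cong refl) (simp add: hom_mult mon_eval_add mult_ac)
  finally show ?thesis .
qed

lemma subst_const: "subst_mpol \<iota> x (mconst c) = \<iota> c"
  unfolding mconst_def by (simp add: subst_single)

lemma subst_one: "subst_mpol \<iota> x 1 = 1"
  using subst_const[of x 1] by (simp add: mconst_def hom_one)

lemma subst_var: "subst_mpol \<iota> x (mvar i) = x i"
  unfolding mvar_def subst_single by (simp add: mon_eval_def hom_one)

lemma subst_uminus: "subst_mpol \<iota> x (- f) = - subst_mpol \<iota> x f"
  using subst_add[of x f "- f"] by (simp add: subst_zero eq_neg_iff_add_eq_0 add.commute)

lemma subst_diff: "subst_mpol \<iota> x (f - g) = subst_mpol \<iota> x f - subst_mpol \<iota> x g"
  using subst_add[of x f "- g"] subst_uminus[of x g] by simp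

lemma subst_power: "subst_mpol \<iota> x (f ^ k) = subst_mpol \<iota> x f ^ k"
  by (induction k) (simp_all add: subst_mult subst_one)

lemma subst_prod: "subst_mpol \<iota> x (prod f A) = (\<Prod>i\<in>A. subst_mpol \<iota> x (f i))"
  by (induction A rule: infinite_finite_induct) (simp_all add: subst_mult subst_one)

lemma subst_mono: "subst_mpol \<iota> x (power_prod n \<xi> \<alpha>) = power_prod n (\<lambda>i. subst_mpol \<iota> x (\<xi> i)) \<alpha>"
  unfolding power_prod_def by (simp add: subst_prod subst_power)

lemma subst_bieval:
  "subst_mpol \<iota> x (bieval mconst n E c \<xi> \<zeta>) = bieval \<iota> n E c (\<lambda>i. subst_mpol \<iota> x (\<xi> i)) (\<lambda>i. subst_mpol \<iota> x (\<zeta> i))"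
  unfolding bieval_def by (simp add: subst_sum subst_mult subst_const subst_mono)

end

lemma coeff_hom_id: "coeff_hom (\<lambda>a. a)" by unfold_locales auto
lemma coeff_hom_mconst: "coeff_hom mconst"
  by unfold_locales (auto simp: mconst_def single_add mult_single)
lemma coeff_hom_pCons_mconst: "coeff_hom (\<lambda>a. [:mconst a:])"
  by unfold_locales (auto simp: mconst_def single_add mult_single one_pCons mult.commute)

lemma CHAR_mpol:
  assumes "CHAR('a::comm_ring_1) = p"
  shows "CHAR('a mpol) = p"
proof (rule CHAR_eqI)
  show "of_nat p = (0 :: 'a mpol)"
    using of_nat_CHAR[where 'a='a] assms by (simp flip: single_of_nat)
  fix k assume "of_nat k = (0 :: 'a mpol)"
  then have "lookup (of_nat k :: 'a mpol) 0 = 0" by simp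
  then have "(of_nat k :: 'a) = 0" by (simp add: lookup_of_nat)
  then show "p dvd k" using assms by (simp only: of_nat_eq_0_iff_char_dvd)
qed

lemma lookup_mconst_mult: "lookup (mconst c * f) m = c * lookup f m"
proof -
  have "mconst c * f = (\<Sum>m\<in>keys f. Poly_Mapping.single m (c * lookup f m))"
    by (subst mpol_sum_single[of f]) (simp add: sum_distrib_left mconst_def mult_single)
  then have "lookup (mconst c * f) m = (\<Sum>m'\<in>keys f. if m' = m then c * lookup f m else 0)"
    by (simp only: lookup_sum) (auto intro!: sum.cong simp: lookup_single when_def)
  then show ?thesis by (auto simp: in_keys_iff)
qed

subsection \<open>Weighted degrees\<close>

definition weight :: "(nat \<Rightarrow> int) \<Rightarrow> (nat \<Rightarrow>\<^sub>0 nat) \<Rightarrow> int" where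
  "weight w m = (\<Sum>i\<in>keys m. w i * int (lookup m i))"

lemma weight_superset:
  assumes "finite A" "keys m \<subseteq> A"
  shows "weight w m = (\<Sum>i\<in>A. w i * int (lookup m i))"
  unfolding weight_def by (rule sum.mono_neutral_left) (use assms in \<open>auto simp: in_keys_iff\<close>)

lemma weight_add: "weight w (m + m') = weight w m + weight w m'"
proof -
  let ?A = "keys m \<union> keys m'"
  have "weight w (m + m') = (\<Sum>i\<in>?A. w i * int (lookup (m + m') i))"
    by (rule weight_superset) (use keys_add[of m m'] in auto)
  also have "\<dots> = (\<Sum>i\<in>?A. w i * int (lookup m i)) + (\<Sum>i\<in>?A. w i * int (lookup m' i))"
    by (simp add: lookup_add algebra_simps sum.distrib)
  also have "\<dots> = weight w m + weight w m'"
    by (subst (1 2) weight_superset[of ?A]) auto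
  finally show ?thesis .
qed

lemma weight_indicator: "weight (\<lambda>i. if i = j then 1 else 0) m = int (lookup m j)"
proof -
  have "weight (\<lambda>i. if i = j then 1 else 0) m = (\<Sum>i\<in>insert j (keys m). (if i = j then 1 else 0) * int (lookup m i))"
    by (rule weight_superset) auto
  then show ?thesis by (simp add: if_distrib[of "\<lambda>x. x * _"] cong: if_cong)
qed

text \<open>Weights may be negative. Bounds for a weight and for its negative together pin down the
  weight of every monomial; the zero polynomial satisfies every bound.\<close>

definition weight_le :: "(nat \<Rightarrow> int) \<Rightarrow> int \<Rightarrow> 'a::comm_ring_1 mpol \<Rightarrow> bool" where
  "weight_le w d f \<longleftrightarrow> (\<forall>m\<in>keys f. weight w m \<le> d)"

lemma weight_le_mono: "weight_le w d f \<Longrightarrow> d \<le> d' \<Longrightarrow> weight_le w d' f"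
  unfolding weight_le_def by fastforce

lemma weight_le_zero: "weight_le w d 0"
  unfolding weight_le_def by simp

lemma weight_le_add: "weight_le w d f \<Longrightarrow> weight_le w d g \<Longrightarrow> weight_le w d (f + g)"
  unfolding weight_le_def using keys_add[of f g] by blast

lemma weight_le_sum: "(\<And>i. i \<in> A \<Longrightarrow> weight_le w d (f i)) \<Longrightarrow> weight_le w d (sum f A)"
  by (induction A rule: infinite_finite_induct) (simp_all add: weight_le_zero weight_le_add)

lemma weight_le_uminus: "weight_le w d f \<Longrightarrow> weight_le w d (- f)"
  unfolding weight_le_def by (simp add: in_keys_iff)

lemma weight_le_mult: "weight_le w d f \<Longrightarrow> weight_le w e g \<Longrightarrow> weight_le w (d + e) (f * g)"
  unfolding weight_le_def
proof
  fix m assume f: "\<forall>m\<in>keys f. weight w m \<le> d" and g: "\<forall>m\<in>keys g. weight w m \<le> e" and m: "m \<in> keys (f * g)"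
  obtain a b where "m = a + b" "a \<in> keys f" "b \<in> keys g" using keys_mult[of f g] m by blast
  then show "weight w m \<le> d + e" using f g weight_add[of w a b] by fastforce
qed

lemma weight_le_const: "weight_le w 0 (mconst c)"
  unfolding weight_le_def mconst_def weight_def by auto

lemma weight_le_one: "weight_le w 0 1"
  unfolding weight_le_def weight_def by auto

lemma weight_le_power: "weight_le w d f \<Longrightarrow> weight_le w (int k * d) (f ^ k)"
proof (induction k)
  case (Suc k)
  then show ?case using weight_le_mult[of w d f "int k * d" "f ^ k"] by (simp add: algebra_simps)
qed (simp add: weight_le_one)

lemma weight_le_prod: "(\<And>i. i \<in> A \<Longrightarrow> weight_le w (d i) (f i)) \<Longrightarrow> weight_le w (\<Sum>i\<in>A. d i) (prod f A)"
  by (induction A rule: infinite_finite_induct) (simp_all add: weight_le_one weight_le_mult)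

lemma weight_le_var: "weight_le w (w i) (mvar i)"
  unfolding weight_le_def mvar_def weight_def by auto

lemma weight_le_mono_fun:
  assumes "\<And>i. i < n \<Longrightarrow> weight_le w (a i) (\<xi> i)"
  shows "weight_le w (\<Sum>i<n. int (\<alpha> i) * a i) (power_prod n \<xi> \<alpha>)"
  unfolding power_prod_def by (intro weight_le_prod weight_le_power assms) simp

lemma weight_le_bieval:
  assumes \<xi>: "\<And>i. i < n \<Longrightarrow> weight_le w (a i) (\<xi> i)" and \<zeta>: "\<And>i. i < n \<Longrightarrow> weight_le w (b i) (\<zeta> i)"
    and d: "\<And>e. e \<in> E \<Longrightarrow> c e \<noteq> 0 \<Longrightarrow> (\<Sum>i<n. int (fst e i) * a i) + (\<Sum>i<n. int (snd e i) * b i) \<le> d"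
  shows "weight_le w d (bieval mconst n E c \<xi> \<zeta>)"
  unfolding bieval_def
proof (rule weight_le_sum)
  fix e assume e: "e \<in> E"
  show "weight_le w d (mconst (c e) * (power_prod n \<xi> (fst e) * power_prod n \<zeta> (snd e)))"
  proof (cases "c e = 0")
    case True
    then show ?thesis by (simp add: mconst_def weight_le_zero)
  next
    case False
    have "weight_le w (0 + ((\<Sum>i<n. int (fst e i) * a i) + (\<Sum>i<n. int (snd e i) * b i)))
        (mconst (c e) * (power_prod n \<xi> (fst e) * power_prod n \<zeta> (snd e)))"
      by (intro weight_le_mult weight_le_const weight_le_mono_fun \<xi> \<zeta>)
    then show ?thesis by (rule weight_le_mono) (use d[OF e False] in simp)
  qed
qed

subsection \<open>The ideal generated by the \<open>p\<close>-th powers of the variables\<close>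

text \<open>The ideal is monomial and is described through its monomials, so membership passes to
  any part of a polynomial obtained by selecting monomials.\<close>

definition frob_ideal :: "nat \<Rightarrow> 'a::comm_ring_1 mpol set" where
  "frob_ideal p = {f. \<forall>m\<in>keys f. \<exists>i. p \<le> lookup m i}"

lemma frob_ideal_zero: "0 \<in> frob_ideal p"
  unfolding frob_ideal_def by simp

lemma frob_ideal_add: "f \<in> frob_ideal p \<Longrightarrow> g \<in> frob_ideal p \<Longrightarrow> f + g \<in> frob_ideal p"
  unfolding frob_ideal_def using keys_add[of f g] by blast

lemma frob_ideal_sum: "(\<And>i. i \<in> A \<Longrightarrow> f i \<in> frob_ideal p) \<Longrightarrow> sum f A \<in> frob_ideal p"
  by (induction A rule: infinite_finite_induct) (simp_all add: frob_ideal_zero frob_ideal_add)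

lemma frob_ideal_mult: "f \<in> frob_ideal p \<Longrightarrow> f * g \<in> frob_ideal p"
  unfolding frob_ideal_def
proof (intro CollectI ballI)
  fix m assume f: "f \<in> {f. \<forall>m\<in>keys f. \<exists>i. p \<le> lookup m i}" and m: "m \<in> keys (f * g)"
  obtain a b where ab: "m = a + b" "a \<in> keys f" using keys_mult[of f g] m by blast
  then obtain i where "p \<le> lookup a i" using f by auto
  then have "p \<le> lookup m i" unfolding ab(1) by (simp add: lookup_add)
  then show "\<exists>i. p \<le> lookup m i" ..
qed

lemma frob_ideal_var_power: "mvar i ^ p \<in> frob_ideal p"
proof -
  have "mvar i ^ k = (Poly_Mapping.single (Poly_Mapping.single i k) 1 :: 'a mpol)" for k
    by (induction k) (simp_all add: mvar_def mult_single single_add[symmetric])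
  then show ?thesis unfolding frob_ideal_def by (auto intro!: exI[of _ i])
qed

lemma frob_ideal_uminus: "f \<in> frob_ideal p \<Longrightarrow> - f \<in> frob_ideal p"
  using frob_ideal_mult[of f p "- 1"] by simp

lemma subst_frob_ideal:
  assumes f: "f \<in> frob_ideal p" and x: "\<And>i. x i ^ p \<in> frob_ideal p"
  shows "subst_mpol mconst x f \<in> frob_ideal p"
  unfolding subst_mpol_def
proof (rule frob_ideal_sum)
  fix m assume m: "m \<in> keys f"
  then obtain i where i: "p \<le> lookup m i" using f unfolding frob_ideal_def by auto
  show "mconst (lookup f m) * mon_eval x m \<in> frob_ideal p"
  proof (cases "i \<in> keys m")
    case True
    have "mon_eval x m = x i ^ lookup m i * (\<Prod>j\<in>keys m - {i}. x j ^ lookup m j)"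
      unfolding mon_eval_def by (rule prod.remove) (use True in auto)
    also have "x i ^ lookup m i = x i ^ p * x i ^ (lookup m i - p)" using i by (simp flip: power_add)
    finally have "mconst (lookup f m) * mon_eval x m
        = x i ^ p * (x i ^ (lookup m i - p) * (\<Prod>j\<in>keys m - {i}. x j ^ lookup m j) * mconst (lookup f m))"
      by (simp add: mult_ac)
    then show ?thesis using frob_ideal_mult[OF x[of i]] by simp
  next
    case False
    then have "p = 0" using i by (simp add: in_keys_iff)
    then show ?thesis unfolding frob_ideal_def by simp
  qed
qed

text \<open>Compare the coefficients of \<open>M + \<nu>\<close>, where \<open>M\<close> is a monomial of minimal degree occurring in
  one of the \<open>\<Psi>\<^sub>i\<close> and \<open>\<nu>\<close> has all exponents less than \<open>p\<close>.\<close>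

lemma independent_over_frobenius_subring:
  fixes f \<Psi> :: "'i \<Rightarrow> 'a::field mpol"
  assumes I: "finite I"
    and ind: "\<And>a. (\<Sum>i\<in>I. mconst (a i) * f i) \<in> frob_ideal p \<Longrightarrow> \<forall>i\<in>I. a i = 0"
    and \<Psi>: "\<And>i m j. i \<in> I \<Longrightarrow> m \<in> keys (\<Psi> i) \<Longrightarrow> p dvd lookup m j"
    and sum0: "(\<Sum>i\<in>I. f i * \<Psi> i) = 0" and i: "i \<in> I"
  shows "\<Psi> i = 0"
proof (rule ccontr)
  assume nz: "\<Psi> i \<noteq> 0"
  define K where "K = (\<Union>i\<in>I. keys (\<Psi> i))"
  have "finite K" unfolding K_def using I by auto
  moreover have "K \<noteq> {}" unfolding K_def using nz i by auto
  ultimately obtain M where M: "M \<in> K" "\<And>m. m \<in> K \<Longrightarrow> weight (\<lambda>_. 1) M \<le> weight (\<lambda>_. 1) m"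
    using ex_is_arg_min_if_finite[of K "weight (\<lambda>_. 1)"] unfolding is_arg_min_linorder by blast
  define a where "a = (\<lambda>i. lookup (\<Psi> i) M)"
  have pM: "p dvd lookup M j" for j using M(1) \<Psi> unfolding K_def by auto
  have "(\<Sum>i\<in>I. mconst (a i) * f i) \<in> frob_ideal p"
    unfolding frob_ideal_def
  proof (intro CollectI ballI)
    fix \<nu> assume \<nu>: "\<nu> \<in> keys (\<Sum>i\<in>I. mconst (a i) * f i)"
    show "\<exists>j. p \<le> lookup \<nu> j"
    proof (rule ccontr)
      assume "\<nexists>j. p \<le> lookup \<nu> j"
      then have lt: "lookup \<nu> j < p" for j by (simp add: not_le)
      \<comment> \<open>The exponents of \<open>m'\<close> and \<open>M\<close> are multiples of
        \<open>p\<close> and those of \<open>\<nu>\<close> are less than \<open>p\<close>, which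
        gives \<open>m' \<le> M\<close> at every variable; minimality of the degree of
        \<open>M\<close> forces equality.\<close>
      have uniq: "m' = M \<and> \<nu>' = \<nu>" if m': "m' \<in> K" and e: "\<nu>' + m' = \<nu> + M" for m' \<nu>'
      proof -
        have ev: "lookup \<nu>' j + lookup m' j = lookup \<nu> j + lookup M j" for j
          using arg_cong[OF e, of "\<lambda>m. lookup m j"] by (simp add: lookup_add)
        have le: "lookup m' j \<le> lookup M j" for j
        proof -
          have "p dvd lookup m' j" using m' \<Psi> unfolding K_def by auto
          then obtain b where b: "lookup m' j = p * b" by (elim dvdE)
          obtain c where c: "lookup M j = p * c" using pM[of j] by (elim dvdE)
          have "p * b < p * c + p" using ev[of j] lt[of j] b c by simp
          then have "p * b < p * (c + 1)" by simp
          then have "b < c + 1" using mult_less_cancel1 by blast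
          then show ?thesis unfolding b c by simp
        qed
        define A where "A = keys m' \<union> keys M"
        have "weight (\<lambda>_. 1) M \<le> weight (\<lambda>_. 1) m'" by (rule M(2)[OF m'])
        moreover have "weight (\<lambda>_. 1) M = (\<Sum>j\<in>A. int (lookup M j))"
          using weight_superset[of A M "\<lambda>_. 1"] unfolding A_def by simp
        moreover have "weight (\<lambda>_. 1) m' = (\<Sum>j\<in>A. int (lookup m' j))"
          using weight_superset[of A m' "\<lambda>_. 1"] unfolding A_def by simp
        ultimately have ge: "(\<Sum>j\<in>A. int (lookup M j)) \<le> (\<Sum>j\<in>A. int (lookup m' j))" by simp
        have "lookup m' j = lookup M j" for j
        proof (rule ccontr)
          assume ne: "lookup m' j \<noteq> lookup M j"
          then have "j \<in> A" unfolding A_def by (auto simp: in_keys_iff)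
          moreover have "lookup m' j < lookup M j" using ne le[of j] by simp
          ultimately have "(\<Sum>j\<in>A. int (lookup m' j)) < (\<Sum>j\<in>A. int (lookup M j))"
            by (intro sum_strict_mono_ex1) (auto simp: A_def le)
          then show False using ge by simp
        qed
        then have "m' = M" by (rule poly_mapping_eqI)
        then show ?thesis using e by simp
      qed
      have "0 = lookup (\<Sum>i\<in>I. f i * \<Psi> i) (\<nu> + M)" using sum0 by simp
      also have "\<dots> = (\<Sum>i\<in>I. \<Sum>\<nu>'\<in>keys (f i). \<Sum>m'\<in>keys (\<Psi> i).
          lookup (Poly_Mapping.single (\<nu>' + m') (lookup (f i) \<nu>' * lookup (\<Psi> i) m')) (\<nu> + M))"
      proof -
        have "f i * \<Psi> i = (\<Sum>\<nu>'\<in>keys (f i). \<Sum>m'\<in>keys (\<Psi> i). Poly_Mapping.single (\<nu>' + m') (lookup (f i) \<nu>' * lookup (\<Psi> i) m'))" for i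
          by (subst mpol_sum_single[of "f i"], subst mpol_sum_single[of "\<Psi> i"]) (simp add: sum_product mult_single)
        then show ?thesis by (simp only: lookup_sum)
      qed
      also have "\<dots> = (\<Sum>i\<in>I. \<Sum>\<nu>'\<in>keys (f i). \<Sum>m'\<in>keys (\<Psi> i).
          if \<nu>' = \<nu> \<and> m' = M then lookup (f i) \<nu> * a i else 0)"
      proof (intro sum.cong refl)
        fix i \<nu>' m' assume i: "i \<in> I" and m': "m' \<in> keys (\<Psi> i)"
        have "m' \<in> K" unfolding K_def using i m' by auto
        then show "lookup (Poly_Mapping.single (\<nu>' + m') (lookup (f i) \<nu>' * lookup (\<Psi> i) m')) (\<nu> + M)
            = (if \<nu>' = \<nu> \<and> m' = M then lookup (f i) \<nu> * a i else 0)"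
          using uniq[of m' \<nu>'] unfolding lookup_single when_def a_def by auto
      qed
      also have "\<dots> = (\<Sum>i\<in>I. a i * lookup (f i) \<nu>)"
      proof (intro sum.cong refl)
        fix i
        have "(\<Sum>\<nu>'\<in>keys (f i). \<Sum>m'\<in>keys (\<Psi> i). if \<nu>' = \<nu> \<and> m' = M then lookup (f i) \<nu> * a i else 0)
            = (\<Sum>\<nu>'\<in>keys (f i). if \<nu>' = \<nu> then \<Sum>m'\<in>keys (\<Psi> i). if m' = M then lookup (f i) \<nu> * a i else 0 else 0)"
          by (intro sum.cong refl) auto
        also have "\<dots> = a i * lookup (f i) \<nu>"
          unfolding a_def by (auto simp: in_keys_iff)
        finally show "(\<Sum>\<nu>'\<in>keys (f i). \<Sum>m'\<in>keys (\<Psi> i). if \<nu>' = \<nu> \<and> m' = M then lookup (f i) \<nu> * a i else 0) = a i * lookup (f i) \<nu>" .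
      qed
      also have "\<dots> = lookup (\<Sum>i\<in>I. mconst (a i) * f i) \<nu>"
        by (simp add: lookup_sum lookup_mconst_mult)
      finally show False using \<nu> by (simp add: in_keys_iff)
    qed
  qed
  then have "\<forall>i\<in>I. a i = 0" by (rule ind)
  then show False using M(1) unfolding K_def a_def by (auto simp: in_keys_iff)
qed

section \<open>Frobenius-twisted products of polynomials\<close>

lemma keys_single_power: "M \<in> keys (Poly_Mapping.single m c ^ k :: 'a::comm_ring_1 mpol) \<Longrightarrow> lookup M j = k * lookup m j"
proof (induction k arbitrary: M)
  case (Suc k)
  then obtain a b where "M = a + b" "a \<in> keys (Poly_Mapping.single m c)" "b \<in> keys (Poly_Mapping.single m c ^ k)"
    using keys_mult[of "Poly_Mapping.single m c" "Poly_Mapping.single m c ^ k"] by auto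
  then show ?case using Suc.IH[of b] by (auto simp: lookup_add split: if_splits)
qed simp

lemma keys_char_power:
  fixes g :: "'a::comm_ring_1 mpol"
  assumes p: "prime p" "CHAR('a) = p" and M: "M \<in> keys (g ^ p)"
  shows "p dvd lookup M j"
proof -
  have "g ^ p = (\<Sum>m\<in>keys g. Poly_Mapping.single m (lookup g m) ^ p)"
    by (subst mpol_sum_single[of g], rule freshmans_dream_sum) (use p CHAR_mpol[OF p(2)] in auto)
  then have "M \<in> (\<Union>m\<in>keys g. keys (Poly_Mapping.single m (lookup g m) ^ p))"
    using M keys_sum[of "\<lambda>m. Poly_Mapping.single m (lookup g m) ^ p"] by auto
  then show ?thesis using keys_single_power by (auto dest!: keys_single_power[where j=j])
qed

text \<open>For the list \<open>i\<^sub>0, i\<^sub>1, i\<^sub>2, ...\<close> this is the product of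
  \<open>f i\<^sub>0\<close>, \<open>f i\<^sub>1 ^ p\<close>, \<open>f i\<^sub>2 ^ (p ^ 2)\<close>
  and so on, nested as in Horner's scheme so that the tail appears as a single \<open>p\<close>-th
  power.\<close>

fun frob_prod :: "nat \<Rightarrow> ('i \<Rightarrow> 'r::comm_ring_1) \<Rightarrow> 'i list \<Rightarrow> 'r" where
  "frob_prod p f [] = 1"
| "frob_prod p f (i # l) = f i * frob_prod p f l ^ p"

definition lists_of :: "'i set \<Rightarrow> nat \<Rightarrow> 'i list set" where
  "lists_of I t = {l. set l \<subseteq> I \<and> length l = t}"

lemma finite_lists_of: "finite I \<Longrightarrow> finite (lists_of I t)"
  unfolding lists_of_def by (rule finite_lists_length_eq)

lemma card_lists_of: "finite I \<Longrightarrow> card (lists_of I t) = card I ^ t"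
  unfolding lists_of_def by (rule card_lists_length_eq)

lemma lists_of_0: "lists_of I 0 = {[]}"
  unfolding lists_of_def by auto

lemma sum_lists_of_Suc:
  assumes "finite I"
  shows "(\<Sum>l\<in>lists_of I (Suc t). F l) = (\<Sum>i\<in>I. \<Sum>l\<in>lists_of I t. F (i # l))"
proof -
  have "(\<Sum>l\<in>lists_of I (Suc t). F l) = (\<Sum>(i, l)\<in>I \<times> lists_of I t. F (i # l))"
    by (rule sum.reindex_bij_witness[of _ "\<lambda>(i, l). i # l" "\<lambda>l. (hd l, tl l)"])
       (auto simp: lists_of_def length_Suc_conv)
  then show ?thesis by (simp add: sum.cartesian_product)
qed

text \<open>Collecting the terms by the head of the list gives a relation among the
  \<open>f i\<close> whose coefficients are \<open>p\<close>-th powers of sums over shorter lists.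
  Independence over the Frobenius subring makes each coefficient zero, and its \<open>p\<close>-th
  root is a relation of length \<open>t\<close>.\<close>

lemma frob_prod_independent:
  fixes f :: "'i \<Rightarrow> 'a::{field,finite} mpol"
  assumes p: "prime p" "CARD('a) = p ^ e" "e \<ge> 1" and I: "finite I"
    and ind: "\<And>a. (\<Sum>i\<in>I. mconst (a i) * f i) \<in> frob_ideal p \<Longrightarrow> \<forall>i\<in>I. a i = 0"
    and 0: "(\<Sum>l\<in>lists_of I t. mconst (c l) * frob_prod p f l) = 0" and l: "l \<in> lists_of I t"
  shows "c l = 0"
  using 0 l
proof (induction t arbitrary: c l)
  case 0
  then have "mconst (c []) = 0" by (simp add: lists_of_0)
  then have "lookup (mconst (c [])) 0 = 0" by simp
  then show ?case using 0 by (simp add: mconst_def lists_of_0)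
next
  case (Suc t)
  \<comment> \<open>The inverse of the Frobenius map of the coefficient field, available since
    \<open>a ^ (p ^ e) = a\<close>.\<close>
  define r where "r = (\<lambda>a::'a. a ^ (p ^ (e - 1)))"
  have r: "r a ^ p = a" for a
  proof -
    have "r a ^ p = a ^ (p ^ (e - 1) * p)" unfolding r_def by (simp add: power_mult)
    also have "p ^ (e - 1) * p = CARD('a)" using p(2,3) by (cases e) auto
    finally show ?thesis by (simp only: finite_field_power_card)
  qed
  have char: "CHAR('a) = p" by (rule finite_field_CHAR[OF p(1,2)])
  define g where "g = (\<lambda>i. \<Sum>l\<in>lists_of I t. mconst (r (c (i # l))) * frob_prod p f l)"
  have mp: "mconst a ^ k = mconst (a ^ k)" for a :: 'a and k
    by (induction k) (simp_all add: mconst_def mult_single)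
  have gp: "g i ^ p = (\<Sum>l\<in>lists_of I t. mconst (c (i # l)) * frob_prod p f l ^ p)" for i
  proof -
    have "g i ^ p = (\<Sum>l\<in>lists_of I t. (mconst (r (c (i # l))) * frob_prod p f l) ^ p)"
      unfolding g_def by (rule freshmans_dream_sum) (use p(1) CHAR_mpol[OF char] in auto)
    then show ?thesis by (simp add: power_mult_distrib mp r)
  qed
  have sum0: "(\<Sum>i\<in>I. f i * g i ^ p) = 0"
    using Suc.prems(1) unfolding sum_lists_of_Suc[OF I] gp by (simp add: sum_distrib_left mult_ac)
  have "g i ^ p = 0" if "i \<in> I" for i
  proof (rule independent_over_frobenius_subring[where I=I and f=f and p=p and \<Psi>="\<lambda>i. g i ^ p"])
    show "p dvd lookup m j" if "m \<in> keys (g i ^ p)" for i m j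
      by (rule keys_char_power[OF p(1) char that])
  qed (use I ind sum0 that in auto)
  then have g0: "g i = 0" if "i \<in> I" for i using that by simp
  obtain i l' where l: "l = i # l'" "i \<in> I" "l' \<in> lists_of I t"
    using Suc.prems(2) unfolding lists_of_def by (cases l) auto
  have "r (c (i # l')) = 0" by (rule Suc.IH[of "\<lambda>l. r (c (i # l))", OF _ l(3)]) (use g0[OF l(2)] in \<open>simp add: g_def\<close>)
  then have "r (c (i # l')) ^ p = 0" using prime_gt_0_nat[OF p(1)] by simp
  then show ?case unfolding r l(1) .
qed

lemma mpol_eq_0_if_vanishing:
  fixes f :: "'a::{field,finite} mpol"
  assumes lt: "\<And>m i. m \<in> keys f \<Longrightarrow> lookup m i < CARD('a) - 1"
    and zero: "\<And>x. subst_mpol (\<lambda>a. a) x f = 0"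
  shows "f = 0"
proof (rule poly_mapping_eqI)
  fix m
  define I where "I = (\<Union>m\<in>keys f. keys m)"
  have I: "finite I" unfolding I_def by auto
  show "lookup f m = lookup 0 m"
  proof (cases "m \<in> keys f")
    case True
    have "lookup f m = 0"
    proof (rule monomials_independent_finite_field[of I "keys f" lookup "lookup f"])
      show "(\<Sum>m\<in>keys f. lookup f m * (\<Prod>i\<in>I. x i ^ lookup m i)) = 0" for x
      proof -
        have "(\<Sum>m\<in>keys f. lookup f m * (\<Prod>i\<in>I. x i ^ lookup m i)) = subst_mpol (\<lambda>a. a) x f"
          unfolding subst_mpol_def
          by (intro sum.cong refl arg_cong2[where f="(*)"] mon_eval_superset[symmetric] I) (auto simp: I_def)
        then show ?thesis using zero by simp
      qed
      fix m1 m2 assume m: "m1 \<in> keys f" "m2 \<in> keys f" and e: "\<And>i. i \<in> I \<Longrightarrow> lookup m1 i = lookup m2 i"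
      show "m1 = m2"
      proof (rule poly_mapping_eqI)
        fix i
        show "lookup m1 i = lookup m2 i"
        proof (cases "i \<in> I")
          case False
          then have "lookup m1 i = 0" "lookup m2 i = 0" using m unfolding I_def by (auto simp: in_keys_iff)
          then show ?thesis by simp
        qed (rule e)
      qed
    qed (use I lt True in auto)
    then show ?thesis by simp
  qed (simp add: in_keys_iff)
qed

section \<open>Restriction to an affine cell of the flag variety\<close>

lemma (in coeff_hom) hom_sum: "\<iota> (sum f A) = (\<Sum>i\<in>A. \<iota> (f i))"
  by (induction A rule: infinite_finite_induct) (simp_all add: hom_zero hom_add)

lemma (in coeff_hom) hom_power: "\<iota> (a ^ k) = \<iota> a ^ k"
  by (induction k) (simp_all add: hom_one hom_mult)

lemma (in coeff_hom) hom_prod: "\<iota> (prod f A) = (\<Prod>i\<in>A. \<iota> (f i))"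
  by (induction A rule: infinite_finite_induct) (simp_all add: hom_one hom_mult)

lemma (in coeff_hom) hom_bieval: "\<iota> (bieval \<kappa> n E c \<xi> \<zeta>) = bieval (\<lambda>a. \<iota> (\<kappa> a)) n E c (\<lambda>i. \<iota> (\<xi> i)) (\<lambda>i. \<iota> (\<zeta> i))"
  unfolding bieval_def power_prod_def by (simp add: hom_sum hom_mult hom_prod hom_power)

lemma bieval_cong:
  assumes "\<And>i. i < n \<Longrightarrow> \<xi> i = \<xi>' i" "\<And>i. i < n \<Longrightarrow> \<zeta> i = \<zeta>' i"
  shows "bieval \<iota> n E c \<xi> \<zeta> = bieval \<iota> n E c \<xi>' \<zeta>'"
  unfolding bieval_def power_prod_def using assms by (intro sum.cong refl) simp

lemma (in coeff_hom) bieval_add: "bieval \<iota> n E (c + d) \<xi> \<zeta> = bieval \<iota> n E c \<xi> \<zeta> + bieval \<iota> n E d \<xi> \<zeta>"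
  unfolding bieval_def by (simp add: hom_add distrib_right sum.distrib)

lemma (in coeff_hom) bieval_lincomb:
  "bieval \<iota> n E (\<lambda>e. \<Sum>i\<in>I. a i * c i e) \<xi> \<zeta> = (\<Sum>i\<in>I. \<iota> (a i) * bieval \<iota> n E (c i) \<xi> \<zeta>)"
  unfolding bieval_def by (simp add: hom_sum hom_mult sum_distrib_left sum_distrib_right mult.assoc) (rule sum.swap)

text \<open>The points \<open>(x, z)\<close> of \<open>\<Sum>\<^sub>i x\<^sub>i z\<^sub>i = 0\<close> with \<open>x\<^sub>0 = z\<^sub>1 = 1\<close>, parametrised by \<open>s = x\<^sub>1\<close> and the
  remaining coordinates of index at least two.\<close>

definition cell_x :: "'r::comm_ring_1 \<Rightarrow> (nat \<Rightarrow> 'r) \<Rightarrow> nat \<Rightarrow> 'r" where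
  "cell_x s y i = (if i = 0 then 1 else if i = 1 then s else y i)"

definition cell_z :: "nat \<Rightarrow> 'r::comm_ring_1 \<Rightarrow> (nat \<Rightarrow> 'r) \<Rightarrow> (nat \<Rightarrow> 'r) \<Rightarrow> nat \<Rightarrow> 'r" where
  "cell_z n s y z i = (if i = 0 then - (s + (\<Sum>j\<in>{2..<n}. y j * z j)) else if i = 1 then 1 else z i)"

lemma sum_lessThan_split2:
  fixes f :: "nat \<Rightarrow> 'b::comm_monoid_add"
  assumes "n \<ge> 2"
  shows "(\<Sum>i<n. f i) = f 0 + f 1 + (\<Sum>i\<in>{2..<n}. f i)"
proof -
  have "{..<n} = insert 0 (insert (Suc 0) {2..<n})" using assms by auto
  moreover have "0 \<notin> insert (Suc 0) {2..<n}" "Suc 0 \<notin> {2..<n}" by auto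
  ultimately show ?thesis by (simp add: add.assoc)
qed

lemma cell_on_quadric:
  assumes "n \<ge> 2"
  shows "(\<Sum>i<n. cell_x s y i * cell_z n s y z i) = 0"
  unfolding sum_lessThan_split2[OF assms] by (simp add: cell_x_def cell_z_def)

definition vanishes_on_cell :: "nat \<Rightarrow> nat \<Rightarrow> ((nat \<Rightarrow> nat) \<times> (nat \<Rightarrow> nat) \<Rightarrow> 'a::comm_ring_1) \<Rightarrow> bool" where
  "vanishes_on_cell n k c \<longleftrightarrow> (\<forall>s y z. beval n (biexpo n k) c (cell_x s y) (cell_z n s y z) = 0)"

text \<open>Two disjoint families of variables, exchanged by negating \<open>b\<close>.\<close>

definition cvar :: "bool \<Rightarrow> nat \<Rightarrow> nat" where
  "cvar b i = 2 * i + (if b then 1 else 0)"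

lemma cvar_eq_iff: "cvar b i = cvar b' j \<longleftrightarrow> b = b' \<and> i = j"
  unfolding cvar_def by (auto split: if_splits) presburger+

text \<open>Only the indices \<open>i \<ge> 2\<close> need both variables, so the variable of index
  \<open>0\<close> stays free for the one remaining coordinate of the cell.\<close>

lemma cvar_nonzero: "i \<ge> 2 \<Longrightarrow> cvar b i \<noteq> 0"
  unfolding cvar_def by auto

abbreviation "mcv b i \<equiv> mvar (cvar b i)"
definition mquad :: "nat \<Rightarrow> 'a::comm_ring_1 mpol" where
  "mquad n = (\<Sum>i\<in>{2..<n}. mcv True i * mcv False i)"

lemma sum_mcv: "(\<Sum>i\<in>{2..<n}. mcv b i * mcv (\<not> b) i) = mquad n"
  unfolding mquad_def by (cases b) (simp_all add: mult.commute)

lemma mquad_nonzero: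
  assumes "n \<ge> 3"
  shows "(mquad n :: 'a::comm_ring_1 mpol) \<noteq> 0"
proof
  assume z: "(mquad n :: 'a mpol) = 0"
  interpret coeff_hom "\<lambda>a::'a. a" by (rule coeff_hom_id)
  let ?x = "\<lambda>j. if j = cvar True 2 \<or> j = cvar False 2 then 1 else (0::'a)"
  have "subst_mpol (\<lambda>a. a) ?x (mquad n) = (\<Sum>i\<in>{2..<n}. if i = 2 then 1 else 0)"
    unfolding mquad_def subst_sum subst_mult subst_var by (intro sum.cong refl) (simp add: cvar_eq_iff)
  also have "\<dots> = 1" using assms by (simp del: mult_1 mult_1_right)
  finally show False unfolding z by (simp add: subst_zero)
qed

lemma weight_fun_add: "weight (\<lambda>j. w j + w' j) m = weight w m + weight w' m"
  unfolding weight_def by (simp add: algebra_simps sum.distrib)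

lemma weight_fun_uminus: "weight (\<lambda>j. - w j) m = - weight w m"
  unfolding weight_def by (simp add: sum_negf)

lemma lookup_le_weight:
  assumes "\<And>i. w i \<ge> 0" "w j \<ge> 1"
  shows "int (lookup m j) \<le> weight w m"
proof (cases "j \<in> keys m")
  case True
  have "int (lookup m j) \<le> w j * int (lookup m j)" using assms(2) by (simp add: mult_le_cancel_right1)
  also have "\<dots> \<le> weight w m" unfolding weight_def
    by (rule member_le_sum[where f="\<lambda>i. w i * int (lookup m i)"]) (use True assms(1) in auto)
  finally show ?thesis .
next
  case False
  then have "lookup m j = 0" by (simp add: in_keys_iff)
  then show ?thesis unfolding weight_def using assms(1) by (simp add: sum_nonneg)
qed

lemma sum_pCons_0: "(\<Sum>i\<in>A. [:0, f i:]) = [:0, \<Sum>i\<in>A. f i:]"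
  by (induction A rule: infinite_finite_induct) simp_all

text \<open>The coordinate \<open>z\<^sub>0\<close> of the cell serves as the variable with index \<open>0\<close>.\<close>

abbreviation "lsub n \<equiv> - (mvar 0 + mquad n)"

lemma cell_z_lsub: "cell_z n (lsub n) (mcv b) (mcv (\<not> b)) i = (if i = 0 then mvar 0 else if i = 1 then 1 else mcv (\<not> b) i)"
  unfolding cell_z_def sum_mcv by simp

lemma weight_le_mquad:
  assumes "\<And>i. i \<in> {2..<n} \<Longrightarrow> w (cvar True i) + w (cvar False i) \<le> d"
  shows "weight_le w d (mquad n)"
  unfolding mquad_def
  by (rule weight_le_sum, rule weight_le_mono[OF weight_le_mult[OF weight_le_var weight_le_var]]) (rule assms)

lemma sum_expo: "e \<in> biexpo n k \<Longrightarrow> (\<Sum>i<n. fst e i) = k" "e \<in> biexpo n k \<Longrightarrow> (\<Sum>i<n. snd e i) = k"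
  unfolding biexpo_def expo_def by auto

lemma degree_mono_le:
  assumes "\<And>i. i < n \<Longrightarrow> degree (x i) \<le> d"
  shows "degree (power_prod n x \<alpha>) \<le> d * (\<Sum>i<n. \<alpha> i)"
proof -
  have "degree (power_prod n x \<alpha>) \<le> (\<Sum>i<n. degree (x i ^ \<alpha> i))"
    unfolding power_prod_def using degree_prod_sum_le[of "{..<n}" "\<lambda>i. x i ^ \<alpha> i"] by simp
  also have "\<dots> \<le> (\<Sum>i<n. d * \<alpha> i)"
  proof (rule sum_mono)
    fix i assume "i \<in> {..<n}"
    then have "degree (x i) * \<alpha> i \<le> d * \<alpha> i" using assms by simp
    then show "degree (x i ^ \<alpha> i) \<le> d * \<alpha> i" using degree_power_le[of "x i" "\<alpha> i"] by linarith
  qed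
  finally show ?thesis by (simp add: sum_distrib_left)
qed

text \<open>With \<open>\<ell> = z\<^sub>0\<close> as a coordinate, no exponent of \<open>x\<^sub>i\<close> or \<open>z\<^sub>i\<close> with \<open>i \<ge> 2\<close> reaches \<open>p\<close>, so
  the polynomial is divisible by \<open>\<ell>\<^sup>p\<close>. With \<open>s = x\<^sub>1\<close> as a coordinate, its degree in the \<open>z\<^sub>i\<close> is
  less than \<open>p\<close>, whereas \<open>\<ell> = - (s + \<Sum>\<^sub>i x\<^sub>i z\<^sub>i)\<close> has degree one in the \<open>z\<^sub>i\<close>.\<close>

lemma vanishes_on_cell_if_x_heavy:
  fixes c :: "_ \<Rightarrow> 'a::field"
  assumes n: "n \<ge> 3" and k: "k < p"
    and heavy: "\<And>e. e \<in> biexpo n k \<Longrightarrow> c e \<noteq> 0 \<Longrightarrow> (\<Sum>i\<in>{2..<n}. snd e i) \<le> (\<Sum>i\<in>{2..<n}. fst e i)"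
    and J: "bieval mconst n (biexpo n k) c (cell_x (lsub n) (mcv b)) (cell_z n (lsub n) (mcv b) (mcv (\<not> b))) \<in> frob_ideal p"
  shows "vanishes_on_cell n k c"
proof -
  let ?E = "biexpo n k" and ?S = "mquad n :: 'a mpol"
  define P where "P = bieval mconst n ?E c (cell_x (lsub n) (mcv b)) (cell_z n (lsub n) (mcv b) (mcv (\<not> b)))"
  have n2: "n \<ge> 2" using n by simp
  define isY where "isY = (\<lambda>b j. \<exists>i\<in>{2..<n}. j = cvar b i)"
  have isY: "isY b (cvar b' i) \<longleftrightarrow> b = b' \<and> i \<in> {2..<n}" for b b' i
    unfolding isY_def by (auto simp: cvar_eq_iff)
  have isY0: "\<not> isY b 0" for b
  proof
    assume "isY b 0"
    then obtain i where "i \<in> {2..<n}" "0 = cvar b i" unfolding isY_def by (elim bexE)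
    then show False using cvar_nonzero[of i b] by simp
  qed
  have isYd: "isY b j \<Longrightarrow> \<not> isY (\<not> b) j" for j unfolding isY_def by (auto simp: cvar_eq_iff)
  \<comment> \<open>Here \<open>w1\<close> counts the degree in the variables for
    \<open>x\<^sub>i\<close>, \<open>w2\<close> the degree in those for \<open>z\<^sub>i\<close>
    minus the former, and \<open>w3\<close> detects foreign variables. Their bounds
    \<open>k\<close>, \<open>0\<close> and \<open>0\<close> limit every exponent except that of
    index \<open>0\<close> to \<open>k\<close>.\<close>
  define w1 w2 w3 :: "nat \<Rightarrow> int" where
    "w1 = (\<lambda>j. if isY b j then 1 else 0)"
    and "w2 = (\<lambda>j. if isY (\<not> b) j then 1 else if isY b j then -1 else 0)"
    and "w3 = (\<lambda>j. if j = 0 \<or> isY b j \<or> isY (\<not> b) j then 0 else 1)"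
  have mq: "weight_le w d ?S" if "\<And>i. i \<in> {2..<n} \<Longrightarrow> w (cvar b i) + w (cvar (\<not> b) i) \<le> d" for w d
    by (rule weight_le_mquad) (use that in \<open>cases b; simp add: add.commute\<close>)
  have wl: "weight_le w d (lsub n :: 'a mpol)" if "w 0 \<le> d" "\<And>i. i \<in> {2..<n} \<Longrightarrow> w (cvar b i) + w (cvar (\<not> b) i) \<le> d" for w d
  proof -
    have "weight_le w d (mvar 0 :: 'a mpol)" by (rule weight_le_mono[where d="w 0"]) (use weight_le_var that(1) in auto)
    then show ?thesis by (intro weight_le_uminus weight_le_add mq that)
  qed
  have gen: "weight_le w D P"
    if a1: "w 0 \<le> a1" "\<And>i. i \<in> {2..<n} \<Longrightarrow> w (cvar b i) + w (cvar (\<not> b) i) \<le> a1"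
      and a: "\<And>i. i \<in> {2..<n} \<Longrightarrow> w (cvar b i) = a" and b: "\<And>i. i \<in> {2..<n} \<Longrightarrow> w (cvar (\<not> b) i) = b'"
      and D: "\<And>e. e \<in> ?E \<Longrightarrow> c e \<noteq> 0 \<Longrightarrow> int (fst e 1) * a1 + a * int (\<Sum>i\<in>{2..<n}. fst e i)
          + int (snd e 0) * w 0 + b' * int (\<Sum>i\<in>{2..<n}. snd e i) \<le> D"
    for w a1 a b' D
    unfolding P_def
  proof (rule weight_le_bieval[where a="\<lambda>i. if i = 0 then 0 else if i = 1 then a1 else a"
        and b="\<lambda>i. if i = 0 then w 0 else if i = 1 then 0 else b'"])
    fix i assume i: "i < n"
    show "weight_le w (if i = 0 then 0 else if i = 1 then a1 else a) (cell_x (lsub n) (mcv b) i :: 'a mpol)"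
      unfolding cell_x_def using wl[OF a1] weight_le_one weight_le_var[of w "cvar b i"] a[of i] i by auto
    show "weight_le w (if i = 0 then w 0 else if i = 1 then 0 else b') (cell_z n (lsub n) (mcv b) (mcv (\<not> b)) i :: 'a mpol)"
      unfolding cell_z_lsub using weight_le_one weight_le_var[of w "cvar (\<not> b) i"] weight_le_var[of w 0] b[of i] i by auto
  next
    fix e assume e: "e \<in> ?E" "c e \<noteq> 0"
    show "(\<Sum>i<n. int (fst e i) * (if i = 0 then 0 else if i = 1 then a1 else a))
        + (\<Sum>i<n. int (snd e i) * (if i = 0 then w 0 else if i = 1 then 0 else b')) \<le> D"
      using D[OF e] unfolding sum_lessThan_split2[OF n2] by (simp add: sum_distrib_left mult.commute)
  qed
  have fst_le: "fst e 1 + (\<Sum>i\<in>{2..<n}. fst e i) \<le> k" if "e \<in> ?E" for e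
    using sum_expo(1)[OF that] unfolding sum_lessThan_split2[OF n2] by simp
  have W1: "weight_le w1 (int k) P"
  proof (rule gen[where ?a1.0=1 and a=1 and b'=0])
    fix e assume e: "e \<in> ?E"
    show "int (fst e 1) * 1 + 1 * int (\<Sum>i\<in>{2..<n}. fst e i) + int (snd e 0) * w1 0 + 0 * int (\<Sum>i\<in>{2..<n}. snd e i) \<le> int k"
      using fst_le[OF e] isY0 unfolding w1_def by (simp del: of_nat_sum)
  qed (auto simp: w1_def isY isY0)
  have W2: "weight_le w2 0 P"
  proof (rule gen[where ?a1.0=0 and a="-1" and b'=1])
    fix e assume e: "e \<in> ?E" "c e \<noteq> 0"
    show "int (fst e 1) * 0 + (-1) * int (\<Sum>i\<in>{2..<n}. fst e i) + int (snd e 0) * w2 0 + 1 * int (\<Sum>i\<in>{2..<n}. snd e i) \<le> 0"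
      using heavy[OF e] isY0 unfolding w2_def by (simp del: of_nat_sum)
  qed (auto simp: w2_def isY isY0)
  have W3: "weight_le w3 0 P"
    by (rule gen[where ?a1.0=0 and a=0 and b'=0]) (auto simp: w3_def isY isY0)
  have lp: "p \<le> lookup m 0" if m: "m \<in> keys P" for m
  proof -
    obtain i where i: "p \<le> lookup m i" using J m unfolding P_def[symmetric] frob_ideal_def by auto
    have 1: "weight w1 m \<le> int k" and 2: "weight w2 m \<le> 0" and 3: "weight w3 m \<le> 0"
      using W1 W2 W3 m unfolding weight_le_def by auto
    have "i = 0"
    proof (rule ccontr)
      assume i0: "i \<noteq> 0"
      consider "isY b i" | "isY (\<not> b) i" | "\<not> isY b i" "\<not> isY (\<not> b) i" by blast
      then have "int (lookup m i) \<le> int k"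
      proof cases
        case 1
        then have "int (lookup m i) \<le> weight w1 m" by (intro lookup_le_weight) (auto simp: w1_def)
        then show ?thesis using \<open>weight w1 m \<le> int k\<close> by simp
      next
        case c2: 2
        then have "int (lookup m i) \<le> weight (\<lambda>j. w2 j + w1 j) m"
          by (intro lookup_le_weight) (auto simp: w1_def w2_def dest: isYd)
        then show ?thesis using 1 2 unfolding weight_fun_add by simp
      next
        case c3: 3
        then have "int (lookup m i) \<le> weight w3 m" by (intro lookup_le_weight) (auto simp: w3_def i0)
        then show ?thesis using 3 by simp
      qed
      then show False using i k by simp
    qed
    then show ?thesis using i by simp
  qed
  \<comment> \<open>The auxiliary variable marks the degree in the \<open>z\<^sub>i\<close> with
    \<open>i \<ge> 2\<close>, and index \<open>0\<close> now stands for
    \<open>s = x\<^sub>1\<close>. The former variable \<open>z\<^sub>0\<close> becomes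
    \<open>L\<close>, of degree one since \<open>mquad n\<close> is nonzero.\<close>
  define L :: "'a mpol poly" where "L = [: - mvar 0, - ?S :]"
  define X where "X = (\<lambda>j. if j = 0 then L else if isY (\<not> b) j then [:0, mvar j:] else [:mvar j:])"
  define R where "R = subst_mpol (\<lambda>a. [:mconst a:]) X P"
  interpret ph: coeff_hom "\<lambda>a::'a. [:mconst a:]" by (rule coeff_hom_pCons_mconst)
  have XY: "X (cvar b i) = [:mcv b i:]" "X (cvar (\<not> b) i) = [:0, mcv (\<not> b) i:]" if "i \<in> {2..<n}" for i
    using that cvar_nonzero[of i b] cvar_nonzero[of i "\<not> b"] unfolding X_def by (simp_all add: isY)
  have X0: "X 0 = L" unfolding X_def by simp
  have XS: "subst_mpol (\<lambda>a. [:mconst a:]) X ?S = [:0, ?S:]"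
  proof -
    have "subst_mpol (\<lambda>a. [:mconst a:]) X ?S = (\<Sum>i\<in>{2..<n}. X (cvar b i) * X (cvar (\<not> b) i))"
      unfolding sum_mcv[of b n, symmetric] by (simp add: ph.subst_sum ph.subst_mult ph.subst_var)
    also have "\<dots> = (\<Sum>i\<in>{2..<n}. [:0, mcv b i * mcv (\<not> b) i:])"
      by (intro sum.cong refl) (simp add: XY)
    also have "\<dots> = [:0, \<Sum>i\<in>{2..<n}. mcv b i * mcv (\<not> b) i:]"
      by (rule sum_pCons_0)
    finally show ?thesis unfolding sum_mcv .
  qed
  have sx: "subst_mpol (\<lambda>a. [:mconst a:]) X (cell_x (lsub n) (mcv b) i) = cell_x [:mvar 0:] (\<lambda>i. [:mcv b i:]) i" if "i < n" for i
    using that unfolding cell_x_def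
    by (auto simp: ph.subst_one ph.subst_uminus ph.subst_diff ph.subst_var XS XY X0 L_def)
  have sz: "subst_mpol (\<lambda>a. [:mconst a:]) X (cell_z n (lsub n) (mcv b) (mcv (\<not> b)) i)
      = (if i = 0 then L else if i = 1 then 1 else [:0, mcv (\<not> b) i:])" if "i < n" for i
    using that unfolding cell_z_lsub by (auto simp: ph.subst_one ph.subst_var XY X0)
  have R: "R = bieval (\<lambda>a. [:mconst a:]) n ?E c (cell_x [:mvar 0:] (\<lambda>i. [:mcv b i:])) (\<lambda>i. if i = 0 then L else if i = 1 then 1 else [:0, mcv (\<not> b) i:])"
    unfolding R_def P_def ph.subst_bieval by (rule bieval_cong[OF sx sz])
  have degR: "degree R \<le> k"
    unfolding R bieval_def
  proof (rule degree_sum_le, simp)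
    fix e assume e: "e \<in> ?E"
    let ?x = "power_prod n (cell_x [:mvar 0 :: 'a mpol:] (\<lambda>i. [:mcv b i:])) (fst e)"
    let ?z = "power_prod n (\<lambda>i. if i = 0 then L else if i = 1 then 1 else [:0, mcv (\<not> b) i:]) (snd e)"
    have "degree ?x \<le> 0 * (\<Sum>i<n. fst e i)" by (rule degree_mono_le) (auto simp: cell_x_def)
    moreover have "degree ?z \<le> 1 * (\<Sum>i<n. snd e i)" by (rule degree_mono_le) (auto simp: L_def)
    ultimately have "degree (?x * ?z) \<le> k" using degree_mult_le[of ?x ?z] sum_expo(2)[OF e] by simp
    then show "degree ([:mconst (c e):] * (?x * ?z)) \<le> k"
      using degree_mult_le[of "[:mconst (c e):]" "?x * ?z"] by simp
  qed
  have R0: "R = 0"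
  proof (rule ccontr)
    assume "R \<noteq> 0"
    have "L ^ p dvd R"
      unfolding R_def subst_mpol_def
    proof (rule dvd_sum, rule dvd_mult)
      fix m assume m: "m \<in> keys P"
      show "L ^ p dvd mon_eval X m"
      proof (cases "0 \<in> keys m")
        case True
        have "L ^ p dvd L ^ lookup m 0" using lp[OF m] by (rule le_imp_power_dvd)
        also have "L ^ lookup m 0 dvd mon_eval X m"
          unfolding mon_eval_def using dvd_prodI[of "keys m" 0 "\<lambda>i. X i ^ lookup m i"] True by (simp add: X_def)
        finally show ?thesis .
      next
        case False
        then show ?thesis using lp[OF m] k by (simp add: in_keys_iff)
      qed
    qed
    then have "degree (L ^ p) \<le> degree R" using \<open>R \<noteq> 0\<close> by (rule dvd_imp_degree_le)
    moreover have "degree L = 1" unfolding L_def using mquad_nonzero[OF n, where 'a='a] by simp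
    then have "degree (L ^ p) = p" by (subst degree_power_eq) auto
    ultimately show False using degR k by simp
  qed
  show ?thesis unfolding vanishes_on_cell_def
  proof (intro allI)
    fix s y z
    define pt where "pt = (\<lambda>j. if j = 0 then s else if isY b j then y (j div 2) else (z (j div 2) :: 'a))"
    have pt: "pt (cvar b i) = y i" "pt (cvar (\<not> b) i) = z i" if "i \<in> {2..<n}" for i
      using that cvar_nonzero[of i b] cvar_nonzero[of i "\<not> b"] unfolding pt_def by (simp_all add: isY) (simp_all add: cvar_def)
    have pt0: "pt 0 = s" unfolding pt_def by simp
    interpret id: coeff_hom "\<lambda>a::'a. a" by (rule coeff_hom_id)
    \<comment> \<open>Setting the auxiliary variable to one recovers the points of the cell.\<close>
    interpret ev: coeff_hom "\<lambda>f. subst_mpol (\<lambda>a::'a. a) pt (poly f 1)"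
      by unfold_locales (simp_all add: id.subst_zero id.subst_one id.subst_add id.subst_mult)
    have S: "subst_mpol (\<lambda>a. a) pt ?S = (\<Sum>i\<in>{2..<n}. y i * z i)"
      unfolding sum_mcv[of b n, symmetric] id.subst_sum id.subst_mult id.subst_var
      by (intro sum.cong refl) (simp add: pt)
    have "0 = subst_mpol (\<lambda>a. a) pt (poly R 1)" using R0 by (simp add: id.subst_zero)
    also have "\<dots> = bieval (\<lambda>a. a) n ?E c (cell_x s y) (cell_z n s y z)"
      unfolding R ev.hom_bieval poly_pCons poly_0 mult_zero_right add_0_right id.subst_const
    proof (rule bieval_cong)
      fix i assume i: "i < n"
      show "subst_mpol (\<lambda>a. a) pt (poly (cell_x [:mvar 0:] (\<lambda>i. [:mcv b i:]) i) 1) = cell_x s y i"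
        using i unfolding cell_x_def by (auto simp: id.subst_one id.subst_var pt pt0)
      show "subst_mpol (\<lambda>a. a) pt (poly (if i = 0 then L else if i = 1 then 1 else [:0, mcv (\<not> b) i:]) 1) = cell_z n s y z i"
        using i unfolding cell_z_def L_def
        by (auto simp: id.subst_one id.subst_var id.subst_diff id.subst_uminus S pt pt0)
    qed
    finally show "beval n ?E c (cell_x s y) (cell_z n s y z) = 0" by simp
  qed
qed

section \<open>The symmetry of the cell that exchanges \<open>x\<close> with
  \<open>z\<close>\<close>

definition swap01 :: "nat \<Rightarrow> nat" where
  "swap01 i = (if i = 0 then 1 else if i = 1 then 0 else i)"

lemma swap01_swap01 [simp]: "swap01 (swap01 i) = i"
  unfolding swap01_def by auto

lemma swap01_less: "n \<ge> 2 \<Longrightarrow> i < n \<Longrightarrow> swap01 i < n"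
  unfolding swap01_def by auto

definition swap_exp :: "(nat \<Rightarrow> nat) \<Rightarrow> nat \<Rightarrow> nat" where
  "swap_exp \<alpha> = (\<lambda>i. \<alpha> (swap01 i))"

lemma swap_exp_swap_exp [simp]: "swap_exp (swap_exp \<alpha>) = \<alpha>"
  unfolding swap_exp_def by simp

lemma sum_swap_exp: "(\<Sum>i\<in>{2..<n}. swap_exp \<alpha> i) = (\<Sum>i\<in>{2..<n}. \<alpha> i)"
  unfolding swap_exp_def swap01_def by (intro sum.cong refl) auto

lemma swap_exp_in_expo:
  assumes n: "n \<ge> 2" and \<alpha>: "\<alpha> \<in> expo n k"
  shows "swap_exp \<alpha> \<in> expo n k"
proof -
  have "(\<Sum>i<n. swap_exp \<alpha> i) = (\<Sum>i<n. \<alpha> i)"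
    unfolding sum_lessThan_split2[OF n] sum_swap_exp by (simp add: swap_exp_def swap01_def)
  then show ?thesis using \<alpha> n unfolding expo_def by (auto simp: swap_exp_def swap01_def)
qed

lemma power_prod_swap_exp:
  assumes "n \<ge> 2"
  shows "power_prod n x (swap_exp \<alpha>) = power_prod n (\<lambda>i. x (swap01 i)) \<alpha>"
  unfolding power_prod_def swap_exp_def
  by (rule prod.reindex_bij_witness[of _ swap01 swap01]) (use swap01_less[OF assms] in auto)

lemma bieval_swap:
  assumes n: "n \<ge> 2"
  shows "bieval \<iota> n (biexpo n k) (\<lambda>e. c (swap_exp (snd e), swap_exp (fst e))) x z
    = bieval \<iota> n (biexpo n k) c (\<lambda>i. z (swap01 i)) (\<lambda>i. x (swap01 i))"
  unfolding bieval_def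
proof (rule sum.reindex_bij_witness[of _ "\<lambda>e. (swap_exp (snd e), swap_exp (fst e))" "\<lambda>e. (swap_exp (snd e), swap_exp (fst e))"])
  fix e assume "e \<in> biexpo n k"
  then show "(swap_exp (snd e), swap_exp (fst e)) \<in> biexpo n k" "(swap_exp (snd e), swap_exp (fst e)) \<in> biexpo n k"
    unfolding biexpo_def using swap_exp_in_expo[OF n] by auto
qed (auto simp: power_prod_swap_exp[OF n, symmetric] mult.commute)

lemma cell_z_swap: "cell_z n s y z (swap01 i) = cell_x (- (s + (\<Sum>j\<in>{2..<n}. y j * z j))) z i"
  unfolding cell_z_def cell_x_def swap01_def by auto

lemma cell_x_swap: "cell_x s y (swap01 i) = cell_z n (- (s + (\<Sum>j\<in>{2..<n}. y j * z j))) z y i"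
  unfolding cell_z_def cell_x_def swap01_def by (auto simp: mult.commute)

text \<open>Exchanging \<open>x\<close> with \<open>z\<close> and index \<open>0\<close> with index
  \<open>1\<close> preserves both the quadric and the normalisation
  \<open>x\<^sub>0 = z\<^sub>1 = 1\<close>. The new \<open>x\<^sub>1\<close> is the old
  \<open>z\<^sub>0\<close>, which accounts for the new first parameter.\<close>

lemma bieval_swap_cell:
  assumes n: "n \<ge> 2"
  shows "bieval \<iota> n (biexpo n k) (\<lambda>e. c (swap_exp (snd e), swap_exp (fst e))) (cell_x s y) (cell_z n s y z)
    = bieval \<iota> n (biexpo n k) c (cell_x (- (s + (\<Sum>j\<in>{2..<n}. y j * z j))) z)
        (cell_z n (- (s + (\<Sum>j\<in>{2..<n}. y j * z j))) z y)"
  unfolding bieval_swap[OF n] cell_z_swap cell_x_swap[of _ _ _ n z] ..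

lemma vanishes_on_cell_swap:
  fixes c :: "_ \<Rightarrow> 'a::comm_ring_1"
  assumes n: "n \<ge> 2" and v: "vanishes_on_cell n k (\<lambda>e. c (swap_exp (snd e), swap_exp (fst e)))"
  shows "vanishes_on_cell n k c"
  unfolding vanishes_on_cell_def
proof (intro allI)
  fix s y z
  define s' where "s' = - (s + (\<Sum>j\<in>{2..<n}. z j * y j :: 'a))"
  have "beval n (biexpo n k) (\<lambda>e. c (swap_exp (snd e), swap_exp (fst e))) (cell_x s' z) (cell_z n s' z y) = 0"
    using v unfolding vanishes_on_cell_def by blast
  moreover have "- (s' + (\<Sum>j\<in>{2..<n}. z j * y j)) = s" unfolding s'_def by simp
  ultimately show "beval n (biexpo n k) c (cell_x s y) (cell_z n s y z) = 0"
    unfolding bieval_swap_cell[OF n] by simp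
qed

text \<open>Restriction to the cell respects the weight that counts the degree in the
  \<open>z\<^sub>i\<close> minus that in the \<open>x\<^sub>i\<close> for \<open>i \<ge> 2\<close>.
  The two parts of \<open>c\<close> selected by the sign of this weight thus have disjoint monomials
  on the cell, and the monomial ideal contains both. The part \<open>c1\<close> is covered by the
  preceding case, \<open>c2\<close> by its mirror image.\<close>

lemma vanishes_on_cell_if_frob_ideal:
  fixes c :: "_ \<Rightarrow> 'a::field"
  assumes n: "n \<ge> 3" and k: "k < p" and p: "prime p" "CHAR('a) = p"
    and J: "bieval mconst n (biexpo n k) c (cell_x (lsub n) (mcv True)) (cell_z n (lsub n) (mcv True) (mcv False)) \<in> frob_ideal p"
  shows "vanishes_on_cell n k c"
proof -
  have n2: "n \<ge> 2" using n by simp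
  define heavy where "heavy = (\<lambda>e::(nat \<Rightarrow> nat) \<times> (nat \<Rightarrow> nat). (\<Sum>i\<in>{2..<n}. snd e i) \<le> (\<Sum>i\<in>{2..<n}. fst e i))"
  define c1 where "c1 = (\<lambda>e. if heavy e then c e else 0)"
  define c2 where "c2 = (\<lambda>e. if heavy e then 0 else c e)"
  define \<pi> where "\<pi> = (\<lambda>c::_ \<Rightarrow> 'a. bieval mconst n (biexpo n k) c (cell_x (lsub n) (mcv True)) (cell_z n (lsub n) (mcv True) (mcv False)))"
  interpret mc: coeff_hom "mconst :: 'a \<Rightarrow> _" by (rule coeff_hom_mconst)
  have cc: "c = c1 + c2" unfolding c1_def c2_def by (auto simp: fun_eq_iff)
  have \<pi>c: "\<pi> c = \<pi> c1 + \<pi> c2" unfolding \<pi>_def cc by (rule mc.bieval_add)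
  \<comment> \<open>Both \<open>mvar 0\<close> and \<open>mquad n\<close> have weight zero, so only
    the coordinates of index at least two contribute.\<close>
  define w :: "nat \<Rightarrow> int" where "w = (\<lambda>j. if \<exists>i\<in>{2..<n}. j = cvar False i then 1 else if \<exists>i\<in>{2..<n}. j = cvar True i then -1 else 0)"
  have w: "w (cvar False i) = 1" "w (cvar True i) = -1" if "i \<in> {2..<n}" for i
    using that unfolding w_def by (auto simp: cvar_eq_iff)
  have w0: "w 0 = 0" unfolding w_def using cvar_nonzero[of _ True] cvar_nonzero[of _ False] by force
  have cz: "cell_z n (lsub n) (mcv True) (mcv False) i = (if i = 0 then mvar 0 else if i = 1 then 1 else mcv False i :: 'a mpol)" for i
    using cell_z_lsub[of n True i] by (simp only: not_True_eq_False)
  have wt: "weight_le (\<lambda>j. \<epsilon> * w j) D (\<pi> d)"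
    if D: "\<And>e. d e \<noteq> 0 \<Longrightarrow> \<epsilon> * (int (\<Sum>i\<in>{2..<n}. snd e i) - int (\<Sum>i\<in>{2..<n}. fst e i)) \<le> D" for \<epsilon> D d
    unfolding \<pi>_def
  proof (rule weight_le_bieval[where a="\<lambda>i. if i \<ge> 2 then - \<epsilon> else 0" and b="\<lambda>i. if i \<ge> 2 then \<epsilon> else 0"])
    let ?w = "\<lambda>j. \<epsilon> * w j"
    have 0: "weight_le ?w 0 (mvar 0 :: 'a mpol)" using weight_le_var[of ?w 0] by (simp add: w0)
    have S: "weight_le ?w 0 (lsub n :: 'a mpol)"
      by (intro weight_le_uminus weight_le_add 0 weight_le_mquad) (simp add: w)
    fix i assume i: "i < n"
    show "weight_le ?w (if i \<ge> 2 then - \<epsilon> else 0) (cell_x (lsub n) (mcv True) i :: 'a mpol)"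
      unfolding cell_x_def using S weight_le_one weight_le_var[of ?w "cvar True i"] w(2)[of i] i by auto
    show "weight_le ?w (if i \<ge> 2 then \<epsilon> else 0) (cell_z n (lsub n) (mcv True) (mcv False) i :: 'a mpol)"
      unfolding cz using 0 weight_le_one weight_le_var[of ?w "cvar False i"] w(1)[of i] i by auto
  next
    fix e assume e: "d e \<noteq> 0"
    have s: "(\<Sum>i\<in>{2..<n}. int (f i) * (if i \<ge> 2 then x else 0)) = x * int (\<Sum>i\<in>{2..<n}. f i)" for f and x :: int
      by (simp add: sum_distrib_left mult.commute)
    show "(\<Sum>i<n. int (fst e i) * (if i \<ge> 2 then - \<epsilon> else 0)) + (\<Sum>i<n. int (snd e i) * (if i \<ge> 2 then \<epsilon> else 0)) \<le> D"
      using D[OF e] unfolding sum_lessThan_split2[OF n2] s by (simp add: algebra_simps del: of_nat_sum)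
  qed
  have W1: "weight_le (\<lambda>j. 1 * w j) 0 (\<pi> c1)"
    by (rule wt) (auto simp: c1_def heavy_def simp del: of_nat_sum split: if_splits)
  have W2: "weight_le (\<lambda>j. (- 1) * w j) (- 1) (\<pi> c2)"
    by (rule wt) (auto simp: c2_def heavy_def simp del: of_nat_sum split: if_splits)
  have disj: "keys (\<pi> c1) \<inter> keys (\<pi> c2) = {}"
  proof -
    have False if "m \<in> keys (\<pi> c1)" "m \<in> keys (\<pi> c2)" for m
    proof -
      have "weight w m \<le> 0" using W1 that unfolding weight_le_def by auto
      moreover have "- weight w m \<le> - 1" using W2 that unfolding weight_le_def by (auto simp: weight_fun_uminus)
      ultimately show False by simp
    qed
    then show ?thesis by blast
  qed
  have J': "\<pi> c \<in> frob_ideal p" using J unfolding \<pi>_def .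
  have J1: "\<pi> c1 \<in> frob_ideal p"
    unfolding frob_ideal_def
  proof (intro CollectI ballI)
    fix m assume m: "m \<in> keys (\<pi> c1)"
    then have "lookup (\<pi> c2) m = 0" using disj by (auto simp: in_keys_iff)
    then have "m \<in> keys (\<pi> c)" using m unfolding \<pi>c by (simp add: in_keys_iff lookup_add)
    then show "\<exists>i. p \<le> lookup m i" using J' unfolding frob_ideal_def by auto
  qed
  have J2: "\<pi> c2 \<in> frob_ideal p"
  proof -
    have "\<pi> c2 = \<pi> c + - \<pi> c1" unfolding \<pi>c by simp
    then show ?thesis using frob_ideal_add[OF J' frob_ideal_uminus[OF J1]] by simp
  qed
  have v1: "vanishes_on_cell n k c1"
    by (rule vanishes_on_cell_if_x_heavy[OF n k _ , where b=True])
       (use J1 in \<open>auto simp: \<pi>_def c1_def heavy_def split: if_splits\<close>)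
  \<comment> \<open>This substitution exchanges the roles of \<open>z\<^sub>0\<close> and
    \<open>x\<^sub>1\<close> as the coordinate of index \<open>0\<close>, as the mirror image
    requires. It preserves the ideal because the \<open>p\<close>-th power of \<open>lsub n\<close>
    is computed termwise.\<close>
  define X :: "nat \<Rightarrow> 'a mpol" where "X = (\<lambda>j. if j = 0 then lsub n else mvar j)"
  have X: "X 0 = lsub n" "i \<ge> 2 \<Longrightarrow> X (cvar b i) = mcv b i" for i b
    unfolding X_def using cvar_nonzero[of i b] by auto
  have Xp: "X i ^ p \<in> frob_ideal p" for i
  proof (cases "i = 0")
    case True
    have ch: "CHAR('a mpol) = p" by (rule CHAR_mpol[OF p(2)])
    have fd: "(f + g) ^ p = f ^ p + g ^ p" for f g :: "'a mpol"
      by (rule freshmans_dream) (use ch p in auto)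
    have "(mquad n :: 'a mpol) ^ p = (\<Sum>i\<in>{2..<n}. (mcv True i * mcv False i) ^ p)"
      unfolding mquad_def by (rule freshmans_dream_sum) (use ch p in auto)
    also have "\<dots> \<in> frob_ideal p"
      by (rule frob_ideal_sum) (simp only: power_mult_distrib frob_ideal_mult[OF frob_ideal_var_power])
    finally have "(mvar 0 + mquad n :: 'a mpol) ^ p \<in> frob_ideal p"
      unfolding fd by (intro frob_ideal_add frob_ideal_var_power)
    then have "(mvar 0 + mquad n :: 'a mpol) ^ p * (- 1) ^ p \<in> frob_ideal p" by (rule frob_ideal_mult)
    moreover have "(mvar 0 + mquad n :: 'a mpol) ^ p * (- 1) ^ p = (lsub n) ^ p"
      by (simp flip: power_mult_distrib)
    ultimately show ?thesis using True X(1) by simp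
  qed (simp add: X_def frob_ideal_var_power)
  have "subst_mpol mconst X (\<pi> c2) \<in> frob_ideal p" by (rule subst_frob_ideal[OF J2 Xp])
  also have "subst_mpol mconst X (\<pi> c2) = bieval mconst n (biexpo n k) c2 (cell_x (mvar 0) (mcv True)) (cell_z n (mvar 0) (mcv True) (mcv False))"
    unfolding \<pi>_def mc.subst_bieval
  proof (rule bieval_cong)
    have S: "subst_mpol mconst X (mquad n) = mquad n"
      unfolding mquad_def mc.subst_sum mc.subst_mult mc.subst_var by (intro sum.cong refl) (simp add: X)
    fix i assume i: "i < n"
    show "subst_mpol mconst X (cell_x (lsub n) (mcv True) i) = cell_x (mvar 0) (mcv True) i"
      unfolding cell_x_def by (auto simp: mc.subst_one mc.subst_uminus mc.subst_diff mc.subst_var S X)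
    show "subst_mpol mconst X (cell_z n (lsub n) (mcv True) (mcv False) i) = cell_z n (mvar 0) (mcv True) (mcv False) i"
    proof -
      have q: "(\<Sum>j\<in>{2..<n}. mcv True j * mcv False j) = (mquad n :: 'a mpol)" using sum_mcv[of True n] by simp
      show ?thesis unfolding cz unfolding cell_z_def q by (auto simp: mc.subst_one mc.subst_var X)
    qed
  qed
  also have "\<dots> = bieval mconst n (biexpo n k) (\<lambda>e. c2 (swap_exp (snd e), swap_exp (fst e)))
      (cell_x (lsub n) (mcv False)) (cell_z n (lsub n) (mcv False) (mcv True))"
    using bieval_swap_cell[OF n2, of mconst k c2 "lsub n" "mcv False" "mcv True"] sum_mcv[of False n, where 'a='a] by simp
  finally have J3: "bieval mconst n (biexpo n k) (\<lambda>e. c2 (swap_exp (snd e), swap_exp (fst e)))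
      (cell_x (lsub n) (mcv False)) (cell_z n (lsub n) (mcv False) (mcv True)) \<in> frob_ideal p" .
  have "vanishes_on_cell n k (\<lambda>e. c2 (swap_exp (snd e), swap_exp (fst e)))"
  proof (rule vanishes_on_cell_if_x_heavy[OF n k, where b=False])
    fix e assume "c2 (swap_exp (snd e), swap_exp (fst e)) \<noteq> 0"
    then have "\<not> heavy (swap_exp (snd e), swap_exp (fst e))" unfolding c2_def by auto
    then show "(\<Sum>i\<in>{2..<n}. snd e i) \<le> (\<Sum>i\<in>{2..<n}. fst e i)" unfolding heavy_def by (simp add: sum_swap_exp)
  qed (use J3 in simp)
  then have v2: "vanishes_on_cell n k c2" by (rule vanishes_on_cell_swap[OF n2])
  interpret id: coeff_hom "\<lambda>a::'a. a" by (rule coeff_hom_id)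
  show ?thesis using v1 v2 unfolding vanishes_on_cell_def cc id.bieval_add by simp
qed

subsection \<open>Arrays vanishing on the cell are multiples of \<open>\<sigma>\<close>\<close>

text \<open>Each coordinate of the cell has degree at most one in every single variable, and a
  monomial of bidegree \<open>k\<close> has \<open>2 * k\<close> factors.\<close>

lemma lookup_le_bieval_cell:
  fixes s :: "'a::comm_ring_1 mpol"
  assumes s: "\<And>j. weight_le (\<lambda>i. if i = j then 1 else 0) 1 s"
    and m: "m \<in> keys (bieval mconst n (biexpo n k) c (cell_x s (mcv True)) (cell_z n s (mcv True) (mcv False)))"
  shows "lookup m j \<le> 2 * k"
proof -
  let ?w = "\<lambda>i. if i = j then 1 else (0::int)"
  have one: "weight_le ?w 1 1" by (rule weight_le_mono[OF weight_le_one]) simp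
  have var: "weight_le ?w 1 (mvar i :: 'a mpol)" for i
    by (rule weight_le_mono[where d="?w i"]) (use weight_le_var[of ?w i] in auto)
  have mq: "weight_le ?w 1 (mquad n :: 'a mpol)"
    by (rule weight_le_mquad) (auto simp: cvar_eq_iff)
  have q: "(\<Sum>j\<in>{2..<n}. mcv True j * mcv False j) = (mquad n :: 'a mpol)" using sum_mcv[of True n] by simp
  have "weight_le ?w (int (2 * k)) (bieval mconst n (biexpo n k) c (cell_x s (mcv True)) (cell_z n s (mcv True) (mcv False)))"
  proof (rule weight_le_bieval[where a="\<lambda>_. 1" and b="\<lambda>_. 1"])
    fix i
    show "weight_le ?w 1 (cell_x s (mcv True) i)"
      unfolding cell_x_def using one s var by auto
    have "weight_le ?w 1 (- (s + mquad n))" by (intro weight_le_uminus weight_le_add s mq)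
    then show "weight_le ?w 1 (cell_z n s (mcv True) (mcv False) i)"
      unfolding cell_z_def q using one var by (auto simp del: minus_add_distrib)
  next
    fix e assume "e \<in> biexpo n k"
    then show "(\<Sum>i<n. int (fst e i) * 1) + (\<Sum>i<n. int (snd e i) * 1) \<le> int (2 * k)"
      by (simp add: sum_expo flip: of_nat_sum)
  qed
  then have "weight ?w m \<le> int (2 * k)" using m unfolding weight_le_def by blast
  then show ?thesis unfolding weight_indicator by simp
qed

lemma indicator_weight_mvar: "weight_le (\<lambda>i. if i = j then 1 else 0) 1 (mvar i)"
  by (rule weight_le_mono[where d="if i = j then 1 else 0"]) (use weight_le_var[of "\<lambda>i. if i = j then 1 else 0" i] in auto)

lemma indicator_weight_lsub: "weight_le (\<lambda>i. if i = j then 1 else 0) 1 (lsub n)"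
  by (intro weight_le_uminus weight_le_add indicator_weight_mvar weight_le_mquad) (auto simp: cvar_eq_iff)

text \<open>Modulo \<open>\<sigma>\<close> every array can be brought to a form without monomials divisible by \<open>x\<^sub>0 z\<^sub>0\<close>. On such
  arrays restriction to the cell is injective: the degree in \<open>x\<^sub>1, \<dots>, x\<^sub>n\<^sub>-\<^sub>1\<close> after the substitution
  separates the powers of \<open>z\<^sub>0\<close>.\<close>

lemma vanishes_on_cell_normal_form:
  fixes c :: "_ \<Rightarrow> 'a::{field,finite}"
  assumes n: "n \<ge> 3" and k: "2 * k < CARD('a) - 1" and v: "vanishes_on_cell n k c"
    and nf: "\<And>e. e \<in> biexpo n k \<Longrightarrow> c e \<noteq> 0 \<Longrightarrow> fst e 0 = 0 \<or> snd e 0 = 0"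
    and e: "e \<in> biexpo n k"
  shows "c e = 0"
proof (rule ccontr)
  assume ce: "c e \<noteq> 0"
  have n2: "n \<ge> 2" using n by simp
  interpret id: coeff_hom "\<lambda>a::'a. a" by (rule coeff_hom_id)
  interpret mc: coeff_hom "mconst :: 'a \<Rightarrow> _" by (rule coeff_hom_mconst)
  let ?\<xi> = "cell_x (mvar 0 :: 'a mpol) (mcv True)" and ?\<zeta> = "cell_z n (mvar 0 :: 'a mpol) (mcv True) (mcv False)"
  define P where "P = bieval mconst n (biexpo n k) c ?\<xi> ?\<zeta>"
  have q: "(\<Sum>j\<in>{2..<n}. mcv True j * mcv False j) = (mquad n :: 'a mpol)" using sum_mcv[of True n] by simp
  have P0: "P = 0"
  proof (rule mpol_eq_0_if_vanishing)
    fix m i assume "m \<in> keys P"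
    then have "lookup m i \<le> 2 * k" unfolding P_def by (rule lookup_le_bieval_cell[OF indicator_weight_mvar])
    then show "lookup m i < CARD('a) - 1" using k by simp
  next
    fix x :: "nat \<Rightarrow> 'a"
    define y z where "y = (\<lambda>i. x (cvar True i))" and "z = (\<lambda>i. x (cvar False i))"
    have "subst_mpol (\<lambda>a. a) x P = beval n (biexpo n k) c (cell_x (x 0) y) (cell_z n (x 0) y z)"
      unfolding P_def id.subst_bieval
    proof (rule bieval_cong)
      fix i
      show "subst_mpol (\<lambda>a. a) x (?\<xi> i) = cell_x (x 0) y i"
        unfolding cell_x_def y_def by (simp add: id.subst_one id.subst_var)
      have "subst_mpol (\<lambda>a. a) x (mquad n) = (\<Sum>j\<in>{2..<n}. y j * z j)"
        unfolding mquad_def y_def z_def by (simp add: id.subst_sum id.subst_mult id.subst_var)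
      then show "subst_mpol (\<lambda>a. a) x (?\<zeta> i) = cell_z n (x 0) y z i"
        unfolding cell_z_def q z_def by (simp add: id.subst_one id.subst_var id.subst_diff id.subst_uminus)
    qed
    then show "subst_mpol (\<lambda>a. a) x P = 0" using v unfolding vanishes_on_cell_def by simp
  qed
  define E where "E = (\<lambda>b. {e \<in> biexpo n k. snd e 0 = b \<and> c e \<noteq> 0})"
  have finE: "finite (E b)" for b unfolding E_def by auto
  define T where "T = (\<lambda>b. bieval mconst n (E b) c ?\<xi> ?\<zeta>)"
  have sumT: "(\<Sum>b\<le>k. T b) = 0"
  proof -
    have "(\<Sum>b\<le>k. T b) = (\<Sum>b\<le>k. \<Sum>e\<in>{e \<in> {e\<in>biexpo n k. c e \<noteq> 0}. snd e 0 = b}. mconst (c e) * (power_prod n ?\<xi> (fst e) * power_prod n ?\<zeta> (snd e)))"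
      unfolding T_def bieval_def E_def by (intro sum.cong refl) auto
    also have "\<dots> = (\<Sum>e\<in>{e\<in>biexpo n k. c e \<noteq> 0}. mconst (c e) * (power_prod n ?\<xi> (fst e) * power_prod n ?\<zeta> (snd e)))"
      by (rule sum.group) (auto simp: biexpo_def intro: expo_le)
    also have "\<dots> = P" unfolding P_def bieval_def
      by (rule sum.mono_neutral_left) (auto simp: mconst_def)
    finally show ?thesis using P0 by simp
  qed
  \<comment> \<open>The weight counts the degree in the \<open>x\<^sub>i\<close> with
    \<open>i \<ge> 1\<close>, and \<open>z\<^sub>0\<close> acquires weight one. For
    \<open>b > 0\<close> the normal form excludes \<open>x\<^sub>0\<close>, so \<open>T b\<close> is
    homogeneous of weight \<open>k + b\<close>, while \<open>T 0\<close> has weight at most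
    \<open>k\<close>. Hence different groups cannot cancel.\<close>
  define w :: "nat \<Rightarrow> int" where "w = (\<lambda>j. if j = 0 \<or> (\<exists>i\<in>{2..<n}. j = cvar True i) then 1 else 0)"
  have w: "w 0 = 1" "i \<in> {2..<n} \<Longrightarrow> w (cvar True i) = 1" "i \<in> {2..<n} \<Longrightarrow> w (cvar False i) = 0" for i
    using cvar_nonzero[of i False] unfolding w_def by (auto simp: cvar_eq_iff)
  have wT: "weight_le (\<lambda>j. \<epsilon> * w j) D (T b)"
    if D: "\<And>e. e \<in> E b \<Longrightarrow> \<epsilon> * int (fst e 1 + (\<Sum>i\<in>{2..<n}. fst e i) + b) \<le> D" for \<epsilon> D b
    unfolding T_def
  proof (rule weight_le_bieval[where a="\<lambda>i. if i = 0 then 0 else \<epsilon>" and b="\<lambda>i. if i = 0 then \<epsilon> else 0"])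
    let ?w = "\<lambda>j. \<epsilon> * w j"
    have 0: "weight_le ?w \<epsilon> (mvar 0 :: 'a mpol)" using weight_le_var[of ?w 0] by (simp add: w)
    have S: "weight_le ?w \<epsilon> (lsub n :: 'a mpol)"
      by (intro weight_le_uminus weight_le_add 0 weight_le_mquad) (simp add: w)
    fix i assume i: "i < n"
    show "weight_le ?w (if i = 0 then 0 else \<epsilon>) (?\<xi> i)"
      unfolding cell_x_def using 0 weight_le_one weight_le_var[of ?w "cvar True i"] w(2)[of i] i by auto
    show "weight_le ?w (if i = 0 then \<epsilon> else 0) (?\<zeta> i)"
      unfolding cell_z_def q using S weight_le_one weight_le_var[of ?w "cvar False i"] w(3)[of i] i by auto
  next
    fix e assume e: "e \<in> E b"
    have "(\<Sum>i<n. int (fst e i) * (if i = 0 then 0 else \<epsilon>)) + (\<Sum>i<n. int (snd e i) * (if i = 0 then \<epsilon> else 0))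
        = \<epsilon> * int (fst e 1 + (\<Sum>i\<in>{2..<n}. fst e i) + b)"
      using e unfolding sum_lessThan_split2[OF n2] E_def by (simp add: sum_distrib_left algebra_simps)
    then show "(\<Sum>i<n. int (fst e i) * (if i = 0 then 0 else \<epsilon>)) + (\<Sum>i<n. int (snd e i) * (if i = 0 then \<epsilon> else 0)) \<le> D"
      using D[OF e] by simp
  qed
  have deg: "fst e 0 + fst e 1 + (\<Sum>i\<in>{2..<n}. fst e i) = k" if "e \<in> biexpo n k" for e
    using sum_expo(1)[OF that] unfolding sum_lessThan_split2[OF n2] by simp
  have degT: "weight w m = int (k + b)" if b: "b > 0" and m: "m \<in> keys (T b)" for b m
  proof -
    have D: "fst e 1 + (\<Sum>i\<in>{2..<n}. fst e i) + b = k + b" if "e \<in> E b" for e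
      using deg[of e] nf[of e] that b unfolding E_def by auto
    have "weight_le (\<lambda>j. 1 * w j) (int (k + b)) (T b)" by (rule wT) (simp only: D mult_1)
    moreover have "weight_le (\<lambda>j. (- 1) * w j) (- int (k + b)) (T b)" by (rule wT) (simp only: D mult_minus1)
    ultimately have "weight (\<lambda>j. 1 * w j) m \<le> int (k + b)" "weight (\<lambda>j. (- 1) * w j) m \<le> - int (k + b)"
      using m unfolding weight_le_def by (blast, blast)
    then show ?thesis by (simp add: weight_fun_uminus)
  qed
  have degT0: "weight w m \<le> int k" if m: "m \<in> keys (T 0)" for m
  proof -
    have "weight_le (\<lambda>j. 1 * w j) (int k) (T 0)"
    proof (rule wT)
      fix e assume "e \<in> E 0"
      then have "fst e 1 + (\<Sum>i\<in>{2..<n}. fst e i) + 0 \<le> k" using deg[of e] unfolding E_def by auto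
      then show "1 * int (fst e 1 + (\<Sum>i\<in>{2..<n}. fst e i) + 0) \<le> int k" by (simp del: of_nat_sum of_nat_add)
    qed
    then show ?thesis using m unfolding weight_le_def by auto
  qed
  have Tpos: "T b = 0" if b: "0 < b" "b \<le> k" for b
  proof (rule poly_mapping_eqI)
    fix m
    show "lookup (T b) m = lookup 0 m"
    proof (rule ccontr)
      assume "lookup (T b) m \<noteq> lookup 0 m"
      then have m: "m \<in> keys (T b)" by (simp add: in_keys_iff)
      have "lookup (T b') m = 0" if "b' \<noteq> b" for b'
      proof (rule ccontr)
        assume "lookup (T b') m \<noteq> 0"
        then have m': "m \<in> keys (T b')" by (simp add: in_keys_iff)
        show False
        proof (cases "b' = 0")
          case True
          then show False using degT0[of m] m' degT[OF b(1) m] b by simp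
        next
          case False
          then show False using degT[of b' m] m' degT[OF b(1) m] that by simp
        qed
      qed
      then have "(\<Sum>b'\<le>k. lookup (T b') m) = lookup (T b) m"
        using b by (subst sum.remove[of _ b]) (auto intro!: sum.neutral)
      then show False using sumT m by (simp add: lookup_sum[symmetric] in_keys_iff)
    qed
  qed
  have T0: "T b = 0" if "b \<le> k" for b
  proof (cases "b = 0")
    case True
    have "(\<Sum>b\<le>k. T b) = T 0" by (subst sum.remove[of _ 0]) (auto intro!: sum.neutral Tpos)
    then show ?thesis using True sumT by simp
  qed (use Tpos that in auto)
  define b where "b = snd e 0"
  have eE: "e \<in> E b" unfolding E_def b_def using e ce by simp
  have "b \<le> k" unfolding b_def using e expo_le[of "snd e" n k 0] unfolding biexpo_def by auto
  \<comment> \<open>Within a group the exponent of \<open>z\<^sub>0\<close> is constant, so its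
    power splits off as a nonzero factor; the entry \<open>1\<close> at index \<open>0\<close>
    stands for what remains.\<close>
  define \<zeta>' where "\<zeta>' = (\<lambda>i. if i \<le> 1 then 1 else mcv False i :: 'a mpol)"
  define g where "g = bieval mconst n (E b) c ?\<xi> \<zeta>'"
  have "T b = (lsub n) ^ b * g"
    unfolding T_def g_def bieval_def sum_distrib_left
  proof (intro sum.cong refl)
    fix e assume "e \<in> E b"
    then have b: "snd e 0 = b" unfolding E_def by simp
    have "power_prod n ?\<zeta> (snd e) = ?\<zeta> 0 ^ snd e 0 * (\<Prod>i\<in>{..<n} - {0}. ?\<zeta> i ^ snd e i)"
      unfolding power_prod_def by (rule prod.remove) (use n in auto)
    also have "?\<zeta> 0 = lsub n" unfolding cell_z_def q by simp
    also have "(\<Prod>i\<in>{..<n} - {0}. ?\<zeta> i ^ snd e i) = (\<Prod>i\<in>{..<n} - {0}. \<zeta>' i ^ snd e i)"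
      by (intro prod.cong refl) (auto simp: cell_z_def \<zeta>'_def)
    also have "\<dots> = power_prod n \<zeta>' (snd e)"
      unfolding power_prod_def using prod.remove[of "{..<n}" 0 "\<lambda>i. \<zeta>' i ^ snd e i"] n by (auto simp: \<zeta>'_def)
    finally show "mconst (c e) * (power_prod n ?\<xi> (fst e) * power_prod n ?\<zeta> (snd e)) = (lsub n) ^ b * (mconst (c e) * (power_prod n ?\<xi> (fst e) * power_prod n \<zeta>' (snd e)))"
      unfolding b by (simp only: mult_ac)
  qed
  moreover have "lsub n \<noteq> (0 :: 'a mpol)"
  proof
    let ?x = "\<lambda>j. if j = 0 then 1 else (0::'a)"
    assume z: "lsub n = (0 :: 'a mpol)"
    have "subst_mpol (\<lambda>a. a) ?x (mquad n) = 0"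
      unfolding mquad_def id.subst_sum id.subst_mult id.subst_var
      by (intro sum.neutral) (auto dest: cvar_nonzero[of _ True] simp: cvar_nonzero)
    then have "subst_mpol (\<lambda>a. a) ?x (lsub n) = - 1"
      by (simp add: id.subst_uminus id.subst_diff id.subst_var)
    then show False unfolding z id.subst_zero by simp
  qed
  ultimately have g0: "g = 0" using T0[OF \<open>b \<le> k\<close>] by simp
  \<comment> \<open>The exponents of \<open>x\<^sub>0\<close> and \<open>z\<^sub>1\<close>, both set
    to one on the cell, are recovered from the bidegree once \<open>b\<close> and the exponents over
    \<open>I\<close> are known.\<close>
  define I where "I = Pair True ` {1..<n} \<union> Pair False ` {2..<n}"
  define ex where "ex = (\<lambda>(e::(nat \<Rightarrow> nat) \<times> (nat \<Rightarrow> nat)) j. if fst j then fst e (snd j) else snd e (snd j))"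
  have "c e = 0"
  proof (rule monomials_independent_finite_field[of I "E b" ex c])
    show "finite I" unfolding I_def by auto
    show "ex e i < CARD('a) - 1" if "e \<in> E b" for e i
    proof -
      have "ex e i \<le> k" using that expo_le[of "fst e" n k "snd i"] expo_le[of "snd e" n k "snd i"]
        unfolding E_def biexpo_def ex_def by auto
      then show ?thesis using k by simp
    qed
    show "e1 = e2" if e1: "e1 \<in> E b" and e2: "e2 \<in> E b" and eq: "\<And>i. i \<in> I \<Longrightarrow> ex e1 i = ex e2 i" for e1 e2
    proof -
      have f: "fst e1 i = fst e2 i" if "1 \<le> i" "i < n" for i
        using eq[of "(True, i)"] that unfolding I_def ex_def by auto
      have s: "snd e1 i = snd e2 i" if "2 \<le> i" "i < n" for i
        using eq[of "(False, i)"] that unfolding I_def ex_def by auto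
      have sf: "(\<Sum>i\<in>{2..<n}. fst e1 i) = (\<Sum>i\<in>{2..<n}. fst e2 i)" by (intro sum.cong refl f) auto
      have ss: "(\<Sum>i\<in>{2..<n}. snd e1 i) = (\<Sum>i\<in>{2..<n}. snd e2 i)" by (intro sum.cong refl s) auto
      have E: "e1 \<in> biexpo n k" "e2 \<in> biexpo n k" "snd e1 0 = snd e2 0" using e1 e2 unfolding E_def by auto
      have f0: "fst e1 0 = fst e2 0" using deg[OF E(1)] deg[OF E(2)] sf f[of 1] n by simp
      have s1: "snd e1 1 = snd e2 1"
        using sum_expo(2)[OF E(1)] sum_expo(2)[OF E(2)] ss E(3) unfolding sum_lessThan_split2[OF n2] by simp
      have o: "fst e1 i = fst e2 i" "snd e1 i = snd e2 i" if "i \<ge> n" for i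
        using E(1,2) that unfolding biexpo_def expo_def by auto
      have "fst e1 i = fst e2 i" for i using f[of i] f0 o(1)[of i] by (cases "i = 0"; cases "i < n") auto
      moreover have "snd e1 i = snd e2 i" for i
        using s[of i] s1 E(3) o(2)[of i] by (cases "i = 0"; cases "i = 1"; cases "i < n") auto
      ultimately show ?thesis by (auto simp: prod_eq_iff fun_eq_iff)
    qed
    show "(\<Sum>e\<in>E b. c e * (\<Prod>i\<in>I. x i ^ ex e i)) = 0" for x
    proof -
      define pt where "pt = (\<lambda>j. if j = 0 then x (True, 1) else x (odd j, j div 2))"
      have pt: "pt (cvar b i) = x (b, i)" if "2 \<le> i" for b i
      proof -
        have "odd (cvar b i) = b" "cvar b i div 2 = i" by (simp_all add: cvar_def)
        then show ?thesis using cvar_nonzero[OF that, of b] unfolding pt_def by simp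
      qed
      have "0 = subst_mpol (\<lambda>a. a) pt g" unfolding g0 by (rule id.subst_zero[symmetric])
      also have "\<dots> = (\<Sum>e\<in>E b. c e * (power_prod n (\<lambda>i. subst_mpol (\<lambda>a. a) pt (?\<xi> i)) (fst e) * power_prod n (\<lambda>i. subst_mpol (\<lambda>a. a) pt (\<zeta>' i)) (snd e)))"
        unfolding g_def id.subst_bieval unfolding bieval_def ..
      also have "\<dots> = (\<Sum>e\<in>E b. c e * (\<Prod>i\<in>I. x i ^ ex e i))"
      proof (intro sum.cong refl arg_cong2[where f="(*)"])
        fix e :: "(nat \<Rightarrow> nat) \<times> (nat \<Rightarrow> nat)"
        have n1: "{..<n} = insert 0 {1..<n}" "{..<n} = insert 0 (insert 1 {2..<n})" using n by auto
        have "power_prod n (\<lambda>i. subst_mpol (\<lambda>a. a) pt (?\<xi> i)) (fst e) = (\<Prod>i\<in>{1..<n}. x (True, i) ^ fst e i)"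
        proof -
          have "subst_mpol (\<lambda>a. a) pt (?\<xi> i) = x (True, i)" if "i \<in> {1..<n}" for i
            using that pt[of i True] unfolding cell_x_def by (auto simp: id.subst_var pt_def)
          moreover have "subst_mpol (\<lambda>a. a) pt (?\<xi> 0) = 1" unfolding cell_x_def by (simp add: id.subst_one)
          ultimately show ?thesis unfolding power_prod_def n1(1) by simp
        qed
        moreover have "power_prod n (\<lambda>i. subst_mpol (\<lambda>a. a) pt (\<zeta>' i)) (snd e) = (\<Prod>i\<in>{2..<n}. x (False, i) ^ snd e i)"
        proof -
          have "subst_mpol (\<lambda>a. a) pt (\<zeta>' i) = x (False, i)" if "i \<in> {2..<n}" for i
            using that pt[of i False] unfolding \<zeta>'_def by (auto simp: id.subst_var)
          moreover have "subst_mpol (\<lambda>a. a) pt (\<zeta>' i) = 1" if "i \<le> 1" for i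
            using that unfolding \<zeta>'_def by (simp add: id.subst_one)
          ultimately show ?thesis unfolding power_prod_def n1(2) by simp
        qed
        moreover have "(\<Prod>i\<in>I. x i ^ ex e i) = (\<Prod>i\<in>{1..<n}. x (True, i) ^ fst e i) * (\<Prod>i\<in>{2..<n}. x (False, i) ^ snd e i)"
          unfolding I_def by (subst prod.union_disjoint) (auto simp: prod.reindex inj_on_def ex_def)
        ultimately show "power_prod n (\<lambda>i. subst_mpol (\<lambda>a. a) pt (?\<xi> i)) (fst e) * power_prod n (\<lambda>i. subst_mpol (\<lambda>a. a) pt (\<zeta>' i)) (snd e) = (\<Prod>i\<in>I. x i ^ ex e i)"
          by simp
      qed
      finally show ?thesis by simp
    qed
  qed (use finE eE in auto)
  then show False using ce by contradiction
qed

text \<open>Counting replaces division by \<open>\<sigma>\<close>. An array vanishing on the cell is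
  determined by its coefficients at monomials divisible by \<open>x\<^sub>0 z\<^sub>0\<close>, by
  the normal form lemma, so there are at most as many such arrays as multiples of
  \<open>\<sigma>\<close>; and the multiples do vanish there.\<close>

theorem vanishes_on_cell_imp_multiple_of_sigma:
  fixes c :: "_ \<Rightarrow> 'a::{field,finite}"
  assumes n: "n \<ge> 3" and k: "2 * k < CARD('a) - 1"
    and c: "c \<in> fspace (biexpo n k)" "vanishes_on_cell n k c"
  shows "c \<in> mult_sigma n ` fspace (biexpo_pred n k)"
proof -
  define N where "N = {c :: _ \<Rightarrow> 'a. c \<in> fspace (biexpo n k) \<and> vanishes_on_cell n k c}"
  define S where "S = mult_sigma n ` (fspace (biexpo_pred n k) :: (_ \<Rightarrow> 'a) set)"
  define \<phi> where "\<phi> = (\<lambda>(c :: _ \<Rightarrow> 'a) e. if e \<in> biexpo_pred n k then c (inc2 e 0) else 0)"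
  have finN: "finite N" unfolding N_def by (rule finite_subset[OF _ finite_fspace[of "biexpo n k"]]) auto
  have SN: "S \<subseteq> N"
  proof
    fix d assume "d \<in> S"
    then obtain d' where d: "d = mult_sigma n d'" "d' \<in> fspace (biexpo_pred n k)" unfolding S_def by (elim imageE)
    have "vanishes_on_cell n k d"
      unfolding vanishes_on_cell_def d(1) beval_mult_sigma using n by (simp add: cell_on_quadric)
    then show "d \<in> N" unfolding N_def using mult_sigma_in[OF d(2)] d(1) by simp
  qed
  have inj: "inj_on \<phi> N"
  proof (rule inj_onI)
    fix c d assume cN: "c \<in> N" and dN: "d \<in> N" and eq: "\<phi> c = \<phi> d"
    have v: "vanishes_on_cell n k (\<lambda>e. c e - d e)"
      using cN dN unfolding N_def vanishes_on_cell_def bieval_def by (simp add: left_diff_distrib sum_subtractf)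
    have z: "c e - d e = 0" if e: "e \<in> biexpo n k" for e
    proof (rule vanishes_on_cell_normal_form[OF n k v _ e])
      fix e assume e: "e \<in> biexpo n k" and ne: "c e - d e \<noteq> 0"
      show "fst e 0 = 0 \<or> snd e 0 = 0"
      proof (rule ccontr)
        assume "\<not> (fst e 0 = 0 \<or> snd e 0 = 0)"
        then have pos: "fst e 0 > 0" "snd e 0 > 0" by simp_all
        have "dec2 e 0 \<in> biexpo_pred n k" using dec2_in_biexpo_pred_iff[of 0 n e k] pos e n by simp
        then have "\<phi> c (dec2 e 0) = c e" "\<phi> d (dec2 e 0) = d e"
          unfolding \<phi>_def by (simp_all add: inc2_dec2[OF pos])
        then show False using ne eq by simp
      qed
    qed
    show "c = d"
    proof
      fix e
      show "c e = d e"
      proof (cases "e \<in> biexpo n k")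
        case True
        then show ?thesis using z[of e] by simp
      next
        case False
        then have "c e = 0" "d e = 0" using cN dN unfolding N_def by (auto intro: fspaceD)
        then show ?thesis by simp
      qed
    qed
  qed
  have "\<phi> ` N \<subseteq> fspace (biexpo_pred n k)" unfolding \<phi>_def fspace_def by auto
  then have "card N \<le> card (fspace (biexpo_pred n k) :: (_ \<Rightarrow> 'a) set)"
    by (rule card_inj_on_le[OF inj]) (rule finite_fspace, simp)
  also have "\<dots> = card S"
    unfolding S_def using n by (simp add: card_mult_sigma_image card_fspace)
  finally have "S = N" by (rule card_seteq[OF finN SN])
  then show ?thesis using c unfolding N_def S_def by blast
qed

section \<open>Independence of the twisted products as functions on the quadric\<close>

lemma weight_le_frob_prod:
  assumes "\<And>i. weight_le w (2 * (int p - 1)) (f i)"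
  shows "weight_le w (2 * (int p ^ length l - 1)) (frob_prod p f l)"
proof (induction l)
  case Nil
  show ?case using weight_le_one by simp
next
  case (Cons i l)
  have "weight_le w (2 * (int p - 1) + int p * (2 * (int p ^ length l - 1))) (f i * frob_prod p f l ^ p)"
    by (rule weight_le_mult[OF assms weight_le_power[OF Cons]])
  then show ?case by (simp add: algebra_simps)
qed

lemma (in coeff_hom) subst_frob_prod:
  "subst_mpol \<iota> x (frob_prod p f l) = frob_prod p (\<lambda>i. subst_mpol \<iota> x (f i)) l"
  by (induction l) (simp_all add: subst_one subst_mult subst_power)

text \<open>On the cell a relation between functions is a relation between polynomials, because the
  exponents are at most \<open>2 * (p ^ t - 1)\<close> and thus small enough to be determined by
  values. The polynomial relation falls to the independence modulo \<open>p\<close>-th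
  powers.\<close>

theorem frob_prod_independent_on_quadric:
  fixes c :: "'i \<Rightarrow> _ \<Rightarrow> 'a::{field,finite}"
  assumes p: "prime p" "CARD('a) = p ^ (2 * t)" "t \<ge> 1" and n: "n \<ge> 3" and I: "finite I"
    and ind: "\<And>a. vanishes_on_cell n (p - 1) (\<lambda>e. \<Sum>i\<in>I. a i * c i e) \<Longrightarrow> \<forall>i\<in>I. a i = 0"
    and 0: "\<And>x z. x \<in> fspace {..<n} \<Longrightarrow> z \<in> fspace {..<n} \<Longrightarrow> (\<Sum>i<n. x i * z i) = 0 \<Longrightarrow>
      (\<Sum>l\<in>lists_of I t. lm l * frob_prod p (\<lambda>i. beval n (biexpo n (p - 1)) (c i) x z) l) = 0"
    and l: "l \<in> lists_of I t"
  shows "lm l = 0"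
proof -
  have CH: "CHAR('a) = p" by (rule finite_field_CHAR[OF p(1,2)])
  interpret id: coeff_hom "\<lambda>a::'a. a" by (rule coeff_hom_id)
  interpret mc: coeff_hom "mconst :: 'a \<Rightarrow> _" by (rule coeff_hom_mconst)
  let ?\<xi> = "cell_x (lsub n :: 'a mpol) (mcv True)" and ?\<zeta> = "cell_z n (lsub n :: 'a mpol) (mcv True) (mcv False)"
  define f where "f = (\<lambda>i. bieval mconst n (biexpo n (p - 1)) (c i) ?\<xi> ?\<zeta>)"
  define G where "G = (\<Sum>l\<in>lists_of I t. mconst (lm l) * frob_prod p f l)"
  have p2: "p \<ge> 2" using p(1) by (rule prime_ge_2_nat)
  have q: "(\<Sum>j\<in>{2..<n}. mcv True j * mcv False j) = (mquad n :: 'a mpol)" using sum_mcv[of True n] by simp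
  have "G = 0"
  proof (rule mpol_eq_0_if_vanishing)
    fix m :: "nat \<Rightarrow>\<^sub>0 nat" and j :: nat assume m: "m \<in> keys G"
    let ?w = "\<lambda>i. if i = j then 1 else (0::int)"
    have wf: "weight_le ?w (2 * (int p - 1)) (f i)" for i
      unfolding weight_le_def
    proof
      fix m assume "m \<in> keys (f i)"
      then have "lookup m j \<le> 2 * (p - 1)" unfolding f_def by (rule lookup_le_bieval_cell[OF indicator_weight_lsub])
      then show "weight ?w m \<le> 2 * (int p - 1)" unfolding weight_indicator using p2 by simp
    qed
    have "weight_le ?w (2 * (int p ^ t - 1)) G"
      unfolding G_def
    proof (rule weight_le_sum)
      fix l assume "l \<in> lists_of I t"
      then have l: "length l = t" unfolding lists_of_def by simp
      have "weight_le ?w (0 + 2 * (int p ^ length l - 1)) (mconst (lm l) * frob_prod p f l)"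
        by (rule weight_le_mult[OF weight_le_const weight_le_frob_prod[OF wf]])
      then show "weight_le ?w (2 * (int p ^ t - 1)) (mconst (lm l) * frob_prod p f l)" unfolding l by simp
    qed
    then have "int (lookup m j) \<le> 2 * (int p ^ t - 1)"
      using m unfolding weight_le_def weight_indicator by blast
    \<comment> \<open>The inequality amounts to \<open>(p ^ t - 1)\<^sup>2 > 0\<close>.\<close>
    moreover have "2 * (int p ^ t - 1) < int (p ^ (2 * t)) - 1"
    proof -
      have P: "int p ^ t \<ge> 2" using p2 p(3) self_le_power[of p t] by (simp flip: of_nat_power)
      have "0 < (int p ^ t - 1) * (int p ^ t - 1)" using P by simp
      moreover have "(int p ^ t - 1) * (int p ^ t - 1) = int p ^ t * int p ^ t - 2 * int p ^ t + 1"
        by (simp only: left_diff_distrib right_diff_distrib mult_1 mult_1_right)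
      moreover have "int (p ^ (2 * t)) = int p ^ t * int p ^ t"
        by (simp only: of_nat_power of_nat_mult mult_2 power_add)
      ultimately have "2 * int p ^ t < int (p ^ (2 * t)) + 1" by (simp only: diff_add_eq diff_gt_0_iff_gt)
      then show ?thesis by simp
    qed
    ultimately show "lookup m j < CARD('a) - 1" unfolding p(2) by linarith
  next
    fix x :: "nat \<Rightarrow> 'a"
    define y z where "y = (\<lambda>i. x (cvar True i))" and "z = (\<lambda>i. x (cvar False i))"
    \<comment> \<open>The variable of index \<open>0\<close> carries \<open>z\<^sub>0\<close>, so
      the parameter \<open>x\<^sub>1 = s\<close> of the cell is computed from it.\<close>
    define s where "s = - (x 0 + (\<Sum>j\<in>{2..<n}. y j * z j))"
    define xi ze where "xi = (\<lambda>i. if i < n then cell_x s y i else 0)" and "ze = (\<lambda>i. if i < n then cell_z n s y z i else 0)"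
    have S: "subst_mpol (\<lambda>a. a) x (mquad n) = (\<Sum>j\<in>{2..<n}. y j * z j)"
      unfolding mquad_def y_def z_def by (simp add: id.subst_sum id.subst_mult id.subst_var)
    have s: "subst_mpol (\<lambda>a. a) x (lsub n) = s"
      unfolding s_def by (simp add: id.subst_uminus id.subst_diff id.subst_var S)
    have z0: "- (s + (\<Sum>j\<in>{2..<n}. y j * z j)) = x 0" unfolding s_def by simp
    have ev: "subst_mpol (\<lambda>a. a) x (f i) = beval n (biexpo n (p - 1)) (c i) xi ze" for i
      unfolding f_def id.subst_bieval
    proof (rule bieval_cong)
      fix i assume i: "i < n"
      show "subst_mpol (\<lambda>a. a) x (?\<xi> i) = xi i"
        unfolding cell_x_def xi_def by (simp add: i id.subst_one id.subst_var s y_def del: minus_add_distrib)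
      show "subst_mpol (\<lambda>a. a) x (?\<zeta> i) = ze i"
        unfolding cell_z_def q ze_def
        by (simp add: i z0 id.subst_one id.subst_var id.subst_add id.subst_uminus s S del: minus_add_distrib) (simp add: z_def)
    qed
    have "subst_mpol (\<lambda>a. a) x G = (\<Sum>l\<in>lists_of I t. lm l * frob_prod p (\<lambda>i. beval n (biexpo n (p - 1)) (c i) xi ze) l)"
      unfolding G_def id.subst_sum id.subst_mult id.subst_const id.subst_frob_prod ev ..
    also have "\<dots> = 0"
    proof (rule 0)
      show "xi \<in> fspace {..<n}" "ze \<in> fspace {..<n}" unfolding xi_def ze_def fspace_def by auto
      have "(\<Sum>i<n. xi i * ze i) = (\<Sum>i<n. cell_x s y i * cell_z n s y z i)"
        by (intro sum.cong refl) (simp add: xi_def ze_def)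
      then show "(\<Sum>i<n. xi i * ze i) = 0" using cell_on_quadric[of n s y z] n by simp
    qed
    finally show "subst_mpol (\<lambda>a. a) x G = 0" .
  qed
  have pp: "p - 1 < p" using p2 by simp
  have G0: "(\<Sum>l\<in>lists_of I t. mconst (lm l) * frob_prod p f l) = 0" using \<open>G = 0\<close> unfolding G_def .
  show ?thesis
  proof (rule frob_prod_independent[where e="2 * t" and f=f and t=t and I=I and c=lm and l=l, OF p(1,2) _ I _ G0 l])
    show "2 * t \<ge> 1" using p(3) by simp
    fix a assume "(\<Sum>i\<in>I. mconst (a i) * f i) \<in> frob_ideal p"
    then have "bieval mconst n (biexpo n (p - 1)) (\<lambda>e. \<Sum>i\<in>I. a i * c i e) ?\<xi> ?\<zeta> \<in> frob_ideal p"
      unfolding f_def mc.bieval_lincomb .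
    then have "vanishes_on_cell n (p - 1) (\<lambda>e. \<Sum>i\<in>I. a i * c i e)"
      by (rule vanishes_on_cell_if_frob_ideal[OF n pp p(1) CH])
    then show "\<forall>i\<in>I. a i = 0" by (rule ind)
  qed
qed

section \<open>The kernel on the quadric\<close>

text \<open>A vector \<open>v\<close> of \<open>V\<close> gives the pair \<open>(crd v, dcrd v)\<close>, which lies on the quadric if \<open>v\<close> is singular.
  The kernel of two such pairs is \<open>(h v w * h w v)\<^sup>k\<close>.\<close>

definition quadric :: "nat \<Rightarrow> ((nat \<Rightarrow> 'a::comm_ring_1) \<times> (nat \<Rightarrow> 'a)) set" where
  "quadric n = {(x, z). x \<in> fspace {..<n} \<and> z \<in> fspace {..<n} \<and> (\<Sum>i<n. x i * z i) = 0}"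

definition kernel :: "nat \<Rightarrow> nat \<Rightarrow> (nat \<Rightarrow> 'a) \<times> (nat \<Rightarrow> 'a) \<Rightarrow> (nat \<Rightarrow> 'a) \<times> (nat \<Rightarrow> 'a) \<Rightarrow> 'a::comm_ring_1" where
  "kernel n k v w = ((\<Sum>i<n. fst v i * snd w i) * (\<Sum>i<n. snd v i * fst w i)) ^ k"

lemma kernel_commute: "kernel n k v w = kernel n k w v"
  unfolding kernel_def by (simp add: mult.commute)

lemma quadric_swap: "(x, z) \<in> quadric n \<Longrightarrow> (z, x) \<in> quadric n"
  unfolding quadric_def by (auto simp: mult.commute)

lemma finite_quadric: "finite (quadric n :: ((nat \<Rightarrow> 'a::{field,finite}) \<times> (nat \<Rightarrow> 'a)) set)"
  by (rule finite_subset[of _ "fspace {..<n} \<times> fspace {..<n}"]) (auto simp: quadric_def finite_fspace)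

context
  fixes p n k :: nat
  assumes p: "prime p" and n: "n \<ge> 3" and k: "k < p"
begin

lemma vanishes_on_quadric_iff:
  fixes c :: "_ \<Rightarrow> 'a::{field,finite}"
  assumes card: "2 * k < CARD('a) - 1" and c: "c \<in> fspace (biexpo n k)"
  shows "(\<forall>v\<in>quadric n. beval n (biexpo n k) c (fst v) (snd v) = 0) \<longleftrightarrow> c \<in> mult_sigma n ` fspace (biexpo_pred n k)"
proof
  assume v: "\<forall>v\<in>quadric n. beval n (biexpo n k) c (fst v) (snd v) = 0"
  show "c \<in> mult_sigma n ` fspace (biexpo_pred n k)"
  proof (rule vanishes_on_cell_imp_multiple_of_sigma[OF n card c], unfold vanishes_on_cell_def, intro allI)
    fix s y z
    define xi ze where "xi = (\<lambda>i. if i < n then cell_x s y i else (0::'a))" and "ze = (\<lambda>i. if i < n then cell_z n s y z i else 0)"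
    have "(\<Sum>i<n. xi i * ze i) = (\<Sum>i<n. cell_x s y i * cell_z n s y z i)"
      by (intro sum.cong refl) (simp add: xi_def ze_def)
    then have "(xi, ze) \<in> quadric n"
      using cell_on_quadric[of n s y z] n unfolding quadric_def fspace_def by (simp add: xi_def ze_def)
    then have "beval n (biexpo n k) c xi ze = 0" using v by force
    moreover have "beval n (biexpo n k) c (cell_x s y) (cell_z n s y z) = beval n (biexpo n k) c xi ze"
      by (rule bieval_cong) (simp_all add: xi_def ze_def)
    ultimately show "beval n (biexpo n k) c (cell_x s y) (cell_z n s y z) = 0" by simp
  qed
next
  assume "c \<in> mult_sigma n ` fspace (biexpo_pred n k)"
  then obtain d where "c = mult_sigma n d" by (elim imageE)
  then show "\<forall>v\<in>quadric n. beval n (biexpo n k) c (fst v) (snd v) = 0"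
    unfolding quadric_def by (auto simp: beval_mult_sigma)
qed

text \<open>Both spaces have the multiples of \<open>\<sigma>\<close> as annihilator for the pairing weighted by factorials,
  in which kernel arrays represent the evaluations at points.\<close>

lemma span_kernel_arrays:
  assumes CH: "CHAR('a::{field,finite}) = p" and card: "2 * k < CARD('a) - 1"
  shows "range (\<lambda>a e. \<Sum>v\<in>quadric n. a v * kernel_array n k (fst v) (snd v) e) = (harmonic n k :: (_ \<Rightarrow> 'a) set)"
proof -
  let ?E = "biexpo n k" and ?N = "mult_sigma n ` (fspace (biexpo_pred n k) :: (_ \<Rightarrow> 'a) set)"
  let ?ka = "\<lambda>v. kernel_array n k (fst v) (snd v) :: _ \<Rightarrow> 'a"
  define H where "H = range (\<lambda>a e. \<Sum>v\<in>quadric n. a v * ?ka v e)"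
  \<comment> \<open>Scaling by the factorials turns the weighted pairing into the plain one of
    \<open>card_perp_in\<close>.\<close>
  define F where "F = (\<lambda>(d :: _ \<Rightarrow> 'a) e. facts n e * d e)"
  have fk: "(of_nat (fact k) :: 'a) \<noteq> 0" by (rule of_nat_fact_nonzero[OF p CH k])
  have ka: "?ka v \<in> H" if "v \<in> quadric n" for v
  proof -
    have "?ka v = (\<lambda>e. \<Sum>u\<in>quadric n. (if u = v then 1 else 0) * ?ka u e)"
      using that finite_quadric[of n, where 'a='a] by (auto simp: fun_eq_iff if_distrib[of "\<lambda>x. x * _"] cong: if_cong)
    then show ?thesis unfolding H_def by (rule range_eqI[where x="\<lambda>u. if u = v then 1 else 0"])
  qed
  have ps: "(\<Sum>e\<in>?E. facts n e * (\<Sum>v\<in>quadric n. a v * ?ka v e) * c e)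
      = (\<Sum>v\<in>quadric n. a v * (of_nat (fact k) ^ 2 * beval n ?E c (snd v) (fst v)))" for a c
  proof -
    have "(\<Sum>e\<in>?E. facts n e * (\<Sum>v\<in>quadric n. a v * ?ka v e) * c e)
        = (\<Sum>e\<in>?E. \<Sum>v\<in>quadric n. a v * (facts n e * ?ka v e * c e))"
      by (simp add: sum_distrib_left sum_distrib_right mult_ac)
    also have "\<dots> = (\<Sum>v\<in>quadric n. \<Sum>e\<in>?E. a v * (facts n e * ?ka v e * c e))" by (rule sum.swap)
    finally show ?thesis unfolding kernel_array_reproducing[OF p CH k, symmetric] by (simp add: sum_distrib_left)
  qed
  have Hf: "H \<subseteq> fspace ?E"
  proof
    fix d assume "d \<in> H"
    then obtain a where d: "d = (\<lambda>e. \<Sum>v\<in>quadric n. a v * ?ka v e)" unfolding H_def by (elim rangeE)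
    have "?ka v e = 0" if "e \<notin> ?E" for v e by (rule fspaceD[OF kernel_array_in that])
    then show "d \<in> fspace ?E" unfolding d fspace_def by simp
  qed
  have Hh: "H \<subseteq> harmonic n k"
  proof
    fix d assume d: "d \<in> H"
    then obtain a where da: "d = (\<lambda>e. \<Sum>v\<in>quadric n. a v * ?ka v e)" unfolding H_def by (elim rangeE)
    have df: "d \<in> fspace ?E" using d Hf by auto
    have "(\<Sum>e\<in>?E. facts n e * d e * mult_sigma n c e) = 0" for c
      unfolding da ps beval_mult_sigma
    proof (rule sum.neutral, rule ballI)
      fix v :: "(nat \<Rightarrow> 'a) \<times> (nat \<Rightarrow> 'a)" assume "v \<in> quadric n"
      then have "(\<Sum>i<n. snd v i * fst v i) = 0" unfolding quadric_def by (auto simp: mult.commute)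
      then show "a v * (of_nat (fact k) ^ 2 * ((\<Sum>i<n. snd v i * fst v i) * beval n (biexpo_pred n k) c (snd v) (fst v))) = 0" by simp
    qed
    then show "d \<in> harmonic n k" using laplace_eq_0_iff_orthogonal[OF p CH k df] df unfolding harmonic_def by simp
  qed
  have FH: "F ` H \<subseteq> fspace ?E" using Hf unfolding F_def fspace_def by auto
  have "lin_subspace (F ` H)"
    unfolding lin_subspace_def
  proof (intro conjI ballI allI)
    have rep: "\<exists>a. x = (\<lambda>e. facts n e * (\<Sum>v\<in>quadric n. a v * ?ka v e))" if "x \<in> F ` H" for x
      using that unfolding F_def H_def by auto
    have inF: "(\<lambda>e. facts n e * (\<Sum>v\<in>quadric n. a v * ?ka v e)) \<in> F ` H" for a
      unfolding F_def H_def by auto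
    show "0 \<in> F ` H" using inF[of "\<lambda>_. 0"] by (simp add: zero_fun_def)
    fix x assume x: "x \<in> F ` H"
    then obtain a where a: "x = (\<lambda>e. facts n e * (\<Sum>v\<in>quadric n. a v * ?ka v e))" using rep by blast
    show "(\<lambda>i. b * x i) \<in> F ` H" for b
      using inF[of "\<lambda>v. b * a v"] unfolding a by (simp add: sum_distrib_left mult_ac)
    fix y assume "y \<in> F ` H"
    then obtain a' where a': "y = (\<lambda>e. facts n e * (\<Sum>v\<in>quadric n. a' v * ?ka v e))" using rep by blast
    show "x + y \<in> F ` H"
      using inF[of "\<lambda>v. a v + a' v"] unfolding a a' by (simp add: plus_fun_def distrib_right sum.distrib distrib_left)
  qed
  then have cp: "card (F ` H) * card (perp_in ?E (F ` H)) = CARD('a) ^ card ?E" by (intro card_perp_in FH) simp_all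
  moreover have "perp_in ?E (F ` H) = ?N"
  proof (rule equalityI; rule subsetI)
    fix c :: "_ \<Rightarrow> 'a" assume c: "c \<in> perp_in ?E (F ` H)"
    then have cf: "c \<in> fspace ?E" unfolding perp_in_def by simp
    have "beval n ?E c (snd v) (fst v) = 0" if v: "v \<in> quadric n" for v
    proof -
      have "(\<Sum>e\<in>?E. c e * F (?ka v) e) = 0" using c ka[OF v] unfolding perp_in_def by blast
      then have "(\<Sum>e\<in>?E. facts n e * ?ka v e * c e) = 0" unfolding F_def by (simp add: mult_ac)
      then show ?thesis unfolding kernel_array_reproducing[OF p CH k] using fk by simp
    qed
    then have "\<forall>v\<in>quadric n. beval n ?E c (fst v) (snd v) = 0" using quadric_swap by fastforce
    then show "c \<in> ?N" using vanishes_on_quadric_iff[OF card cf] by simp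
  next
    fix c :: "_ \<Rightarrow> 'a" assume c: "c \<in> ?N"
    then have cf: "c \<in> fspace ?E" using mult_sigma_in by auto
    then have v: "\<forall>v\<in>quadric n. beval n ?E c (fst v) (snd v) = 0" using vanishes_on_quadric_iff[OF card cf] c by simp
    have v': "beval n ?E c (snd v) (fst v) = 0" if "v \<in> quadric n" for v
      using v quadric_swap[of "fst v" "snd v" n] that by force
    have "(\<Sum>e\<in>?E. c e * F d e) = 0" if "d \<in> H" for d
    proof -
      obtain a where da: "d = (\<lambda>e. \<Sum>v\<in>quadric n. a v * ?ka v e)" using \<open>d \<in> H\<close> unfolding H_def by (elim rangeE)
      have "(\<Sum>e\<in>?E. c e * F d e) = (\<Sum>e\<in>?E. facts n e * d e * c e)" unfolding F_def by (simp add: mult_ac)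
      also have "\<dots> = 0" unfolding da ps by (rule sum.neutral) (simp add: v')
      finally show ?thesis .
    qed
    then show "c \<in> perp_in ?E (F ` H)" unfolding perp_in_def using cf by auto
  qed
  moreover have inj: "inj_on F H"
  proof (rule inj_onI)
    fix c d assume c: "c \<in> H" and d: "d \<in> H" and eq: "F c = F d"
    show "c = d"
    proof
      fix e
      have "facts n e * c e = facts n e * d e" using fun_cong[OF eq, of e] unfolding F_def .
      show "c e = d e"
      proof (cases "e \<in> ?E")
        case True
        then show ?thesis using \<open>facts n e * c e = facts n e * d e\<close> facts_nonzero[OF p CH k True] by simp
      next
        case False
        have "c \<in> fspace ?E" "d \<in> fspace ?E" using c d Hf by auto
        then show ?thesis using fspaceD[OF _ False] by metis
      qed
    qed
  qed
  moreover have "card (F ` H) = card H" by (rule card_image[OF inj])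
  ultimately have "card H * CARD('a) ^ card (biexpo_pred n k) = CARD('a) ^ card ?E"
    using cp card_mult_sigma_image[of n k, where 'a='a] n by simp
  moreover have "CARD('a) ^ card (biexpo_pred n k) * card (harmonic n k :: (_ \<Rightarrow> 'a) set) = CARD('a) ^ card ?E"
    by (rule card_harmonic[OF p CH _ k]) (use n in simp)
  ultimately have "CARD('a) ^ card (biexpo_pred n k) * card H = CARD('a) ^ card (biexpo_pred n k) * card (harmonic n k :: (_ \<Rightarrow> 'a) set)"
    by (simp add: mult.commute)
  then have "card H = card (harmonic n k :: (_ \<Rightarrow> 'a) set)" by simp
  moreover have "finite (harmonic n k :: (_ \<Rightarrow> 'a) set)"
    by (rule finite_subset[OF _ finite_fspace[of ?E]]) (auto simp: harmonic_def)
  ultimately show ?thesis using card_subset_eq[OF _ Hh] unfolding H_def by simp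
qed

end

text \<open>The factors are a maximal independent family of columns of the kernel and its dual family.\<close>

theorem kernel_factorisation:
  assumes p: "prime p" and n: "n \<ge> 3" and CH: "CHAR('a::{field,finite}) = p" and card: "2 * (p - 1) < CARD('a) - 1"
  obtains Y and c d :: "(nat \<Rightarrow> 'a::{field,finite}) \<times> (nat \<Rightarrow> 'a) \<Rightarrow> (nat \<Rightarrow> nat) \<times> (nat \<Rightarrow> nat) \<Rightarrow> 'a" where "finite Y"
    "\<And>v w. v \<in> quadric n \<Longrightarrow> w \<in> quadric n \<Longrightarrow> kernel n (p - 1) v w
      = (\<Sum>y\<in>Y. beval n (biexpo n (p - 1)) (c y) (fst v) (snd v) * beval n (biexpo n (p - 1)) (d y) (fst w) (snd w))"
    "\<And>a. vanishes_on_cell n (p - 1) (\<lambda>e. \<Sum>y\<in>Y. a y * c y e) \<Longrightarrow> \<forall>y\<in>Y. a y = 0"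
    "\<And>a. vanishes_on_cell n (p - 1) (\<lambda>e. \<Sum>y\<in>Y. a y * d y e) \<Longrightarrow> \<forall>y\<in>Y. a y = 0"
    "\<And>m. m < p - 1 \<Longrightarrow> p dvd n + m - 2 \<Longrightarrow>
      card Y + card (biexpo_pred n (p - 1)) + card (biexpo n m) = card (biexpo n (p - 1)) + card (biexpo_pred n m)"
    "(\<And>m. m < p - 1 \<Longrightarrow> \<not> p dvd n + m - 2) \<Longrightarrow> card Y + card (biexpo_pred n (p - 1)) = card (biexpo n (p - 1))"
proof -
  define k where "k = p - 1"
  have k: "k < p" unfolding k_def using prime_gt_0_nat[OF p] by simp
  have card': "2 * k < CARD('a) - 1" unfolding k_def by (rule card)
  let ?E = "biexpo n k"
  define X where "X = (quadric n :: ((nat \<Rightarrow> 'a) \<times> (nat \<Rightarrow> 'a)) set)"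
  have finX: "finite X" unfolding X_def by (rule finite_quadric)
  interpret id: coeff_hom "\<lambda>a::'a. a" by (rule coeff_hom_id)
  define c where "c = (\<lambda>v. kernel_array n k (fst v) (snd v) :: _ \<Rightarrow> 'a)"
  define f where "f = (\<lambda>w v. kernel n k v w :: 'a)"
  have fk: "(of_nat (fact k) :: 'a) \<noteq> 0" by (rule of_nat_fact_nonzero[OF p CH k])
  have cf: "beval n ?E (c w) (fst v) (snd v) = f w v" for v w
    unfolding c_def f_def kernel_def by (rule beval_kernel_array[OF fk])
  have c_in: "c v \<in> fspace ?E" for v unfolding c_def by (rule kernel_array_in)
  obtain Y where Y: "Y \<subseteq> X" "lin_indep X Y f" "\<forall>w\<in>X. \<exists>a. \<forall>v\<in>X. f w v = (\<Sum>y\<in>Y. a y * f y v)"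
    using lin_indep_maximal_subfamily[OF finX, of X f] by (elim exE conjE)
  have finY: "finite Y" using Y(1) finX by (rule finite_subset)
  obtain wt where wt: "\<forall>y\<in>Y. \<forall>y'\<in>Y. (\<Sum>v\<in>X. wt y v * f y' v) = (if y = y' then 1 else 0)"
    using lin_indep_dual[OF finY finX Y(2)] by (elim exE)
  \<comment> \<open>By symmetry of the kernel, evaluating \<open>d y\<close> at \<open>w\<close>
    applies the functional \<open>wt y\<close> to the column of \<open>w\<close>; this extracts the
    coefficient of column \<open>y\<close> in its expansion over \<open>Y\<close>.\<close>
  define d where "d = (\<lambda>y e. \<Sum>v\<in>X. wt y v * c v e)"
  have d_in: "d y \<in> fspace ?E" for y
    unfolding d_def fspace_def using fspaceD[OF c_in] by simp
  have dv: "beval n ?E (d y) (fst w) (snd w) = (\<Sum>v\<in>X. wt y v * f w v)" for y w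
    unfolding d_def id.bieval_lincomb cf unfolding f_def by (simp add: kernel_commute[of n k w])
  obtain al where al: "\<forall>w\<in>X. \<forall>v\<in>X. f w v = (\<Sum>y\<in>Y. al w y * f y v)" using bchoice[OF Y(3)] by (elim exE)
  have dal: "beval n ?E (d y) (fst w) (snd w) = al w y" if w: "w \<in> X" and y: "y \<in> Y" for w y
  proof -
    have "(\<Sum>v\<in>X. wt y v * f w v) = (\<Sum>v\<in>X. \<Sum>y'\<in>Y. al w y' * (wt y v * f y' v))"
    proof (intro sum.cong refl)
      fix v assume "v \<in> X"
      then have "f w v = (\<Sum>y\<in>Y. al w y * f y v)" using al w by blast
      then show "wt y v * f w v = (\<Sum>y'\<in>Y. al w y' * (wt y v * f y' v))" by (simp add: sum_distrib_left mult_ac)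
    qed
    also have "\<dots> = (\<Sum>y'\<in>Y. al w y' * (\<Sum>v\<in>X. wt y v * f y' v))"
      by (subst sum.swap) (simp add: sum_distrib_left)
    also have "\<dots> = (\<Sum>y'\<in>Y. if y = y' then al w y' else 0)"
      using wt y by (intro sum.cong refl) auto
    finally show ?thesis using y finY unfolding dv by simp
  qed
  have van: "(\<Sum>y\<in>Y. a y * beval n ?E (g y) (fst v) (snd v)) = 0"
    if g: "\<And>y. g y \<in> fspace ?E" and 0: "vanishes_on_cell n k (\<lambda>e. \<Sum>y\<in>Y. a y * g y e)" and v: "v \<in> X" for a g v
  proof -
    have in': "(\<lambda>e. \<Sum>y\<in>Y. a y * g y e) \<in> fspace ?E" unfolding fspace_def using fspaceD[OF g] by simp
    have "\<forall>v\<in>quadric n. beval n ?E (\<lambda>e. \<Sum>y\<in>Y. a y * g y e) (fst v) (snd v) = 0"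
      using vanishes_on_quadric_iff[OF p n k card' in'] vanishes_on_cell_imp_multiple_of_sigma[OF n card' in' 0] by simp
    then show ?thesis using v unfolding X_def id.bieval_lincomb by blast
  qed
  have ind_c: "\<forall>y\<in>Y. a y = 0" if 0: "vanishes_on_cell n k (\<lambda>e. \<Sum>y\<in>Y. a y * c y e)" for a
  proof
    fix y assume y: "y \<in> Y"
    show "a y = 0"
      by (rule lin_indepD[OF Y(2) _ y]) (use van[of c, OF c_in 0] in \<open>simp only: cf\<close>)
  qed
  have ind_d: "\<forall>y\<in>Y. a y = 0" if 0: "vanishes_on_cell n k (\<lambda>e. \<Sum>y\<in>Y. a y * d y e)" for a
  proof
    fix y assume y: "y \<in> Y"
    \<comment> \<open>At the points of \<open>Y\<close> itself the dual functions take the values of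
      a Kronecker delta.\<close>
    have "0 = (\<Sum>y'\<in>Y. a y' * beval n ?E (d y') (fst y) (snd y))"
      using van[of d, OF d_in 0] y Y(1) by auto
    also have "\<dots> = (\<Sum>y'\<in>Y. if y' = y then a y' else 0)"
      unfolding dv using wt y by (intro sum.cong refl) auto
    finally show "a y = 0" using y finY by simp
  qed
  have fac: "kernel n k v w = (\<Sum>y\<in>Y. beval n ?E (c y) (fst v) (snd v) * beval n ?E (d y) (fst w) (snd w))"
    if v: "v \<in> X" and w: "w \<in> X" for v w
  proof -
    have "f w v = (\<Sum>y\<in>Y. al w y * f y v)" using al v w by blast
    also have "\<dots> = (\<Sum>y\<in>Y. beval n ?E (c y) (fst v) (snd v) * beval n ?E (d y) (fst w) (snd w))"
      using dal[OF w] by (intro sum.cong refl) (simp add: cf mult.commute)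
    finally show ?thesis unfolding f_def .
  qed
  \<comment> \<open>Restriction of arrays to the quadric. On harmonic arrays its image is the column
    space of the kernel and its kernel is \<open>K\<close>, so counting fibres yields the size of
    \<open>Y\<close>.\<close>
  define \<phi> where "\<phi> = (\<lambda>(c :: _ \<Rightarrow> 'a) v. if v \<in> X then beval n ?E c (fst v) (snd v) else 0)"
  define K where "K = harmonic n k \<inter> mult_sigma n ` (fspace (biexpo_pred n k) :: (_ \<Rightarrow> 'a) set)"
  have im: "\<phi> ` harmonic n k = range (lin_comb X Y f)"
  proof -
    have ph: "\<phi> (\<lambda>e. \<Sum>v\<in>X. a v * c v e) = lin_comb X X f a" for a
      unfolding \<phi>_def lin_comb_def id.bieval_lincomb cf ..
    have "\<phi> ` harmonic n k = range (lin_comb X X f)"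
      unfolding span_kernel_arrays[OF p n k CH card', symmetric] image_image using ph unfolding X_def c_def by simp
    also have "\<dots> = range (lin_comb X Y f)"
      by (rule range_lin_comb_subfamily[OF finX Y(1)]) (rule bspec[OF Y(3)])
    finally show ?thesis .
  qed
  have har: "harmonic n k \<subseteq> (fspace ?E :: (_ \<Rightarrow> 'a) set)" unfolding harmonic_def by auto
  have lap: "laplace n (x - y) = laplace n x - laplace n y" for x y :: "_ \<Rightarrow> 'a"
    using laplace_add[of n "x - y" y] by (simp add: algebra_simps)
  have "card (harmonic n k :: (_ \<Rightarrow> 'a) set) = card (\<phi> ` harmonic n k) * card {x \<in> harmonic n k. \<phi> x = 0}"
  proof (rule card_additive_image)
    show "finite (harmonic n k :: (_ \<Rightarrow> 'a) set)" by (rule finite_subset[OF har finite_fspace]) simp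
    show "0 \<in> (harmonic n k :: (_ \<Rightarrow> 'a) set)"
      unfolding harmonic_def by (simp add: laplace_zero lin_subspaceD(1)[OF lin_subspace_fspace])
    show "x + y \<in> harmonic n k" if "x \<in> harmonic n k" "y \<in> harmonic n k" for x y :: "_ \<Rightarrow> 'a"
      using that lin_subspaceD(2)[OF lin_subspace_fspace, of x ?E y] unfolding harmonic_def by (simp add: laplace_add)
    show "x - y \<in> harmonic n k" if "x \<in> harmonic n k" "y \<in> harmonic n k" for x y :: "_ \<Rightarrow> 'a"
      using that lin_subspaceD(4)[OF lin_subspace_fspace, of x ?E y] unfolding harmonic_def by (simp add: lap)
    show "\<phi> (x + y) = \<phi> x + \<phi> y" for x y unfolding \<phi>_def by (simp add: fun_eq_iff id.bieval_add)
  qed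
  also have "card (\<phi> ` harmonic n k) = CARD('a) ^ card Y" unfolding im by (rule card_range_lin_comb[OF finY Y(2)])
  also have "{x \<in> harmonic n k. \<phi> x = 0} = K"
  proof -
    have "\<phi> x = 0 \<longleftrightarrow> x \<in> mult_sigma n ` fspace (biexpo_pred n k)" if "x \<in> harmonic n k" for x
    proof -
      have "\<phi> x = 0 \<longleftrightarrow> (\<forall>v\<in>quadric n. beval n ?E x (fst v) (snd v) = 0)"
        unfolding \<phi>_def X_def fun_eq_iff by auto
      then show ?thesis using vanishes_on_quadric_iff[OF p n k card'] har that by blast
    qed
    then show ?thesis unfolding K_def by blast
  qed
  finally have cH: "card (harmonic n k :: (_ \<Rightarrow> 'a) set) = CARD('a) ^ card Y * card K" .
  have hk: "CARD('a) ^ card (biexpo_pred n k) * card (harmonic n k :: (_ \<Rightarrow> 'a) set) = CARD('a) ^ card ?E"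
    by (rule card_harmonic[OF p CH _ k]) (use n in simp)
  have Q: "1 < CARD('a)" using finite_field_card_ge_2[where 'a='a] by simp
  have n2: "n \<ge> 2" using n by simp
  note K = card_harmonic_multiples_of_sigma[OF p CH n2, folded k_def, folded K_def]
  show ?thesis
  proof (rule that[OF finY, folded k_def, of c d])
    fix m assume m: "m < k" "p dvd n + m - 2"
    have "card K = card (harmonic n m :: (_ \<Rightarrow> 'a) set)" by (rule K(1)[OF m])
    moreover have "CARD('a) ^ card (biexpo_pred n m) * card (harmonic n m :: (_ \<Rightarrow> 'a) set) = CARD('a) ^ card (biexpo n m)"
      by (rule card_harmonic[OF p CH]) (use n m k in simp_all)
    ultimately have m': "CARD('a) ^ card (biexpo n m) = CARD('a) ^ card (biexpo_pred n m) * card K" by simp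
    \<comment> \<open>The dimensions are compared as exponents in additive form, which avoids
      truncated subtraction.\<close>
    have "CARD('a) ^ (card Y + card (biexpo_pred n k) + card (biexpo n m))
        = CARD('a) ^ card Y * CARD('a) ^ card (biexpo_pred n k) * (CARD('a) ^ card (biexpo_pred n m) * card K)"
      by (simp only: power_add m')
    also have "\<dots> = CARD('a) ^ card (biexpo_pred n k) * (CARD('a) ^ card Y * card K) * CARD('a) ^ card (biexpo_pred n m)"
      by (simp only: mult_ac)
    also have "\<dots> = CARD('a) ^ (card ?E + card (biexpo_pred n m))" by (simp only: cH[symmetric] hk power_add)
    finally have "CARD('a) ^ (card Y + card (biexpo_pred n k) + card (biexpo n m)) = CARD('a) ^ (card ?E + card (biexpo_pred n m))" .
    then show "card Y + card (biexpo_pred n k) + card (biexpo n m) = card ?E + card (biexpo_pred n m)"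
      by (rule power_inject_exp[OF Q, THEN iffD1])
  next
    assume "\<And>m. m < k \<Longrightarrow> \<not> p dvd n + m - 2"
    then have "card K = 1" by (rule K(2))
    then have "CARD('a) ^ card ?E = CARD('a) ^ card (biexpo_pred n k) * CARD('a) ^ card Y"
      using hk unfolding cH by simp
    then have "CARD('a) ^ (card Y + card (biexpo_pred n k)) = CARD('a) ^ card ?E"
      by (simp only: power_add mult.commute)
    then show "card Y + card (biexpo_pred n k) = card ?E"
      by (rule power_inject_exp[OF Q, THEN iffD1])
  next
    fix v w :: "(nat \<Rightarrow> 'a) \<times> (nat \<Rightarrow> 'a)" assume "v \<in> quadric n" "w \<in> quadric n"
    then show "kernel n k v w = (\<Sum>y\<in>Y. beval n ?E (c y) (fst v) (snd v) * beval n ?E (d y) (fst w) (snd w))"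
      unfolding X_def[symmetric] by (rule fac)
  next
    fix a assume "vanishes_on_cell n k (\<lambda>e. \<Sum>y\<in>Y. a y * c y e)"
    then show "\<forall>y\<in>Y. a y = 0" by (rule ind_c)
  next
    fix a assume "vanishes_on_cell n k (\<lambda>e. \<Sum>y\<in>Y. a y * d y e)"
    then show "\<forall>y\<in>Y. a y = 0" by (rule ind_d)
  qed
qed

section \<open>Rank and extension of scalars\<close>

text \<open>Passage from indexed families to the sets of columns in \<open>rank_card_indpt\<close>:
  an independent family repeats no column, so \<open>col A\<close> is injective on \<open>J\<close>,
  and the spanning condition makes the resulting set maximal.\<close>

lemma rank_eq_card_if_lin_indep_columns:
  fixes A :: "'k::field mat"
  assumes A: "A \<in> carrier_mat nr nc" and J: "J \<subseteq> {..<nc}"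
    and li: "lin_indep {..<nr} J (\<lambda>j i. A $$ (i, j))"
    and comb: "\<And>j. j < nc \<Longrightarrow> \<exists>a. \<forall>i<nr. A $$ (i, j) = (\<Sum>j'\<in>J. a j' * A $$ (i, j'))"
  shows "vec_space.rank nr A = card J"
proof -
  interpret vec_space "TYPE('k)" nr .
  define U where "U = col A ` J"
  have colA: "j < nc \<Longrightarrow> i < nr \<Longrightarrow> col A j $ i = A $$ (i, j)" for i j using A by auto
  have finJ: "finite J" using J finite_subset by blast
  have Jn: "j < nc" if "j \<in> J" for j using J that by auto
  have inj: "inj_on (col A) J"
  proof (rule inj_onI, rule ccontr)
    fix j j' assume j: "j \<in> J" and j': "j' \<in> J" and eq: "col A j = col A j'" and ne: "j \<noteq> j'"
    have "(if j = j then 1 else if j = j' then - 1 else 0) = (0::'k)"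
    proof (rule lin_indepD[OF li _ j, where a="\<lambda>i. if i = j then 1 else if i = j' then - 1 else 0"])
      fix i assume "i \<in> {..<nr}"
      then have e1: "A $$ (i, j) = A $$ (i, j')" using colA[OF Jn[OF j], of i] colA[OF Jn[OF j'], of i] eq by simp
      have e2: "(\<Sum>k\<in>J. (if k = j then 1 else if k = j' then - 1 else 0) * A $$ (i, k))
          = (\<Sum>k\<in>{j, j'}. (if k = j then 1 else if k = j' then - 1 else 0) * A $$ (i, k))"
        by (rule sum.mono_neutral_right) (use finJ j j' in auto)
      have e3: "(\<Sum>k\<in>{j, j'}. (if k = j then 1 else if k = j' then - 1 else 0) * A $$ (i, k)) = A $$ (i, j) - A $$ (i, j')"
        using ne by simp
      show "(\<Sum>k\<in>J. (if k = j then 1 else if k = j' then - 1 else 0) * A $$ (i, k)) = 0"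
        unfolding e2 e3 e1 by simp
    qed
    then show False by simp
  qed
  have UA: "U \<subseteq> set (cols A)" unfolding U_def cols_def using J A by auto
  have Uc: "U \<subseteq> carrier_vec nr" using UA cols_dim[of A] A by auto
  have lc: "lincomb a U $ i = (\<Sum>j\<in>J. a (col A j) * A $$ (i, j))" if "i < nr" for a i
    unfolding lincomb_index[OF that Uc] unfolding U_def sum.reindex[OF inj]
    by (intro sum.cong refl) (simp add: colA[OF Jn that])
  have indU: "lin_indpt U"
  proof (rule finite_lin_indpt2)
    show "finite U" unfolding U_def using finJ by simp
    show "U \<subseteq> carrier_vec nr" using Uc by simp
    fix a assume 0: "lincomb a U = 0\<^sub>v nr"
    have "a (col A j) = 0" if "j \<in> J" for j
    proof (rule lin_indepD[OF li _ that])
      fix i assume "i \<in> {..<nr}"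
      then show "(\<Sum>j\<in>J. a (col A j) * A $$ (i, j)) = 0" using lc[of i a] unfolding 0 by simp
    qed
    then show "\<forall>v\<in>U. a v = 0" unfolding U_def by simp
  qed
  have "maximal U (\<lambda>T. T \<subseteq> set (cols A) \<and> lin_indpt T)"
    unfolding maximal_def
  proof (intro conjI allI impI)
    fix T assume "U \<subseteq> T \<and> (T \<subseteq> set (cols A) \<and> lin_indpt T)"
    then have T: "U \<subseteq> T" "T \<subseteq> set (cols A)" "lin_indpt T" by simp_all
    show "T = U"
    proof (rule ccontr)
      assume "T \<noteq> U"
      then obtain v where v: "v \<in> T" "v \<notin> U" using T(1) by blast
      then have vA: "v \<in> set (cols A)" using T(2) by blast
      then obtain j where j: "j < nc" "v = col A j" unfolding cols_def using A by auto
      obtain a where a: "\<forall>i<nr. A $$ (i, j) = (\<Sum>j'\<in>J. a j' * A $$ (i, j'))" using comb[OF j(1)] by (elim exE)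
      define b where "b = (\<lambda>u. if u = v then - 1 else a (inv_into J (col A) u))"
      have vc: "v \<in> carrier_vec nr" using vA cols_dim[of A] A by auto
      have "lincomb b (insert v U) = 0\<^sub>v nr"
      proof (rule eq_vecI)
        fix i assume "i < dim_vec (0\<^sub>v nr)"
        then have i: "i < nr" by simp
        have "lincomb b (insert v U) $ i = b v * v $ i + (\<Sum>u\<in>U. b u * u $ i)"
          by (subst lincomb_index[OF i]) (use vc Uc v finJ in \<open>auto simp: U_def\<close>)
        also have "(\<Sum>u\<in>U. b u * u $ i) = (\<Sum>j'\<in>J. b (col A j') * col A j' $ i)"
          unfolding U_def sum.reindex[OF inj] by simp
        also have "\<dots> = (\<Sum>j'\<in>J. a j' * A $$ (i, j'))"
        proof (intro sum.cong refl)
          fix j' assume j': "j' \<in> J"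
          then have "col A j' \<noteq> v" using v(2) unfolding U_def by auto
          then show "b (col A j') * col A j' $ i = a j' * A $$ (i, j')"
            unfolding b_def using inv_into_f_f[OF inj j'] colA[OF Jn[OF j'] i] by simp
        qed
        also have "\<dots> = v $ i" using a i unfolding j(2) colA[OF j(1) i] by simp
        finally show "lincomb b (insert v U) $ i = 0\<^sub>v nr $ i" using i by (simp add: b_def)
      next
        show "dim_vec (lincomb b (insert v U)) = dim_vec (0\<^sub>v nr)"
          using lincomb_dim[of "insert v U" b] vc Uc finJ by (simp add: U_def)
      qed
      then have "lin_dep T"
        by (intro lin_dep_crit[of "insert v U" T v b]) (use v T(1) finJ in \<open>auto simp: U_def b_def\<close>)
      then show False using T(3) by contradiction
    qed
  qed (use UA indU in auto)
  then have "rank A = card U" by (rule rank_card_indpt[OF A])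
  then show ?thesis unfolding U_def card_image[OF inj] .
qed

text \<open>Elements of the prime field are represented by natural numbers and read in the other
  ring; the choice does not matter because both characteristics are \<open>p\<close>.\<close>

lemma prime_field_hom:
  assumes p: "prime p" "CARD('k::{field,finite}) = p" "CHAR('a::comm_ring_1) = p"
  obtains \<iota> :: "'k::{field,finite} \<Rightarrow> 'a::comm_ring_1" where "coeff_hom \<iota>"
proof -
  have CH: "CHAR('k) = p" by (rule finite_field_CHAR[OF p(1), of 1]) (simp add: p(2))
  have inj: "inj_on (of_nat :: nat \<Rightarrow> 'k) {..<p}"
    by (rule inj_onI) (simp add: of_nat_eq_iff_cong_CHAR CH cong_def)
  have im: "(of_nat :: nat \<Rightarrow> 'k) ` {..<p} = UNIV"
    by (rule card_subset_eq) (simp_all add: card_image[OF inj] p(2))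
  define nt where "nt = inv_into {..<p} (of_nat :: nat \<Rightarrow> 'k)"
  have nt: "of_nat (nt x) = x" for x unfolding nt_def by (rule f_inv_into_f) (simp add: im)
  have eq: "(of_nat a :: 'a) = of_nat b" if "(of_nat a :: 'k) = of_nat b" for a b
    using that by (simp add: of_nat_eq_iff_cong_CHAR CH p(3))
  show ?thesis
  proof (rule that[of "\<lambda>x. of_nat (nt x)"], unfold_locales)
    show "of_nat (nt 0) = (0::'a)" using eq[of "nt 0" 0] by (simp add: nt)
    show "of_nat (nt 1) = (1::'a)" using eq[of "nt 1" 1] by (simp add: nt)
    show "of_nat (nt (a + b)) = (of_nat (nt a) + of_nat (nt b) :: 'a)" for a b
      using eq[of "nt (a + b)" "nt a + nt b"] by (simp add: nt)
    show "of_nat (nt (a * b)) = (of_nat (nt a) * of_nat (nt b) :: 'a)" for a b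
      using eq[of "nt (a * b)" "nt a * nt b"] by (simp add: nt)
  qed
qed

text \<open>Independence survives the extension of scalars because a dual family can be extended as well.\<close>

lemma card_column_space:
  fixes A :: "'k::{field,finite} mat"
  assumes p: "prime p" "CARD('k) = p" "CHAR('a::{field,finite}) = p" and A: "A \<in> carrier_mat nr nc"
    and A01: "\<And>i j. i < nr \<Longrightarrow> j < nc \<Longrightarrow> A $$ (i, j) \<in> {0, 1}"
  shows "card (range (lin_comb {..<nr} {..<nc} (\<lambda>j i. if A $$ (i, j) = 0 then 0 else (1::'a)))) = CARD('a) ^ vec_space.rank nr A"
proof -
  define f g where "f = (\<lambda>j i. A $$ (i, j))" and "g = (\<lambda>j i. if A $$ (i, j) = 0 then 0 else (1::'a))"
  obtain \<iota> :: "'k \<Rightarrow> 'a" where "coeff_hom \<iota>" by (rule prime_field_hom[OF p])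
  then interpret coeff_hom \<iota> .
  have gf: "g j i = \<iota> (f j i)" if "i < nr" "j < nc" for i j
    using A01[OF that] unfolding f_def g_def by (auto simp: hom_zero hom_one)
  obtain J where J: "J \<subseteq> {..<nc}" "lin_indep {..<nr} J f"
      "\<forall>j\<in>{..<nc}. \<exists>a. \<forall>i\<in>{..<nr}. f j i = (\<Sum>j'\<in>J. a j' * f j' i)"
    using lin_indep_maximal_subfamily[OF finite_lessThan, of nc "{..<nr}" f] by (elim exE conjE)
  have finJ: "finite J" using J(1) finite_subset by blast
  have Jn: "j < nc" if "j \<in> J" for j using J(1) that by auto
  obtain w where w: "\<forall>i\<in>J. \<forall>j\<in>J. (\<Sum>x<nr. w i x * f j x) = (if i = j then 1 else 0)"
    using lin_indep_dual[OF finJ finite_lessThan J(2)] by (elim exE)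
  have ind: "lin_indep {..<nr} J g"
    unfolding lin_indep_def
  proof (intro allI impI ballI)
    fix a j assume 0: "\<forall>x\<in>{..<nr}. (\<Sum>i\<in>J. a i * g i x) = 0" and j: "j \<in> J"
    have "0 = (\<Sum>x<nr. \<iota> (w j x) * (\<Sum>i\<in>J. a i * g i x))" using 0 by simp
    also have "\<dots> = (\<Sum>i\<in>J. a i * (\<Sum>x<nr. \<iota> (w j x) * g i x))"
      unfolding sum_distrib_left by (subst sum.swap) (simp only: mult_ac)
    also have "\<dots> = (\<Sum>i\<in>J. a i * \<iota> (\<Sum>x<nr. w j x * f i x))"
      unfolding hom_sum hom_mult by (intro sum.cong refl arg_cong2[where f="(*)"]) (simp add: gf Jn)
    also have "\<dots> = (\<Sum>i\<in>J. if j = i then a i else 0)"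
      using w j by (intro sum.cong refl) (auto simp: hom_zero hom_one)
    finally show "a j = 0" using finJ j by simp
  qed
  have rk: "vec_space.rank nr A = card J"
  proof (rule rank_eq_card_if_lin_indep_columns[OF A J(1) J(2)[unfolded f_def]])
    fix j assume "j < nc"
    then have j: "j \<in> {..<nc}" by simp
    obtain a where "\<forall>i\<in>{..<nr}. f j i = (\<Sum>j'\<in>J. a j' * f j' i)" using bspec[OF J(3) j] by (elim exE)
    then have "\<forall>i<nr. A $$ (i, j) = (\<Sum>j'\<in>J. a j' * A $$ (i, j'))" unfolding f_def by simp
    then show "\<exists>a. \<forall>i<nr. A $$ (i, j) = (\<Sum>j'\<in>J. a j' * A $$ (i, j'))" by (rule exI[of _ a])
  qed
  have "range (lin_comb {..<nr} {..<nc} g) = range (lin_comb {..<nr} J g)"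
  proof (rule range_lin_comb_subfamily[OF finite_lessThan J(1)])
    fix j assume j: "j \<in> {..<nc}"
    obtain a where a: "\<forall>i\<in>{..<nr}. f j i = (\<Sum>j'\<in>J. a j' * f j' i)" using bspec[OF J(3) j] by (elim exE)
    have "g j i = (\<Sum>j'\<in>J. \<iota> (a j') * g j' i)" if "i \<in> {..<nr}" for i
    proof -
      have "g j i = \<iota> (f j i)" using gf[of i j] that j by simp
      also have "f j i = (\<Sum>j'\<in>J. a j' * f j' i)" using a that by (rule bspec)
      finally have "g j i = \<iota> (\<Sum>j'\<in>J. a j' * f j' i)" .
      also have "\<dots> = (\<Sum>j'\<in>J. \<iota> (a j') * g j' i)"
        unfolding hom_sum hom_mult by (intro sum.cong refl) (use that in \<open>simp add: gf Jn\<close>)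
      finally show ?thesis .
    qed
    then show "\<exists>a. \<forall>i\<in>{..<nr}. g j i = (\<Sum>j'\<in>J. a j' * g j' i)" by (intro exI ballI)
  qed
  then show ?thesis unfolding g_def[symmetric] rk using card_range_lin_comb[OF finJ ind] by simp
qed

section \<open>The incidence matrix\<close>

lemma pred_add_pred_mult:
  fixes p m :: nat
  assumes "p \<ge> 1" "m \<ge> 1"
  shows "(p - 1) + (m - 1) * p = p * m - 1"
  using assms by (cases m) (simp_all add: mult.commute)

lemma power_char_expansion:
  fixes u :: "'r::comm_ring_1"
  assumes p: "prime p" "CHAR('r) = p" and Y: "finite Y" and u: "u ^ (p - 1) = (\<Sum>i\<in>Y. f i * g i)"
  shows "u ^ (p ^ t - 1) = (\<Sum>l\<in>lists_of Y t. frob_prod p f l * frob_prod p g l)"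
proof (induction t)
  case 0
  show ?case by (simp add: lists_of_0)
next
  case (Suc t)
  have p1: "p \<ge> 1" using prime_gt_0_nat[OF p(1)] by simp
  have e: "p ^ Suc t - 1 = (p - 1) + (p ^ t - 1) * p"
    using pred_add_pred_mult[of p "p ^ t"] p1 by simp
  have "u ^ (p ^ Suc t - 1) = u ^ (p - 1) * (u ^ (p ^ t - 1)) ^ p"
    unfolding e by (simp only: power_add power_mult)
  also have "(u ^ (p ^ t - 1)) ^ p = (\<Sum>l\<in>lists_of Y t. (frob_prod p f l * frob_prod p g l) ^ p)"
    unfolding Suc by (rule freshmans_dream_sum) (use p in auto)
  also have "u ^ (p - 1) * \<dots> = (\<Sum>i\<in>Y. \<Sum>l\<in>lists_of Y t. (f i * g i) * (frob_prod p f l * frob_prod p g l) ^ p)"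
    unfolding u by (rule sum_product)
  also have "\<dots> = (\<Sum>i\<in>Y. \<Sum>l\<in>lists_of Y t. frob_prod p f (i # l) * frob_prod p g (i # l))"
    by (intro sum.cong refl) (simp add: power_mult_distrib mult_ac)
  finally show ?case unfolding sum_lists_of_Suc[OF Y] .
qed

lemma biform_beval: "biform k (\<lambda>x z. beval n (biexpo n k) c x z)"
  unfolding bieval_def
proof (intro biform_sum biform_scale biform_prod)
  fix e assume "e \<in> biexpo n k"
  then have e: "(\<Sum>i<n. fst e i) = k" "(\<Sum>i<n. snd e i) = k" by (rule sum_expo)+
  have m: "homog_fun (\<Sum>i<n. \<alpha> i) (\<lambda>x. power_prod n x \<alpha> :: 'a)" for \<alpha>
  proof -
    have "homog_fun (1 * \<alpha> i) (\<lambda>x. x i ^ \<alpha> i :: 'a)" for i by (rule homog_fun_power[OF homog_fun_coord])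
    then have "homog_fun (\<Sum>i<n. 1 * \<alpha> i) (\<lambda>x. \<Prod>i<n. x i ^ \<alpha> i :: 'a)" by (intro homog_fun_prod[OF finite_lessThan])
    then show ?thesis unfolding power_prod_def by simp
  qed
  show "homog_fun k (\<lambda>x. power_prod n x (fst e) :: 'a)" using m[of "fst e"] unfolding e .
  show "homog_fun k (\<lambda>x. power_prod n x (snd e) :: 'a)" using m[of "snd e"] unfolding e .
qed

lemma biform_frob_prod:
  assumes p: "p \<ge> 1" and f: "\<And>i. biform (p - 1) (f i)"
  shows "biform (p ^ length l - 1) (\<lambda>x z. frob_prod p (\<lambda>i. f i x z) l)"
proof (induction l)
  case Nil
  show ?case using biform_prod[OF homog_fun_const[of 1] homog_fun_const[of 1]] by simp
next
  case (Cons i l)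
  have e: "(p - 1) + (p ^ length l - 1) * p = p ^ length (i # l) - 1"
    using pred_add_pred_mult[of p "p ^ length l"] p by simp
  have "biform ((p - 1) + (p ^ length l - 1) * p) (\<lambda>x z. f i x z * frob_prod p (\<lambda>i. f i x z) l ^ p)"
    by (rule biform_mult[OF f biform_power[OF Cons]])
  then show ?case unfolding e by simp
qed

section \<open>Factorisation of the non-orthogonality function and the span of the columns\<close>

context hermitian_space
begin

text \<open>The complement of an incidence entry, read in the large field and defined for vectors
  instead of points; it vanishes when either vector is zero.\<close>

definition nonorth :: "'v \<Rightarrow> 'v \<Rightarrow> 'a" where
  "nonorth x y = (if h x y = 0 then 0 else 1)"

lemma nonorth_commute: "nonorth x y = nonorth y x"
  unfolding nonorth_def using h_eq_0_commute[of x y] by simp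

lemma nonorth_zero: "nonorth x 0 = 0"
  unfolding nonorth_def by (simp add: h_zero_right)

lemma nonorth_eq_power: "nonorth x y = h x y ^ (CARD('a) - 1)"
proof -
  have "CARD('a) - 1 > 0" using finite_field_card_ge_2[where 'a='a] by simp
  then show ?thesis unfolding nonorth_def using finite_field_power_card_minus_1[of "h x y"] by simp
qed

text \<open>Since \<open>q\<^sup>2 - 1 = (q + 1) * (q - 1)\<close> and
  \<open>h x y ^ (q + 1)\<close> is the product of \<open>h x y\<close> with its conjugate
  \<open>h y x\<close>.\<close>

lemma nonorth_eq_norm_power: "nonorth x y = (h x y * h y x) ^ (q - 1)"
proof -
  have "CARD('a) - 1 = (q + 1) * (q - 1)"
    unfolding card_field using q_ge_2 by (simp add: power2_eq_square diff_mult_distrib2)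
  then show ?thesis unfolding nonorth_eq_power by (simp only: power_mult) (simp add: h_conj)
qed

lemma card_field_p: "CARD('a) = p ^ (2 * t)"
  unfolding card_field q_def by (simp add: power_mult[symmetric] mult.commute)

lemma coordinates_in_quadric: "h v v = 0 \<Longrightarrow> (crd v, dcrd v) \<in> quadric n"
  unfolding quadric_def using crd_in dcrd_in h_coordinates[of v v] by simp

lemma kernel_coordinates: "kernel n k (crd x, dcrd x) (crd y, dcrd y) = (h x y * h y x) ^ k"
  unfolding kernel_def h_coordinates[of x y] h_coordinates[of y x] by (simp add: mult.commute)

text \<open>A relation among the twisted products is a form of bidegree \<open>q - 1\<close>, so its
  vanishing at singular vectors spreads to the whole quadric, where the polynomial argument
  applies.\<close>

lemma lin_indep_frob_prod:
  assumes Y: "finite Y"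
    and ind: "\<And>a. vanishes_on_cell n (p - 1) (\<lambda>e. \<Sum>y\<in>Y. a y * c y e) \<Longrightarrow> \<forall>y\<in>Y. a y = 0"
  shows "lin_indep {v. h v v = 0} (lists_of Y t)
    (\<lambda>l x. frob_prod p (\<lambda>y. beval n (biexpo n (p - 1)) (c y) (crd x) (dcrd x)) l)"
  unfolding lin_indep_def
proof (intro allI impI ballI)
  fix a l
  assume 0: "\<forall>x\<in>{v. h v v = 0}. (\<Sum>l\<in>lists_of Y t. a l * frob_prod p (\<lambda>y. beval n (biexpo n (p - 1)) (c y) (crd x) (dcrd x)) l) = 0"
    and l: "l \<in> lists_of Y t"
  have n3: "n \<ge> 3" using n_ge_4 by simp
  have p1: "p \<ge> 1" using prime_gt_0_nat[OF prime_p] by simp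
  let ?G = "\<lambda>x z. \<Sum>l\<in>lists_of Y t. a l * frob_prod p (\<lambda>y. beval n (biexpo n (p - 1)) (c y) x z) l"
  have G: "biform (q - 1) ?G"
  proof (rule biform_sum, rule biform_scale)
    fix l assume "l \<in> lists_of Y t"
    then have "p ^ length l - 1 = q - 1" unfolding lists_of_def q_def by simp
    then show "biform (q - 1) (\<lambda>x z. frob_prod p (\<lambda>y. beval n (biexpo n (p - 1)) (c y) x z) l)"
      using biform_frob_prod[OF p1, of "\<lambda>y x z. beval n (biexpo n (p - 1)) (c y) x z" l, OF biform_beval] by simp
  qed
  have G0: "?G (crd x) (dcrd x) = 0" if "h x x = 0" for x using 0 that by simp
  show "a l = 0"
  proof (rule frob_prod_independent_on_quadric[OF prime_p card_field_p t_pos n3 Y ind _ l])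
    fix x z :: "nat \<Rightarrow> 'a" assume xz: "x \<in> fspace {..<n}" "z \<in> fspace {..<n}" "(\<Sum>i<n. x i * z i) = 0"
    show "?G x z = 0" by (rule singular_vectors_determine_biform[OF G G0 xz])
  qed
qed

theorem nonorth_factorisation:
  obtains L :: "((nat \<Rightarrow> 'a) \<times> (nat \<Rightarrow> 'a)) list set" and F G and s :: nat where
    "finite L" "card L = s ^ t" "lin_indep {v. h v v = 0} L F" "lin_indep {v. h v v = 0} L G"
    "\<And>x y. h x x = 0 \<Longrightarrow> h y y = 0 \<Longrightarrow> nonorth x y = (\<Sum>l\<in>L. F l x * G l y)"
    "\<And>m. m < p - 1 \<Longrightarrow> p dvd n + m - 2 \<Longrightarrow>
      s + card (biexpo_pred n (p - 1)) + card (biexpo n m) = card (biexpo n (p - 1)) + card (biexpo_pred n m)"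
    "(\<And>m. m < p - 1 \<Longrightarrow> \<not> p dvd n + m - 2) \<Longrightarrow> s + card (biexpo_pred n (p - 1)) = card (biexpo n (p - 1))"
proof -
  have n3: "n \<ge> 3" using n_ge_4 by simp
  have p2: "p \<ge> 2" by (rule prime_ge_2_nat[OF prime_p])
  have card: "2 * (p - 1) < CARD('a) - 1"
  proof -
    have "p ^ 2 \<le> p ^ (2 * t)" using p2 t_pos by (intro power_increasing) auto
    moreover obtain k where "p = k + 2" using p2 by (metis add.commute le_Suc_ex)
    ultimately show ?thesis unfolding card_field_p by (simp add: power2_eq_square)
  qed
  obtain Y and c d :: "(nat \<Rightarrow> 'a) \<times> (nat \<Rightarrow> 'a) \<Rightarrow> (nat \<Rightarrow> nat) \<times> (nat \<Rightarrow> nat) \<Rightarrow> 'a" where Y: "finite Y"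
    "\<And>v w. v \<in> quadric n \<Longrightarrow> w \<in> quadric n \<Longrightarrow> kernel n (p - 1) v w
      = (\<Sum>y\<in>Y. beval n (biexpo n (p - 1)) (c y) (fst v) (snd v) * beval n (biexpo n (p - 1)) (d y) (fst w) (snd w))"
    "\<And>a. vanishes_on_cell n (p - 1) (\<lambda>e. \<Sum>y\<in>Y. a y * c y e) \<Longrightarrow> \<forall>y\<in>Y. a y = 0"
    "\<And>a. vanishes_on_cell n (p - 1) (\<lambda>e. \<Sum>y\<in>Y. a y * d y e) \<Longrightarrow> \<forall>y\<in>Y. a y = 0"
    "\<And>m. m < p - 1 \<Longrightarrow> p dvd n + m - 2 \<Longrightarrow>
      card Y + card (biexpo_pred n (p - 1)) + card (biexpo n m) = card (biexpo n (p - 1)) + card (biexpo_pred n m)"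
    "(\<And>m. m < p - 1 \<Longrightarrow> \<not> p dvd n + m - 2) \<Longrightarrow> card Y + card (biexpo_pred n (p - 1)) = card (biexpo n (p - 1))"
    by (rule kernel_factorisation[OF prime_p n3 CHAR_p card]) blast
  let ?F = "\<lambda>l x. frob_prod p (\<lambda>y. beval n (biexpo n (p - 1)) (c y) (crd x) (dcrd x)) l"
  let ?G = "\<lambda>l x. frob_prod p (\<lambda>y. beval n (biexpo n (p - 1)) (d y) (crd x) (dcrd x)) l"
  show ?thesis
  proof (rule that[OF finite_lists_of[OF Y(1)] card_lists_of[OF Y(1)]])
    show "lin_indep {v. h v v = 0} (lists_of Y t) ?F" by (rule lin_indep_frob_prod[OF Y(1)], rule Y(3))
    show "lin_indep {v. h v v = 0} (lists_of Y t) ?G" by (rule lin_indep_frob_prod[OF Y(1)], rule Y(4))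
    fix x y assume xy: "h x x = 0" "h y y = 0"
    have "(h x y * h y x) ^ (p - 1) = (\<Sum>i\<in>Y. beval n (biexpo n (p - 1)) (c i) (crd x) (dcrd x) * beval n (biexpo n (p - 1)) (d i) (crd y) (dcrd y))"
      unfolding kernel_coordinates[symmetric]
      using Y(2)[OF coordinates_in_quadric[OF xy(1)] coordinates_in_quadric[OF xy(2)]] by simp
    then show "nonorth x y = (\<Sum>l\<in>lists_of Y t. ?F l x * ?G l y)"
      unfolding nonorth_eq_norm_power q_def by (rule power_char_expansion[OF prime_p CHAR_p Y(1)])
  next
    fix m assume "m < p - 1" "p dvd n + m - 2"
    then show "card Y + card (biexpo_pred n (p - 1)) + card (biexpo n m) = card (biexpo n (p - 1)) + card (biexpo_pred n m)"
      by (rule Y(5))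
  next
    assume "\<And>m. m < p - 1 \<Longrightarrow> \<not> p dvd n + m - 2"
    then show "card Y + card (biexpo_pred n (p - 1)) = card (biexpo n (p - 1))" by (rule Y(6))
  qed
qed

text \<open>On an isotropic line the vectors not orthogonal to \<open>x\<close> span \<open>0\<close> or \<open>CARD('a)\<close> points.\<close>

lemma sum_nonorth_line: "(\<Sum>c\<in>UNIV. nonorth x (e + c *s e')) + nonorth x e' = 0"
proof (cases "h x e' = 0")
  case True
  have "nonorth x (e + c *s e') = nonorth x e" for c
    unfolding nonorth_def using True by (simp add: h_simps)
  then have "(\<Sum>c\<in>UNIV. nonorth x (e + c *s e')) = of_nat (CARD('a)) * nonorth x e" by simp
  then show ?thesis unfolding finite_field_of_nat_card using True by (simp add: nonorth_def)
next
  case False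
  let ?\<phi> = "\<lambda>c. h x e + c ^ q * h x e'"
  have "inj ?\<phi>"
  proof (rule injI)
    fix c d assume "?\<phi> c = ?\<phi> d"
    then have "c ^ q = d ^ q" using False by simp
    then have "(c ^ q) ^ q = (d ^ q) ^ q" by simp
    then show "c = d" unfolding conj_conj .
  qed
  then have bij: "bij ?\<phi>" by (simp add: bij_def finite_UNIV_inj_surj)
  have "(\<Sum>c\<in>UNIV. nonorth x (e + c *s e')) = (\<Sum>c\<in>UNIV. ?\<phi> c ^ (CARD('a) - 1))"
    unfolding nonorth_eq_power by (simp add: h_simps)
  also have "\<dots> = (\<Sum>c\<in>UNIV. c ^ (CARD('a) - 1))" by (rule sum.reindex_bij_betw[OF bij])
  also have "\<dots> = - 1" by (rule finite_field_sum_power_card_minus_1)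
  finally show ?thesis using False by (simp add: nonorth_def)
qed

text \<open>A totally isotropic line has \<open>CARD('a) + 1\<close> points, a number equal to one
  in the field, and \<open>nonorth\<close> sums to zero over them. Hence the columns of the line add
  up to the constant function. A dual family of the \<open>G l\<close> then extracts every
  \<open>F l\<close> from the columns, so the span is that of the constant and the
  \<open>F l\<close>. Summation over the same line separates the constant from the
  \<open>F l\<close>.\<close>

theorem card_span_of_columns:
  assumes I: "finite I" and J: "finite J"
    and v: "\<And>i. i \<in> I \<Longrightarrow> h (v i) (v i) = 0" and w: "\<And>j. j \<in> J \<Longrightarrow> h (w j) (w j) = 0"
    and rows: "\<And>x. x \<noteq> 0 \<Longrightarrow> h x x = 0 \<Longrightarrow> \<exists>i\<in>I. \<forall>y. nonorth x y = nonorth (v i) y"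
    and cols: "\<And>y. y \<noteq> 0 \<Longrightarrow> h y y = 0 \<Longrightarrow> \<exists>j\<in>J. \<forall>x. nonorth x y = nonorth x (w j)"
    and L: "finite L" and indF: "lin_indep {v. h v v = 0} L F" and indG: "lin_indep {v. h v v = 0} L G"
    and fac: "\<And>x y. h x x = 0 \<Longrightarrow> h y y = 0 \<Longrightarrow> nonorth x y = (\<Sum>l\<in>L. F l x * G l y)"
  shows "card (range (lin_comb I J (\<lambda>j i. 1 - nonorth (v i) (w j)))) = CARD('a) ^ (1 + card L)"
proof -
  define S where "S = {v. h v v = 0}"
  have finS: "finite S" unfolding S_def by (rule finite_subset[OF _ finite_V]) simp
  obtain e e' where e: "h e e = 0" "h e' e' = 0" "h e e' = 0" "e' \<noteq> 0" "\<And>c. e \<noteq> c *s e'"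
    by (rule totally_isotropic_line) blast
  have "h e' e = 0" using e(3) h_eq_0_commute[of e e'] by simp
  then have l0: "h (e + c *s e') (e + c *s e') = 0" for c using e by (simp add: h_simps)
  have l1: "e + c *s e' \<noteq> 0" for c
  proof
    assume "e + c *s e' = 0"
    then have "e = (- c) *s e'" by (simp add: eq_neg_iff_add_eq_0)
    then show False using e(5) by blast
  qed
  define f where "f = (\<lambda>j i. 1 - nonorth (v i) (w j))"
  define C where "C = range (lin_comb I J f)"
  have C0: "(\<lambda>i. 0) \<in> C"
    unfolding C_def by (rule range_eqI[of _ _ "\<lambda>_. 0"]) (simp add: lin_comb_def fun_eq_iff)
  have Cadd: "(\<lambda>i. x i + y i) \<in> C" if x: "x \<in> C" and y: "y \<in> C" for x y
  proof -
    obtain a where "x = lin_comb I J f a" using x unfolding C_def by (elim rangeE)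
    moreover obtain b where "y = lin_comb I J f b" using y unfolding C_def by (elim rangeE)
    ultimately have xy: "(\<lambda>i. x i + y i) = lin_comb I J f (\<lambda>j. a j + b j)"
      by (auto simp: lin_comb_def fun_eq_iff distrib_right sum.distrib)
    show ?thesis unfolding C_def xy by (rule rangeI)
  qed
  have Cscale: "(\<lambda>i. a * x i) \<in> C" if x: "x \<in> C" for x a
  proof -
    obtain b where "x = lin_comb I J f b" using x unfolding C_def by (elim rangeE)
    then have x: "(\<lambda>i. a * x i) = lin_comb I J f (\<lambda>j. a * b j)"
      by (auto simp: lin_comb_def fun_eq_iff sum_distrib_left mult.assoc)
    show ?thesis unfolding C_def x by (rule rangeI)
  qed
  have Csum: "(\<lambda>i. \<Sum>k\<in>K. x k i) \<in> C" if "\<And>k. k \<in> K \<Longrightarrow> x k \<in> C" for K :: "'k set" and x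
    using that by (induction K rule: infinite_finite_induct) (simp_all add: C0 Cadd)
  define one where "one = (\<lambda>i. if i \<in> I then 1 else (0::'a))"
  define co where "co = (\<lambda>y i. if i \<in> I then 1 - nonorth (v i) y else 0)"
  define FI where "FI = (\<lambda>l i. if i \<in> I then F l (v i) else 0)"
  have co_nz: "co y \<in> C" if y: "y \<noteq> 0" "h y y = 0" for y
  proof -
    obtain j where j: "j \<in> J" "\<forall>x. nonorth x y = nonorth x (w j)" using cols[OF y] by (elim bexE)
    have "(\<Sum>k\<in>J. (if k = j then 1 else 0) * f k i) = f j i" for i
    proof -
      have "(\<Sum>k\<in>J. (if k = j then 1 else 0) * f k i) = (\<Sum>k\<in>J. if k = j then f j i else 0)"
        by (intro sum.cong refl) simp
      then show ?thesis using j(1) J by simp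
    qed
    then have y: "co y = lin_comb I J f (\<lambda>k. if k = j then 1 else 0)"
      unfolding co_def lin_comb_def f_def using j(2) by (simp add: fun_eq_iff)
    show ?thesis unfolding C_def y by (rule rangeI)
  qed
  have one: "one \<in> C"
  proof -
    have "(\<lambda>i. (\<Sum>c\<in>UNIV. co (e + c *s e') i) + co e' i) \<in> C"
      by (intro Cadd Csum co_nz l0 l1 e)
    moreover have "(\<Sum>c\<in>UNIV. co (e + c *s e') i) + co e' i = one i" for i
    proof (cases "i \<in> I")
      case True
      have "(\<Sum>c\<in>UNIV. co (e + c *s e') i) + co e' i
          = of_nat (CARD('a)) + 1 - ((\<Sum>c\<in>UNIV. nonorth (v i) (e + c *s e')) + nonorth (v i) e')"
        unfolding co_def using True by (simp add: sum_subtractf)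
      then show ?thesis unfolding sum_nonorth_line finite_field_of_nat_card one_def using True by simp
    qed (simp add: co_def one_def)
    ultimately show ?thesis by simp
  qed
  \<comment> \<open>The set \<open>S\<close> includes the zero vector, which spans no point; its
    column is the constant function.\<close>
  have co: "co y \<in> C" if "y \<in> S" for y
  proof (cases "y = 0")
    case True
    have "co y = one" unfolding True co_def one_def nonorth_zero by (auto simp: fun_eq_iff)
    then show ?thesis using one by simp
  qed (use that co_nz S_def in auto)
  obtain \<beta> where \<beta>: "\<forall>l\<in>L. \<forall>l'\<in>L. (\<Sum>y\<in>S. \<beta> l y * G l' y) = (if l = l' then 1 else 0)"
    using lin_indep_dual[OF L finS indG[folded S_def]] by (elim exE)
  have F: "F l x = (\<Sum>y\<in>S. \<beta> l y * nonorth x y)" if l: "l \<in> L" and x: "h x x = 0" for l x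
  proof -
    have "(\<Sum>y\<in>S. \<beta> l y * nonorth x y) = (\<Sum>y\<in>S. \<Sum>l'\<in>L. F l' x * (\<beta> l y * G l' y))"
    proof (intro sum.cong refl)
      fix y assume "y \<in> S"
      then have "nonorth x y = (\<Sum>l\<in>L. F l x * G l y)" unfolding S_def by (intro fac x) simp
      then show "\<beta> l y * nonorth x y = (\<Sum>l'\<in>L. F l' x * (\<beta> l y * G l' y))" by (simp add: sum_distrib_left mult_ac)
    qed
    also have "\<dots> = (\<Sum>l'\<in>L. F l' x * (\<Sum>y\<in>S. \<beta> l y * G l' y))"
      by (subst sum.swap) (simp add: sum_distrib_left)
    also have "\<dots> = (\<Sum>l'\<in>L. if l = l' then F l' x else 0)"
      using \<beta> l by (intro sum.cong refl) auto
    finally show ?thesis using l L by simp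
  qed
  have FC: "FI l \<in> C" if l: "l \<in> L" for l
  proof -
    have "(\<lambda>i. (\<Sum>y\<in>S. \<beta> l y) * one i + (\<Sum>y\<in>S. - \<beta> l y * co y i)) \<in> C"
      by (intro Cadd Csum Cscale one co)
    moreover have "(\<Sum>y\<in>S. \<beta> l y) * one i + (\<Sum>y\<in>S. - \<beta> l y * co y i) = FI l i" for i
    proof (cases "i \<in> I")
      case True
      have "(\<Sum>y\<in>S. - \<beta> l y * co y i) = (\<Sum>y\<in>S. \<beta> l y * nonorth (v i) y) - (\<Sum>y\<in>S. \<beta> l y)"
        unfolding co_def using True by (simp add: right_diff_distrib sum_subtractf sum_negf)
      then show ?thesis unfolding FI_def one_def using True F[OF l v[OF True]] by simp
    qed (simp add: co_def one_def FI_def)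
    ultimately show ?thesis by simp
  qed
  \<comment> \<open>The index \<open>None\<close> stands for the constant function, adjoined to the
    functions \<open>F l\<close>.\<close>
  define N where "N = insert None (Some ` L)"
  define g where "g = (\<lambda>k i. case k of None \<Rightarrow> 1 | Some l \<Rightarrow> F l (v i))"
  have sumN: "(\<Sum>k\<in>N. a k * g k i) = a None + (\<Sum>l\<in>L. a (Some l) * F l (v i))" for a i
  proof -
    have "(\<Sum>k\<in>N. a k * g k i) = a None * g None i + (\<Sum>k\<in>Some ` L. a k * g k i)"
      unfolding N_def using L by (intro sum.insert) auto
    also have "(\<Sum>k\<in>Some ` L. a k * g k i) = (\<Sum>l\<in>L. a (Some l) * F l (v i))"
      by (subst sum.reindex) (auto simp: g_def)
    finally show ?thesis by (simp add: g_def)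
  qed
  have "C = range (lin_comb I N g)"
  proof (rule equalityI; rule subsetI)
    fix x assume "x \<in> C"
    then obtain a where x: "x = lin_comb I J f a" unfolding C_def by (elim rangeE)
    define b where "b = (\<lambda>k. case k of None \<Rightarrow> \<Sum>j\<in>J. a j | Some l \<Rightarrow> - (\<Sum>j\<in>J. a j * G l (w j)))"
    have x': "x = lin_comb I N g b"
    proof
      fix i
      show "x i = lin_comb I N g b i"
      proof (cases "i \<in> I")
        case True
        have "(\<Sum>j\<in>J. a j * f j i) = (\<Sum>j\<in>J. a j - (\<Sum>l\<in>L. a j * G l (w j) * F l (v i)))"
          unfolding f_def
          by (intro sum.cong refl) (simp add: fac[OF v[OF True] w] right_diff_distrib sum_distrib_left mult_ac)
        also have "\<dots> = (\<Sum>j\<in>J. a j) - (\<Sum>l\<in>L. (\<Sum>j\<in>J. a j * G l (w j)) * F l (v i))"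
          unfolding sum_subtractf by (subst sum.swap) (simp add: sum_distrib_right)
        finally show ?thesis unfolding x lin_comb_def sumN using True by (simp add: b_def sum_negf)
      qed (simp add: x lin_comb_def)
    qed
    show "x \<in> range (lin_comb I N g)" unfolding x' by (rule rangeI)
  next
    fix x assume "x \<in> range (lin_comb I N g)"
    then obtain a where x: "x = lin_comb I N g a" by (elim rangeE)
    have x': "x = (\<lambda>i. a None * one i + (\<Sum>l\<in>L. a (Some l) * FI l i))"
      unfolding x lin_comb_def sumN one_def FI_def by (auto simp: fun_eq_iff)
    show "x \<in> C" unfolding x' by (intro Cadd Csum Cscale one FC)
  qed
  moreover have "lin_indep I N g"
    unfolding lin_indep_def
  proof (intro allI impI)
    fix a assume "\<forall>i\<in>I. (\<Sum>k\<in>N. a k * g k i) = 0"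
    then have 0: "a None + (\<Sum>l\<in>L. a (Some l) * F l (v i)) = 0" if "i \<in> I" for i
      using that unfolding sumN by simp
    have 1: "a None + (\<Sum>l\<in>L. a (Some l) * F l x) = 0" if x: "x \<noteq> 0" "h x x = 0" for x
    proof -
      obtain i where i: "i \<in> I" "\<forall>y. nonorth x y = nonorth (v i) y" using rows[OF x] by (elim bexE)
      have "F l x = F l (v i)" if "l \<in> L" for l
        unfolding F[OF that x(2)] F[OF that v[OF i(1)]] using i(2) by simp
      then show ?thesis using 0[OF i(1)] by simp
    qed
    \<comment> \<open>The independence of \<open>F\<close> is assumed on all singular vectors,
      including zero, which no row represents; there the relation holds because every
      \<open>F l\<close> vanishes.\<close>
    have F0: "F l 0 = 0" if "l \<in> L" for l
      using F[OF that, of 0] by (simp add: nonorth_commute[of 0] nonorth_zero h_zero_left)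
    have FW: "(\<Sum>c\<in>UNIV. F l (e + c *s e')) + F l e' = 0" if l: "l \<in> L" for l
    proof -
      have "(\<Sum>c\<in>UNIV. F l (e + c *s e')) + F l e'
          = (\<Sum>c\<in>UNIV. \<Sum>y\<in>S. \<beta> l y * nonorth y (e + c *s e')) + (\<Sum>y\<in>S. \<beta> l y * nonorth y e')"
        by (simp only: F[OF l l0] F[OF l e(2)] nonorth_commute[of "e + _ *s e'"] nonorth_commute[of e'])
      also have "(\<Sum>c\<in>UNIV. \<Sum>y\<in>S. \<beta> l y * nonorth y (e + c *s e')) = (\<Sum>y\<in>S. \<beta> l y * (\<Sum>c\<in>UNIV. nonorth y (e + c *s e')))"
        by (subst sum.swap) (simp add: sum_distrib_left)
      also have "\<dots> + (\<Sum>y\<in>S. \<beta> l y * nonorth y e') = (\<Sum>y\<in>S. \<beta> l y * ((\<Sum>c\<in>UNIV. nonorth y (e + c *s e')) + nonorth y e'))"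
        by (simp add: sum.distrib distrib_left)
      finally show ?thesis unfolding sum_nonorth_line by simp
    qed
    \<comment> \<open>Summing the relation over the isotropic line annihilates the
      \<open>F l\<close> and leaves \<open>CARD('a) + 1 = 1\<close> times the coefficient of the
      constant.\<close>
    have N0: "a None = 0"
    proof -
      have "0 = (\<Sum>c\<in>(UNIV::'a set). a None + (\<Sum>l\<in>L. a (Some l) * F l (e + c *s e'))) + (a None + (\<Sum>l\<in>L. a (Some l) * F l e'))"
        by (simp only: 1[OF l1 l0] 1[OF e(4) e(2)] sum.neutral_const add_0)
      also have "\<dots> = (of_nat (CARD('a)) + 1) * a None + ((\<Sum>c\<in>UNIV. \<Sum>l\<in>L. a (Some l) * F l (e + c *s e')) + (\<Sum>l\<in>L. a (Some l) * F l e'))"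
        by (simp add: sum.distrib distrib_right)
      also have "(\<Sum>c\<in>UNIV. \<Sum>l\<in>L. a (Some l) * F l (e + c *s e')) = (\<Sum>l\<in>L. a (Some l) * (\<Sum>c\<in>UNIV. F l (e + c *s e')))"
        by (subst sum.swap) (simp add: sum_distrib_left)
      also have "\<dots> + (\<Sum>l\<in>L. a (Some l) * F l e') = (\<Sum>l\<in>L. a (Some l) * ((\<Sum>c\<in>UNIV. F l (e + c *s e')) + F l e'))"
        by (simp add: sum.distrib distrib_left)
      finally show ?thesis unfolding finite_field_of_nat_card using FW by simp
    qed
    have "a (Some l) = 0" if l: "l \<in> L" for l
    proof (rule lin_indepD[OF indF _ l])
      fix x assume "x \<in> {v. h v v = 0}"
      then show "(\<Sum>l\<in>L. a (Some l) * F l x) = 0"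
        using 1[of x] N0 F0 by (cases "x = 0") simp_all
    qed
    then show "\<forall>k\<in>N. a k = 0" unfolding N_def using N0 by auto
  qed
  moreover have "finite N" unfolding N_def using L by simp
  moreover have "card N = 1 + card L" unfolding N_def using L by (simp add: card_image)
  ultimately show ?thesis using card_range_lin_comb[of N I g] unfolding C_def f_def by simp
qed

end

section \<open>Points and polar hyperplanes as spans, and the rank of the incidence matrix\<close>

context hermitian_space
begin

lemma singular_points_eq: "singular_points scale h = (\<lambda>v. span {v}) ` {v. v \<noteq> 0 \<and> h v v = 0}"
proof (rule equalityI; rule subsetI)
  fix S assume "S \<in> singular_points scale h"
  then have S: "subspace S" "dim S = 1" "\<And>v. v \<in> S \<Longrightarrow> h v v = 0" unfolding singular_points_def by auto
  obtain B where B: "B \<subseteq> S" "independent B" "S \<subseteq> span B" "card B = dim S"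
    using basis_exists[of S] by blast
  obtain v where v: "B = {v}" using B(4) S(2) card_1_singletonE[of B] by auto
  have "span B \<subseteq> S" by (rule span_minimal[OF B(1) S(1)])
  then have "S = span {v}" using B(3) v by auto
  moreover have "v \<noteq> 0" using B(2) v dependent_zero[of B] by auto
  moreover have "h v v = 0" using S(3) B(1) v by auto
  ultimately show "S \<in> (\<lambda>v. span {v}) ` {v. v \<noteq> 0 \<and> h v v = 0}" by blast
next
  fix S assume "S \<in> (\<lambda>v. span {v}) ` {v. v \<noteq> 0 \<and> h v v = 0}"
  then obtain v where v: "S = span {v}" "v \<noteq> 0" "h v v = 0" by blast
  have "independent {v}" using v(2) by (simp add: dependent_single)
  then have "dim S = 1" unfolding v(1) using dim_span[of "{v}"] dim_eq_card_independent[of "{v}"] by simp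
  moreover have "h u u = 0" if "u \<in> S" for u
    using that v(3) unfolding v(1) span_singleton by (auto simp: h_scale_left h_scale_right)
  ultimately show "S \<in> singular_points scale h" unfolding singular_points_def v(1) using subspace_span by auto
qed

lemma span_subset_perp_iff: "span {v} \<subseteq> perp h (span {w}) \<longleftrightarrow> h v w = 0"
proof
  assume "span {v} \<subseteq> perp h (span {w})"
  then have "v \<in> perp h (span {w})" using span_base[of v "{v}"] by auto
  then have "h w v = 0" unfolding perp_def using span_base[of w "{w}"] by auto
  then show "h v w = 0" using h_eq_0_commute[of v w] by simp
next
  assume "h v w = 0"
  then have "h w v = 0" using h_eq_0_commute[of v w] by simp
  then show "span {v} \<subseteq> perp h (span {w})"
    unfolding perp_def span_singleton by (auto simp: h_scale_left h_scale_right)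
qed

lemma mem_perp_span: "u \<in> perp h (span {w}) \<longleftrightarrow> h u w = 0"
  using h_eq_0_commute[of u w] span_base[of w "{w}"]
  unfolding perp_def span_singleton by (auto simp: h_scale_left)

text \<open>The column space over the large field is counted twice: once with the rank over the
  prime field as exponent, once with exponent \<open>1 + s ^ t\<close>. The representatives
  \<open>v\<close> and \<open>w\<close> are nonzero vectors of the enumerated points and poles, and
  rescaling them leaves \<open>nonorth\<close> unchanged.\<close>

theorem rank_incidence_matrix:
  fixes Ps Hs :: "'v set list" and A :: "'k::{field,finite} mat"
  assumes Ps: "set Ps = singular_points scale h" and Hs: "set Hs = polar_hyperplanes scale h"
    and k: "CARD('k) = p" and A: "A = incidence_matrix Ps Hs"
  obtains s where "vec_space.rank (length Ps) A = 1 + s ^ t"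
    "\<And>m. m < p - 1 \<Longrightarrow> p dvd n + m - 2 \<Longrightarrow>
      s + card (biexpo_pred n (p - 1)) + card (biexpo n m) = card (biexpo n (p - 1)) + card (biexpo_pred n m)"
    "(\<And>m. m < p - 1 \<Longrightarrow> \<not> p dvd n + m - 2) \<Longrightarrow> s + card (biexpo_pred n (p - 1)) = card (biexpo n (p - 1))"
proof -
  obtain L :: "((nat \<Rightarrow> 'a) \<times> (nat \<Rightarrow> 'a)) list set" and F G and s :: nat where L:
    "finite L" "card L = s ^ t" "lin_indep {v. h v v = 0} L F" "lin_indep {v. h v v = 0} L G"
    "\<And>x y. h x x = 0 \<Longrightarrow> h y y = 0 \<Longrightarrow> nonorth x y = (\<Sum>l\<in>L. F l x * G l y)"
    "\<And>m. m < p - 1 \<Longrightarrow> p dvd n + m - 2 \<Longrightarrow>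
      s + card (biexpo_pred n (p - 1)) + card (biexpo n m) = card (biexpo n (p - 1)) + card (biexpo_pred n m)"
    "(\<And>m. m < p - 1 \<Longrightarrow> \<not> p dvd n + m - 2) \<Longrightarrow> s + card (biexpo_pred n (p - 1)) = card (biexpo n (p - 1))"
    by (rule nonorth_factorisation) blast
  let ?nr = "length Ps" and ?nc = "length Hs"
  have "\<exists>v. v \<noteq> 0 \<and> h v v = 0 \<and> Ps ! i = span {v}" if "i < ?nr" for i
  proof -
    have "Ps ! i \<in> singular_points scale h" using nth_mem[OF that] Ps by simp
    then show ?thesis unfolding singular_points_eq by blast
  qed
  then obtain v where v: "\<And>i. i < ?nr \<Longrightarrow> v i \<noteq> 0 \<and> h (v i) (v i) = 0 \<and> Ps ! i = span {v i}" by metis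
  have "\<exists>w. w \<noteq> 0 \<and> h w w = 0 \<and> Hs ! j = perp h (span {w})" if "j < ?nc" for j
  proof -
    have "Hs ! j \<in> perp h ` singular_points scale h" using nth_mem[OF that] Hs unfolding polar_hyperplanes_def by simp
    then show ?thesis unfolding singular_points_eq by blast
  qed
  then obtain w where w: "\<And>j. j < ?nc \<Longrightarrow> w j \<noteq> 0 \<and> h (w j) (w j) = 0 \<and> Hs ! j = perp h (span {w j})" by metis
  have AA: "A \<in> carrier_mat ?nr ?nc" unfolding A incidence_matrix_def by simp
  have Aij: "A $$ (i, j) = (if h (v i) (w j) = 0 then 1 else 0)" if "i < ?nr" "j < ?nc" for i j
    unfolding A incidence_matrix_def using that v[OF that(1)] w[OF that(2)] by (simp add: span_subset_perp_iff)
  have rows: "\<exists>i\<in>{..<?nr}. \<forall>y. nonorth x y = nonorth (v i) y" if x: "x \<noteq> 0" "h x x = 0" for x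
  proof -
    have "span {x} \<in> set Ps" unfolding Ps singular_points_eq using x by blast
    then obtain i where i: "i < ?nr" "Ps ! i = span {x}" by (auto simp: in_set_conv_nth)
    then have "x \<in> span {v i}" using v[OF i(1)] span_base[of x "{x}"] by simp
    then obtain c where c: "x = c *s v i" unfolding span_singleton by auto
    then have "c \<noteq> 0" using x(1) by auto
    then have "nonorth x y = nonorth (v i) y" for y unfolding nonorth_def c h_scale_left by simp
    then show ?thesis using i(1) by (intro bexI[of _ i]) simp_all
  qed
  have cols: "\<exists>j\<in>{..<?nc}. \<forall>x. nonorth x y = nonorth x (w j)" if y: "y \<noteq> 0" "h y y = 0" for y
  proof -
    have "perp h (span {y}) \<in> set Hs" unfolding Hs polar_hyperplanes_def singular_points_eq using y by blast
    then obtain j where j: "j < ?nc" "Hs ! j = perp h (span {y})" by (auto simp: in_set_conv_nth)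
    have "perp h (span {y}) = perp h (span {w j})" using w[OF j(1)] j(2) by simp
    then have "h x y = 0 \<longleftrightarrow> h x (w j) = 0" for x using mem_perp_span[of x y] mem_perp_span[of x "w j"] by simp
    then have "nonorth x y = nonorth x (w j)" for x unfolding nonorth_def by simp
    then show ?thesis using j(1) by (intro bexI[of _ j]) simp_all
  qed
  have "range (lin_comb {..<?nr} {..<?nc} (\<lambda>j i. if A $$ (i, j) = 0 then 0 else (1::'a)))
      = range (lin_comb {..<?nr} {..<?nc} (\<lambda>j i. 1 - nonorth (v i) (w j)))"
  proof -
    have "lin_comb {..<?nr} {..<?nc} (\<lambda>j i. if A $$ (i, j) = 0 then 0 else (1::'a)) a
        = lin_comb {..<?nr} {..<?nc} (\<lambda>j i. 1 - nonorth (v i) (w j)) a" for a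
      unfolding lin_comb_def
      by (rule ext, rule if_cong, rule refl, rule sum.cong) (auto simp: Aij nonorth_def)
    then show ?thesis by simp
  qed
  also have "card \<dots> = CARD('a) ^ (1 + card L)"
    by (rule card_span_of_columns[OF _ _ _ _ rows cols L(1,3,4,5)]) (use v w in auto)
  finally have "CARD('a) ^ vec_space.rank ?nr A = CARD('a) ^ (1 + card L)"
    using card_column_space[OF prime_p k CHAR_p AA] Aij by simp
  moreover have "1 < CARD('a)" using finite_field_card_ge_2[where 'a='a] by simp
  ultimately have rk: "vec_space.rank ?nr A = 1 + card L" by (rule power_inject_exp[THEN iffD1, rotated])
  show ?thesis
  proof (rule that)
    show "vec_space.rank ?nr A = 1 + s ^ t" using rk L(2) by simp
  next
    fix m assume "m < p - 1" "p dvd n + m - 2"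
    then show "s + card (biexpo_pred n (p - 1)) + card (biexpo n m) = card (biexpo n (p - 1)) + card (biexpo_pred n m)"
      by (rule L(6))
  next
    assume "\<And>m. m < p - 1 \<Longrightarrow> \<not> p dvd n + m - 2"
    then show "s + card (biexpo_pred n (p - 1)) = card (biexpo n (p - 1))" by (rule L(7))
  qed
qed

end

theorem theorem1p8:
  fixes p t q n :: nat
    and scale :: "'a::{field,finite} \<Rightarrow> 'v::ab_group_add \<Rightarrow> 'v"
    and h :: "'v \<Rightarrow> 'v \<Rightarrow> 'a"
    and Ps Hs :: "'v set list"
    and A11 :: "'k::{field,finite} mat"
  assumes "prime p" and "t \<ge> 1" and "q = p ^ t"
    and "CARD('a) = q\<^sup>2"
    and "vector_space scale"
    and "vector_space.dim scale (UNIV :: 'v set) = n" and "n \<ge> 4"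
    and "hermitian_form q scale h" and "nondegenerate h"
    and "distinct Ps" and "set Ps = singular_points scale h"
    and "distinct Hs" and "set Hs = polar_hyperplanes scale h"
    and "CARD('k) = p"
    and "A11 = incidence_matrix Ps Hs"
  shows
    "(\<forall>u>0. n - 2 \<le> u * p \<and> u * p \<le> p + n - 4 \<longrightarrow>
      int (vec_space.rank (length Ps) A11) =
        1 + ((int ((n + p - 2) choose (n - 1)))\<^sup>2
             - (int ((n + p - 3) choose (n - 1)))\<^sup>2
             - (int ((u * p + 1) choose (n - 1)))\<^sup>2
             + (int ((u * p) choose (n - 1)))\<^sup>2) ^ t) \<and>
     ((\<nexists>u. u > 0 \<and> n - 2 \<le> u * p \<and> u * p \<le> p + n - 4) \<longrightarrow>
      int (vec_space.rank (length Ps) A11) =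
        1 + ((int ((n + p - 2) choose (n - 1)))\<^sup>2
             - (int ((n + p - 3) choose (n - 1)))\<^sup>2) ^ t)"
proof -
  interpret hermitian_space scale h p t q n
    unfolding hermitian_space_def hermitian_space_axioms_def by (intro conjI assms)
  obtain s where rk: "vec_space.rank (length Ps) A11 = 1 + s ^ t"
    and s1: "\<And>m. m < p - 1 \<Longrightarrow> p dvd n + m - 2 \<Longrightarrow>
      s + card (biexpo_pred n (p - 1)) + card (biexpo n m) = card (biexpo n (p - 1)) + card (biexpo_pred n m)"
    and s2: "(\<And>m. m < p - 1 \<Longrightarrow> \<not> p dvd n + m - 2) \<Longrightarrow> s + card (biexpo_pred n (p - 1)) = card (biexpo n (p - 1))"
    by (rule rank_incidence_matrix[OF assms(11,13,14,15)]) blast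
  have p2: "p \<ge> 2" by (rule prime_ge_2_nat[OF prime_p])
  have b: "card (biexpo n m) = ((n + m - 1) choose (n - 1))\<^sup>2"
    and b': "card (biexpo_pred n m) = ((n + m - 2) choose (n - 1))\<^sup>2" for m
    unfolding biexpo_def biexpo_pred_def using n_ge_4
    by (simp_all add: card_cartesian_product card_expo card_expo_pred power2_eq_square)
  have e: "n + (p - 1) - 1 = n + p - 2" "n + (p - 1) - 2 = n + p - 3" using p2 by simp_all
  show ?thesis
  proof (intro conjI allI impI)
    fix u assume u: "0 < u" "n - 2 \<le> u * p \<and> u * p \<le> p + n - 4"
    \<comment> \<open>The bidegree with \<open>n + m - 2 = u * p\<close>; the bounds on
      \<open>u * p\<close> say exactly that \<open>0 \<le> m \<le> p - 2\<close>.\<close>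
    define m where "m = u * p + 2 - n"
    have m: "n + m - 2 = u * p" "n + m - 1 = u * p + 1" "m < p - 1" using u n_ge_4 p2 unfolding m_def by auto
    have "int (s + ((n + p - 3) choose (n - 1))\<^sup>2 + ((u * p + 1) choose (n - 1))\<^sup>2)
        = int (((n + p - 2) choose (n - 1))\<^sup>2 + ((u * p) choose (n - 1))\<^sup>2)"
      using s1[OF m(3)] unfolding b b' m e by simp
    then have "int s = (int ((n + p - 2) choose (n - 1)))\<^sup>2 - (int ((n + p - 3) choose (n - 1)))\<^sup>2
        - (int ((u * p + 1) choose (n - 1)))\<^sup>2 + (int ((u * p) choose (n - 1)))\<^sup>2"
      unfolding of_nat_add of_nat_power by linarith
    then show "int (vec_space.rank (length Ps) A11) = 1 + ((int ((n + p - 2) choose (n - 1)))\<^sup>2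
        - (int ((n + p - 3) choose (n - 1)))\<^sup>2 - (int ((u * p + 1) choose (n - 1)))\<^sup>2 + (int ((u * p) choose (n - 1)))\<^sup>2) ^ t"
      unfolding rk by (simp only: of_nat_add of_nat_power of_nat_1)
  next
    assume no: "\<nexists>u. u > 0 \<and> n - 2 \<le> u * p \<and> u * p \<le> p + n - 4"
    have "\<not> p dvd n + m - 2" if m: "m < p - 1" for m
    proof
      assume "p dvd n + m - 2"
      then obtain u where u: "n + m - 2 = u * p" by (auto simp: dvd_def mult.commute)
      \<comment> \<open>The number \<open>n + m - 2\<close> is at least two, so it is a positive
        multiple of \<open>p\<close>.\<close>
      have "u > 0" using u n_ge_4 by (cases u) auto
      moreover have "n - 2 \<le> u * p" "u * p \<le> p + n - 4" unfolding u[symmetric] using m n_ge_4 p2 by auto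
      ultimately show False using no by blast
    qed
    then have "s + card (biexpo_pred n (p - 1)) = card (biexpo n (p - 1))" by (rule s2)
    then have "int (s + ((n + p - 3) choose (n - 1))\<^sup>2) = int (((n + p - 2) choose (n - 1))\<^sup>2)"
      unfolding b b' e by simp
    then have "int s = (int ((n + p - 2) choose (n - 1)))\<^sup>2 - (int ((n + p - 3) choose (n - 1)))\<^sup>2"
      unfolding of_nat_add of_nat_power by linarith
    then show "int (vec_space.rank (length Ps) A11) = 1 + ((int ((n + p - 2) choose (n - 1)))\<^sup>2
        - (int ((n + p - 3) choose (n - 1)))\<^sup>2) ^ t"
      unfolding rk by (simp only: of_nat_add of_nat_power of_nat_1)
  qed
qed

end
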